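(* Let $\mathcal{C}$ be a strict monoidal category and $J\in\mathcal{C}$. With the notation of the context, consider the natural transformation $$\zeta_{0,\cdot}:\mathrm{Ev}_{\mathbb{I}}\circ\Gamma\Rightarrow\tilde\Omega:\mathcal{C}[J^{\vee}]\to[\mathcal{C}^{\mathrm{op}},\mathrm{Set}]$$ whose component at $W=(W_0,\dots,W_p)\in\mathcal{C}[J^{\vee}]$ and $A\in\mathcal{C}$ is the function $\Gamma W(A,\mathbb{I})\to\mathcal{C}[J^{\vee}](A,W)$ obtained by composing the canonical isomorphism $$\Gamma W(A,\mathbb{I})\cong\int^{Y_1,\dots,Y_p\in\mathcal{C}}\mathcal{C}(A,W_0\otimes Y_1)\times\mathcal{C}(J\otimes Y_1,W_1\otimes Y_2)\times\dots\times\mathcal{C}(J\otimes Y_p,W_p)$$ with the function taking the equivalence class of $$(A\xrightarrow{f_0}W_0\otimes Y_1,\; J\otimes Y_1\xrightarrow{f_1}W_1\otimes Y_2,\;\dots,\;J\otimes Y_p\xrightarrow{f_p}W_p)$$ to the composite $$A\xrightarrow{f_0}W_0\otimes Y_1\xrightarrow{1\otimes\eta\otimes1}W_0\otimes J^{\vee}\otimes J\otimes Y_1\xrightarrow{1\otimes1\otimes f_1}W_0\otimes J^{\vee}\otimes W_1\otimes Y_2\to\cdots\xrightarrow{1\otimes\eta\otimes1}W_0\otimes J^{\vee}\otimes\dots\otimes W_{p-1}\otimes J^{\vee}\otimes J\otimes Y_p\xrightarrow{1\otimes f_p}W$$ in $\mathcal{C}[J^{\vee}]$. Then $\zeta_{0,\cdot}$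 is invertible.
   Context: Construction of $\mathcal{C}[J^{\vee}]$. Let $\mathcal{C}$ be a strict monoidal category with tensor $\otimes$ and unit $\mathbb{I}$, and let $J\in\mathcal{C}$. Write $[m]=\{0,1,\dots,m\}$. Let $\mathcal{G}_0$ be the set of all functions $U:[m]\to \mathrm{ob}\,\mathcal{C}$ ($m\ge 0$), written $U=(U_0,\dots,U_m)$; objects of $\mathcal{C}$ are identified with functions $[0]\to\mathrm{ob}\,\mathcal{C}$. For $U:[m]\to\mathrm{ob}\,\mathcal{C}$ and $V:[n]\to\mathrm{ob}\,\mathcal{C}$ define $U\otimes V:[m+n]\to\mathrm{ob}\,\mathcal{C}$ by $(U\otimes V)_i=U_i$ for $i<m$, $(U\otimes V)_m=U_m\otimes V_0$, $(U\otimes V)_i=V_{i-m}$ for $i>m$. This makes $\mathcal{G}_0$ a monoid with unit $\mathbb{I}$. Put $J^{\vee}=(\mathbb{I},\mathbb{I}):[1]\to\mathrm{ob}\,\mathcal{C}$; then every $U$ decomposes uniquely as $U=U_0\otimes J^{\vee}\otimes U_1\otimes J^{\vee}\otimes\dots\otimes J^{\vee}\otimes U_m$ with $U_i\in\mathcal{C}$. Let $\mathcal{G}$ be the directed graph with vertex set $\mathcal{G}_0$ and the following edges. The primitive edges are symbols $\varepsilon: J\otimes J^{\vee}\to\mathbb{I}$, $\eta:\mathbb{I}\to J^{\vee}\otimes J$, and $\bar f: C\to D$ for each morphism $f:C\to D$ of $\mathcal{C}$. The general edges are the formal whiskerings $U\otimes p\otimes V: U\otimes A\otimes V\to U\otimes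 B\otimes V$ with $p:A\to B$ primitive and $U,V\in\mathcal{G}_0$ (with $p$ identified with $\mathbb{I}\otimes p\otimes\mathbb{I}$); put $T\otimes(U\otimes p\otimes V)\otimes W=(T\otimes U)\otimes p\otimes(V\otimes W)$ and extend $U\otimes -\otimes V$ to paths edge by edge. Let $\mathcal{F}\mathcal{G}$ be the free category on $\mathcal{G}$, and let $\sim$ be the congruence on $\mathcal{F}\mathcal{G}$ generated by the following relations ($C,D,E,F\in\mathcal{C}$; $U,V,W,X,Y,Z\in\mathcal{G}_0$): (i) $\overline{E\otimes f\otimes F}\sim E\otimes\bar f\otimes F$ for $f\in\mathcal{C}(C,D)$; (ii) $\overline{1_C}\sim 1_C$, and $\overline{gf}\sim\bar g\,\bar f$ for $f\in\mathcal{C}(C,D)$, $g\in\mathcal{C}(D,E)$; (iii) $(V\otimes b)(a\otimes W)\sim(a\otimes X)(U\otimes b)$ for all edges $a:U\to V$, $b:W\to X$; (iv) $(\varepsilon\otimes J)(J\otimes\eta)\sim 1_J$; (v) $(J^{\vee}\otimes\varepsilon)(\eta\otimes J^{\vee})\sim 1_{J^{\vee}}$; (vi) if $\ell\sim\ell'$ is any of the relations (i)–(v), then $Y\otimes\ell\otimes Z\sim Y\otimes\ell'\otimes Z$. Put $\mathcal{C}[J^{\vee}]=\mathcal{F}\mathcal{G}/\sim$. It is strict monoidal: the tensor of objects $U:[m]\to\mathrm{ob}\,\mathcal{C}$ and $V:[n]\to\mathrm{ob}\,\mathcal{C}$ is the product in the monoid $\mathcal{G}_0$, i.e. the function $U\otimes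 V:[m+n]\to\mathrm{ob}\,\mathcal{C}$ with $(U\otimes V)_i=U_i$ for $i<m$, $(U\otimes V)_m=U_m\otimes V_0$, $(U\otimes V)_i=V_{i-m}$ for $i>m$, and for morphisms $[a]\otimes[b]$ is the class of both sides of (iii), extended to paths. The functor $\Omega:\mathcal{C}\to\mathcal{C}[J^{\vee}]$, $\Omega C=C$, $\Omega f=[\bar f]$, is strict monoidal, and $J\dashv J^{\vee}$ in $\mathcal{C}[J^{\vee}]$ with counit $\varepsilon$ and unit $\eta$. Morphisms of $\mathcal{C}$ are regarded as morphisms of $\mathcal{C}[J^{\vee}]$ via $\Omega$. Modules. $\mathrm{Mod}(\mathcal{C},\mathcal{C})=[\mathcal{C}^{\mathrm{op}}\times\mathcal{C},\mathrm{Set}]$ is monoidal under $(N\otimes_{\mathcal{C}}M)(C,A)=\int^{B}M(B,A)\times N(C,B)$ with unit the hom functor $H_{\mathcal{C}}$, $H_{\mathcal{C}}(A',A)=\mathcal{C}(A',A)$. The strong monoidal functor $\Upsilon:\mathcal{C}\to\mathrm{Mod}(\mathcal{C},\mathcal{C})$ is $\Upsilon X(Z,Y)=\mathcal{C}(Z,X\otimes Y)$. Each $\Upsilon X$ has right dual $\Upsilon^{\vee}X$, where $\Upsilon^{\vee}X(Z,Y)=\mathcal{C}(X\otimes Z,Y)$. By the universal property of $\mathcal{C}[J^{\vee}]$ there is a strong monoidal functor $\Gamma:\mathcal{C}[J^{\vee}]\to\mathrm{Mod}(\mathcal{C},\mathcal{C})$ with $\Gamma\Omega\cong\Upsilon$,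 $\Gamma J^{\vee}=\Upsilon^{\vee}J$, and preserving the duality $J\dashv J^{\vee}$, so that $\Gamma\eta:H_{\mathcal{C}}\Rightarrow\Upsilon^{\vee}J\otimes_{\mathcal{C}}\Upsilon J$ at $(X,Z)$ corresponds, under $\int^{Y}\mathcal{C}(J\otimes X,Y)\times\mathcal{C}(Y,J\otimes Z)\cong\mathcal{C}(J\otimes X,J\otimes Z)$, to the function $J\otimes-:\mathcal{C}(X,Z)\to\mathcal{C}(J\otimes X,J\otimes Z)$. The functor $\tilde\Omega:\mathcal{C}[J^{\vee}]\to[\mathcal{C}^{\mathrm{op}},\mathrm{Set}]$ is $\tilde\Omega W=\mathcal{C}[J^{\vee}](\Omega-,W)$, and $\mathrm{Ev}_{\mathbb{I}}:\mathrm{Mod}(\mathcal{C},\mathcal{C})\to[\mathcal{C}^{\mathrm{op}},\mathrm{Set}]$ is $\mathrm{Ev}_{\mathbb{I}}M=M(-,\mathbb{I})$. The canonical isomorphism in the claim comes from $\Gamma W\cong\Upsilon W_0\otimes_{\mathcal{C}}\Upsilon^{\vee}J\otimes_{\mathcal{C}}\Upsilon W_1\otimes_{\mathcal{C}}\dots\otimes_{\mathcal{C}}\Upsilon^{\vee}J\otimes_{\mathcal{C}}\Upsilon W_p$ and the coend form of the Yoneda lemma (for $p=0$ it reads $\Gamma W(A,\mathbb{I})\cong\mathcal{C}(A,W_0)$). *)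

theory Defs
  imports "HOL-Library.FuncSet"
begin

section \<open>Categories, functors, natural transformations\<close>

record ('o, 'm) cat =
  Obj :: "'o set"
  Arr :: "'m set"
  Dom :: "'m \<Rightarrow> 'o"
  Cod :: "'m \<Rightarrow> 'o"
  Id :: "'o \<Rightarrow> 'm"
  Comp :: "'m \<Rightarrow> 'm \<Rightarrow> 'm"  (infixr "\<cdot>\<index>" 70)

definition Hom :: "('o, 'm, 'z) cat_scheme \<Rightarrow> 'o \<Rightarrow> 'o \<Rightarrow> 'm set" where
  "Hom C A B = {f \<in> Arr C. Dom C f = A \<and> Cod C f = B}"

locale category =
  fixes C :: "('o, 'm, 'z) cat_scheme" (structure)
  assumes Dom_Obj: "f \<in> Arr C \<Longrightarrow> Dom C f \<in> Obj C"
    and Cod_Obj: "f \<in> Arr C \<Longrightarrow> Cod C f \<in> Obj C"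
    and Id_Hom: "A \<in> Obj C \<Longrightarrow> Id C A \<in> Hom C A A"
    and Comp_Hom: "\<lbrakk>f \<in> Hom C A B; g \<in> Hom C B D\<rbrakk> \<Longrightarrow> g \<cdot> f \<in> Hom C A D"
    and Comp_Id: "f \<in> Hom C A B \<Longrightarrow> f \<cdot> Id C A = f"
    and Id_Comp: "f \<in> Hom C A B \<Longrightarrow> Id C B \<cdot> f = f"
    and Comp_assoc:
      "\<lbrakk>f \<in> Hom C A B; g \<in> Hom C B D; h \<in> Hom C D E\<rbrakk> \<Longrightarrow> (h \<cdot> g) \<cdot> f = h \<cdot> (g \<cdot> f)"

definition is_inverse :: "('o, 'm, 'z) cat_scheme \<Rightarrow> 'm \<Rightarrow> 'm \<Rightarrow> bool" where
  "is_inverse C f g \<longleftrightarrow> f \<in> Arr C \<and> g \<in> Hom C (Cod C f) (Dom C f) \<and>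
     g \<cdot>\<^bsub>C\<^esub> f = Id C (Dom C f) \<and> f \<cdot>\<^bsub>C\<^esub> g = Id C (Cod C f)"

definition is_iso :: "('o, 'm, 'z) cat_scheme \<Rightarrow> 'm \<Rightarrow> bool" where
  "is_iso C f \<longleftrightarrow> (\<exists>g. is_inverse C f g)"

definition inv_arr :: "('o, 'm, 'z) cat_scheme \<Rightarrow> 'm \<Rightarrow> 'm" where
  "inv_arr C f = (THE g. is_inverse C f g)"

record ('a, 'b, 'c, 'd) func =
  Fo :: "'a \<Rightarrow> 'c"
  Fa :: "'b \<Rightarrow> 'd"

text \<open>Functors are normalised to be \<^const>\<open>undefined\<close> outside their domain, so that
  equality of functors is equality of their values on objects and arrows.\<close>

definition is_functor ::
  "('a, 'b, 'y) cat_scheme \<Rightarrow> ('c, 'd, 'z) cat_scheme \<Rightarrow> ('a, 'b, 'c, 'd) func \<Rightarrow> bool" where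
  "is_functor D E F \<longleftrightarrow>
     Fo F \<in> extensional (Obj D) \<and> Fa F \<in> extensional (Arr D) \<and>
     (\<forall>A \<in> Obj D. Fo F A \<in> Obj E) \<and>
     (\<forall>f \<in> Arr D. Fa F f \<in> Hom E (Fo F (Dom D f)) (Fo F (Cod D f))) \<and>
     (\<forall>A \<in> Obj D. Fa F (Id D A) = Id E (Fo F A)) \<and>
     (\<forall>f \<in> Arr D. \<forall>g \<in> Arr D. Dom D g = Cod D f \<longrightarrow>
        Fa F (g \<cdot>\<^bsub>D\<^esub> f) = Fa F g \<cdot>\<^bsub>E\<^esub> Fa F f)"

definition comp_functor ::
  "('a, 'b, 'z) cat_scheme \<Rightarrow> ('c, 'd, 'e, 'f) func \<Rightarrow> ('a, 'b, 'c, 'd) func \<Rightarrow>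
   ('a, 'b, 'e, 'f) func" where
  "comp_functor D G F =
     \<lparr>Fo = (\<lambda>A \<in> Obj D. Fo G (Fo F A)), Fa = (\<lambda>f \<in> Arr D. Fa G (Fa F f))\<rparr>"

definition nat_trans ::
  "('a, 'b, 'y) cat_scheme \<Rightarrow> ('c, 'd, 'z) cat_scheme \<Rightarrow> ('a, 'b, 'c, 'd) func \<Rightarrow>
   ('a, 'b, 'c, 'd) func \<Rightarrow> ('a \<Rightarrow> 'd) \<Rightarrow> bool" where
  "nat_trans D E F G \<alpha> \<longleftrightarrow>
     (\<forall>A \<in> Obj D. \<alpha> A \<in> Hom E (Fo F A) (Fo G A)) \<and>
     (\<forall>f \<in> Arr D. Fa G f \<cdot>\<^bsub>E\<^esub> \<alpha> (Dom D f) = \<alpha> (Cod D f) \<cdot>\<^bsub>E\<^esub> Fa F f)"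

text \<open>An arrow of a functor category is a triple consisting of the source, the family of
  components, and the target.\<close>

type_synonym ('a, 'b, 'c, 'd) trans =
  "('a, 'b, 'c, 'd) func \<times> ('a \<Rightarrow> 'd) \<times> ('a, 'b, 'c, 'd) func"

definition component :: "('a, 'b, 'c, 'd) trans \<Rightarrow> 'a \<Rightarrow> 'd" where
  "component t = fst (snd t)"

definition functor_cat ::
  "('a, 'b, 'y) cat_scheme \<Rightarrow> ('c, 'd, 'z) cat_scheme \<Rightarrow>
   (('a, 'b, 'c, 'd) func, ('a, 'b, 'c, 'd) trans) cat" where
  "functor_cat D E =
     \<lparr>Obj = {F. is_functor D E F},
      Arr = {(F, \<alpha>, G). is_functor D E F \<and> is_functor D E G \<and> nat_trans D E F G \<alpha> \<and>
                        \<alpha> \<in> extensional (Obj D)},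
      Dom = (\<lambda>(F, \<alpha>, G). F),
      Cod = (\<lambda>(F, \<alpha>, G). G),
      Id = (\<lambda>F. (F, \<lambda>A \<in> Obj D. Id E (Fo F A), F)),
      Comp = (\<lambda>(G', \<beta>, H) (F, \<alpha>, G). (F, \<lambda>A \<in> Obj D. \<beta> A \<cdot>\<^bsub>E\<^esub> \<alpha> A, H))\<rparr>"

definition op_cat :: "('o, 'm, 'z) cat_scheme \<Rightarrow> ('o, 'm) cat" where
  "op_cat C = \<lparr>Obj = Obj C, Arr = Arr C, Dom = Cod C, Cod = Dom C, Id = Id C,
     Comp = (\<lambda>g f. f \<cdot>\<^bsub>C\<^esub> g)\<rparr>"

definition prod_cat ::
  "('a, 'b, 'y) cat_scheme \<Rightarrow> ('c, 'd, 'z) cat_scheme \<Rightarrow> ('a \<times> 'c, 'b \<times> 'd) cat" where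
  "prod_cat C D =
     \<lparr>Obj = Obj C \<times> Obj D, Arr = Arr C \<times> Arr D,
      Dom = (\<lambda>(f, g). (Dom C f, Dom D g)), Cod = (\<lambda>(f, g). (Cod C f, Cod D g)),
      Id = (\<lambda>(A, B). (Id C A, Id D B)),
      Comp = (\<lambda>(f', g') (f, g). (f' \<cdot>\<^bsub>C\<^esub> f, g' \<cdot>\<^bsub>D\<^esub> g))\<rparr>"

type_synonym 'u set_arrow = "'u set \<times> ('u \<Rightarrow> 'u) \<times> 'u set"

definition app :: "'u set_arrow \<Rightarrow> 'u \<Rightarrow> 'u" where
  "app t = fst (snd t)"

definition mk_fun :: "'u set \<Rightarrow> ('u \<Rightarrow> 'u) \<Rightarrow> 'u set \<Rightarrow> 'u set_arrow" where
  "mk_fun X f Y = (X, restrict f X, Y)"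

text \<open>The category of sets with elements in the type \<^typ>\<open>'u\<close>.\<close>

definition set_cat :: "('u set, 'u set_arrow) cat" where
  "set_cat =
     \<lparr>Obj = UNIV,
      Arr = {(X, f, Y). f \<in> X \<rightarrow>\<^sub>E Y},
      Dom = (\<lambda>(X, f, Y). X),
      Cod = (\<lambda>(X, f, Y). Y),
      Id = (\<lambda>X. mk_fun X (\<lambda>x. x) X),
      Comp = (\<lambda>(Y', g, Z) (X, f, Y). mk_fun X (\<lambda>x. g (f x)) Z)\<rparr>"

section \<open>Monoidal categories and strong monoidal functors\<close>

record ('o, 'm) smcat = "('o, 'm) cat" +
  tob :: "'o \<Rightarrow> 'o \<Rightarrow> 'o"  (infixr "\<otimes>\<index>" 75)
  tar :: "'m \<Rightarrow> 'm \<Rightarrow> 'm"  (infixr "\<star>\<index>" 75)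
  unit_ob :: 'o  ("\<one>\<index>")

locale strict_monoidal_category = category +
  assumes unit_Obj: "\<one> \<in> Obj C"
    and tob_Obj: "\<lbrakk>A \<in> Obj C; B \<in> Obj C\<rbrakk> \<Longrightarrow> A \<otimes> B \<in> Obj C"
    and tar_Hom: "\<lbrakk>f \<in> Hom C A B; f' \<in> Hom C A' B'\<rbrakk> \<Longrightarrow> f \<star> f' \<in> Hom C (A \<otimes> A') (B \<otimes> B')"
    and tar_Id: "\<lbrakk>A \<in> Obj C; B \<in> Obj C\<rbrakk> \<Longrightarrow> Id C A \<star> Id C B = Id C (A \<otimes> B)"
    and tar_Comp: "\<lbrakk>f \<in> Hom C A B; g \<in> Hom C B D; f' \<in> Hom C A' B'; g' \<in> Hom C B' D'\<rbrakk>
      \<Longrightarrow> (g \<cdot> f) \<star> (g' \<cdot> f') = (g \<star> g') \<cdot> (f \<star> f')"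
    and tob_assoc: "\<lbrakk>A \<in> Obj C; B \<in> Obj C; D \<in> Obj C\<rbrakk> \<Longrightarrow> (A \<otimes> B) \<otimes> D = A \<otimes> (B \<otimes> D)"
    and unit_tob: "A \<in> Obj C \<Longrightarrow> \<one> \<otimes> A = A"
    and tob_unit: "A \<in> Obj C \<Longrightarrow> A \<otimes> \<one> = A"
    and tar_assoc: "\<lbrakk>f \<in> Arr C; g \<in> Arr C; h \<in> Arr C\<rbrakk> \<Longrightarrow> (f \<star> g) \<star> h = f \<star> (g \<star> h)"
    and unit_tar: "f \<in> Arr C \<Longrightarrow> Id C \<one> \<star> f = f"
    and tar_unit: "f \<in> Arr C \<Longrightarrow> f \<star> Id C \<one> = f"

record ('o, 'm) moncat = "('o, 'm) smcat" +
  assoc :: "'o \<Rightarrow> 'o \<Rightarrow> 'o \<Rightarrow> 'm"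
  lunit :: "'o \<Rightarrow> 'm"
  runit :: "'o \<Rightarrow> 'm"

text \<open>Strong monoidal functors from a strict monoidal category \<open>D\<close> to a monoidal category
  \<open>V\<close>, with structure isomorphisms \<open>\<phi> U W : F U \<otimes> F W \<rightarrow> F (U \<otimes> W)\<close> and
  \<open>\<phi>0 : \<one> \<rightarrow> F \<one>\<close>. The associators of \<open>V\<close> are directed \<open>(A \<otimes> B) \<otimes> C \<rightarrow> A \<otimes> (B \<otimes> C)\<close>.\<close>

definition strong_monoidal_functor ::
  "('a, 'b, 'y) smcat_scheme \<Rightarrow> ('c, 'd, 'z) moncat_scheme \<Rightarrow> ('a, 'b, 'c, 'd) func \<Rightarrow>
   ('a \<Rightarrow> 'a \<Rightarrow> 'd) \<Rightarrow> 'd \<Rightarrow> bool" where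
  "strong_monoidal_functor D V F \<phi> \<phi>0 \<longleftrightarrow>
     is_functor D V F \<and>
     (\<forall>U \<in> Obj D. \<forall>W \<in> Obj D.
        \<phi> U W \<in> Hom V (Fo F U \<otimes>\<^bsub>V\<^esub> Fo F W) (Fo F (U \<otimes>\<^bsub>D\<^esub> W)) \<and> is_iso V (\<phi> U W)) \<and>
     \<phi>0 \<in> Hom V \<one>\<^bsub>V\<^esub> (Fo F \<one>\<^bsub>D\<^esub>) \<and> is_iso V \<phi>0 \<and>
     (\<forall>f \<in> Arr D. \<forall>g \<in> Arr D.
        Fa F (f \<star>\<^bsub>D\<^esub> g) \<cdot>\<^bsub>V\<^esub> \<phi> (Dom D f) (Dom D g)
          = \<phi> (Cod D f) (Cod D g) \<cdot>\<^bsub>V\<^esub> (Fa F f \<star>\<^bsub>V\<^esub> Fa F g)) \<and>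
     (\<forall>T \<in> Obj D. \<forall>U \<in> Obj D. \<forall>W \<in> Obj D.
        \<phi> (T \<otimes>\<^bsub>D\<^esub> U) W \<cdot>\<^bsub>V\<^esub> (\<phi> T U \<star>\<^bsub>V\<^esub> Id V (Fo F W))
          = \<phi> T (U \<otimes>\<^bsub>D\<^esub> W) \<cdot>\<^bsub>V\<^esub> (Id V (Fo F T) \<star>\<^bsub>V\<^esub> \<phi> U W) \<cdot>\<^bsub>V\<^esub>
              assoc V (Fo F T) (Fo F U) (Fo F W)) \<and>
     (\<forall>U \<in> Obj D. \<phi> \<one>\<^bsub>D\<^esub> U \<cdot>\<^bsub>V\<^esub> (\<phi>0 \<star>\<^bsub>V\<^esub> Id V (Fo F U)) = lunit V (Fo F U)) \<and>
     (\<forall>U \<in> Obj D. \<phi> U \<one>\<^bsub>D\<^esub> \<cdot>\<^bsub>V\<^esub> (Id V (Fo F U) \<star>\<^bsub>V\<^esub> \<phi>0) = runit V (Fo F U))"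

text \<open>Monoidal natural isomorphisms \<open>(F, \<phi>, \<phi>0) \<cong> (G, \<psi>, \<psi>0)\<close>.\<close>

definition monoidal_nat_iso ::
  "('a, 'b, 'y) smcat_scheme \<Rightarrow> ('c, 'd, 'z) moncat_scheme \<Rightarrow>
   ('a, 'b, 'c, 'd) func \<Rightarrow> ('a \<Rightarrow> 'a \<Rightarrow> 'd) \<Rightarrow> 'd \<Rightarrow>
   ('a, 'b, 'c, 'd) func \<Rightarrow> ('a \<Rightarrow> 'a \<Rightarrow> 'd) \<Rightarrow> 'd \<Rightarrow> ('a \<Rightarrow> 'd) \<Rightarrow> bool" where
  "monoidal_nat_iso D V F \<phi> \<phi>0 G \<psi> \<psi>0 \<theta> \<longleftrightarrow>
     nat_trans D V F G \<theta> \<and>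
     (\<forall>X \<in> Obj D. is_iso V (\<theta> X)) \<and>
     (\<forall>X \<in> Obj D. \<forall>Y \<in> Obj D.
        \<theta> (X \<otimes>\<^bsub>D\<^esub> Y) \<cdot>\<^bsub>V\<^esub> \<phi> X Y = \<psi> X Y \<cdot>\<^bsub>V\<^esub> (\<theta> X \<star>\<^bsub>V\<^esub> \<theta> Y)) \<and>
     \<theta> \<one>\<^bsub>D\<^esub> \<cdot>\<^bsub>V\<^esub> \<phi>0 = \<psi>0"

section \<open>Quotients of categories\<close>

definition equiv_closure :: "'a set \<Rightarrow> ('a \<times> 'a) set \<Rightarrow> ('a \<times> 'a) set" where
  "equiv_closure S R = (R \<union> R\<inverse>)\<^sup>* \<inter> (S \<times> S)"

inductive_set congruence ::
  "('o, 'm, 'z) cat_scheme \<Rightarrow> ('m \<times> 'm) set \<Rightarrow> ('m \<times> 'm) set"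
  for F :: "('o, 'm, 'z) cat_scheme" and R :: "('m \<times> 'm) set" where
  gen: "(p, q) \<in> R \<Longrightarrow> (p, q) \<in> congruence F R"
| refl: "p \<in> Arr F \<Longrightarrow> (p, p) \<in> congruence F R"
| sym: "(p, q) \<in> congruence F R \<Longrightarrow> (q, p) \<in> congruence F R"
| trans: "\<lbrakk>(p, q) \<in> congruence F R; (q, r) \<in> congruence F R\<rbrakk> \<Longrightarrow> (p, r) \<in> congruence F R"
| comp: "\<lbrakk>(p, p') \<in> congruence F R; (q, q') \<in> congruence F R; Dom F q = Cod F p\<rbrakk>
    \<Longrightarrow> (q \<cdot>\<^bsub>F\<^esub> p, q' \<cdot>\<^bsub>F\<^esub> p') \<in> congruence F R"

definition rep :: "'a set \<Rightarrow> 'a" where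
  "rep c = (SOME p. p \<in> c)"

definition quot_cat ::
  "('o, 'm, 'z) cat_scheme \<Rightarrow> ('m \<times> 'm) set \<Rightarrow> ('o, 'm set) cat" where
  "quot_cat F r =
     \<lparr>Obj = Obj F,
      Arr = Arr F // r,
      Dom = (\<lambda>c. Dom F (rep c)),
      Cod = (\<lambda>c. Cod F (rep c)),
      Id = (\<lambda>A. r `` {Id F A}),
      Comp = (\<lambda>d c. r `` {rep d \<cdot>\<^bsub>F\<^esub> rep c})\<rparr>"

section \<open>Adjoining a right dual\<close>

text \<open>A function \<open>U : [m] \<rightarrow> ob C\<close> is represented by the nonempty list
  \<open>[U\<^sub>0, \<dots>, U\<^sub>m]\<close>, and an object \<open>A\<close> of \<open>C\<close> by \<open>[A]\<close>.\<close>

definition words :: "('o, 'm, 'z) cat_scheme \<Rightarrow> 'o list set" where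
  "words C = {U. U \<noteq> [] \<and> set U \<subseteq> Obj C}"

definition wtensor :: "('o, 'm, 'z) smcat_scheme \<Rightarrow> 'o list \<Rightarrow> 'o list \<Rightarrow> 'o list" where
  "wtensor C U V = butlast U @ (last U \<otimes>\<^bsub>C\<^esub> hd V) # tl V"

definition wunit :: "('o, 'm, 'z) smcat_scheme \<Rightarrow> 'o list" where
  "wunit C = [\<one>\<^bsub>C\<^esub>]"

definition Jdual :: "('o, 'm, 'z) smcat_scheme \<Rightarrow> 'o list" where
  "Jdual C = [\<one>\<^bsub>C\<^esub>, \<one>\<^bsub>C\<^esub>]"

datatype 'm prim = Eps | Eta | Bar 'm

text \<open>The edge \<open>(U, p, V)\<close> is the formal whiskering \<open>U \<otimes> p \<otimes> V\<close>. A path is a triple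
  consisting of its source, the list of its edges in order of traversal, and its target.\<close>

type_synonym ('o, 'm) edge = "'o list \<times> 'm prim \<times> 'o list"
type_synonym ('o, 'm) path = "'o list \<times> ('o, 'm) edge list \<times> 'o list"

fun psrc :: "('o, 'm, 'z) smcat_scheme \<Rightarrow> 'o \<Rightarrow> 'm prim \<Rightarrow> 'o list" where
  "psrc C J Eps = wtensor C [J] (Jdual C)"
| "psrc C J Eta = wunit C"
| "psrc C J (Bar f) = [Dom C f]"

fun ptgt :: "('o, 'm, 'z) smcat_scheme \<Rightarrow> 'o \<Rightarrow> 'm prim \<Rightarrow> 'o list" where
  "ptgt C J Eps = wunit C"
| "ptgt C J Eta = wtensor C (Jdual C) [J]"
| "ptgt C J (Bar f) = [Cod C f]"

definition edges :: "('o, 'm, 'z) smcat_scheme \<Rightarrow> ('o, 'm) edge set" where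
  "edges C = words C \<times> ({Eps, Eta} \<union> Bar ` Arr C) \<times> words C"

definition esrc :: "('o, 'm, 'z) smcat_scheme \<Rightarrow> 'o \<Rightarrow> ('o, 'm) edge \<Rightarrow> 'o list" where
  "esrc C J e = (case e of (U, p, V) \<Rightarrow> wtensor C U (wtensor C (psrc C J p) V))"

definition etgt :: "('o, 'm, 'z) smcat_scheme \<Rightarrow> 'o \<Rightarrow> ('o, 'm) edge \<Rightarrow> 'o list" where
  "etgt C J e = (case e of (U, p, V) \<Rightarrow> wtensor C U (wtensor C (ptgt C J p) V))"

fun is_path ::
  "('o, 'm, 'z) smcat_scheme \<Rightarrow> 'o \<Rightarrow> 'o list \<Rightarrow> ('o, 'm) edge list \<Rightarrow> 'o list \<Rightarrow> bool" where
  "is_path C J U [] V \<longleftrightarrow> U = V"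
| "is_path C J U (e # es) V \<longleftrightarrow> e \<in> edges C \<and> esrc C J e = U \<and> is_path C J (etgt C J e) es V"

definition free_cat :: "('o, 'm, 'z) smcat_scheme \<Rightarrow> 'o \<Rightarrow> ('o list, ('o, 'm) path) cat" where
  "free_cat C J =
     \<lparr>Obj = words C,
      Arr = {(U, es, V). U \<in> words C \<and> V \<in> words C \<and> is_path C J U es V},
      Dom = (\<lambda>(U, es, V). U),
      Cod = (\<lambda>(U, es, V). V),
      Id = (\<lambda>U. (U, [], U)),
      Comp = (\<lambda>(V', es', W) (U, es, V). (U, es @ es', W))\<rparr>"

definition epath :: "('o, 'm, 'z) smcat_scheme \<Rightarrow> 'o \<Rightarrow> ('o, 'm) edge \<Rightarrow> ('o, 'm) path" where
  "epath C J e = (esrc C J e, [e], etgt C J e)"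

definition ewhisker ::
  "('o, 'm, 'z) smcat_scheme \<Rightarrow> 'o list \<Rightarrow> ('o, 'm) edge \<Rightarrow> 'o list \<Rightarrow> ('o, 'm) edge" where
  "ewhisker C T e W = (case e of (U, p, V) \<Rightarrow> (wtensor C T U, p, wtensor C V W))"

definition whisker ::
  "('o, 'm, 'z) smcat_scheme \<Rightarrow> 'o list \<Rightarrow> ('o, 'm) path \<Rightarrow> 'o list \<Rightarrow> ('o, 'm) path" where
  "whisker C T x W = (case x of (A, es, B) \<Rightarrow>
     (wtensor C T (wtensor C A W), map (\<lambda>e. ewhisker C T e W) es, wtensor C T (wtensor C B W)))"

inductive_set base_rel ::
  "('o, 'm, 'z) smcat_scheme \<Rightarrow> 'o \<Rightarrow> (('o, 'm) path \<times> ('o, 'm) path) set"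
  for C :: "('o, 'm, 'z) smcat_scheme" and J :: 'o where
  bar_whisker: "\<lbrakk>E \<in> Obj C; f \<in> Arr C; F \<in> Obj C\<rbrakk> \<Longrightarrow>
    (epath C J (wunit C, Bar (Id C E \<star>\<^bsub>C\<^esub> f \<star>\<^bsub>C\<^esub> Id C F), wunit C),
     epath C J ([E], Bar f, [F])) \<in> base_rel C J"
| bar_Id: "A \<in> Obj C \<Longrightarrow>
    (epath C J (wunit C, Bar (Id C A), wunit C), Id (free_cat C J) [A]) \<in> base_rel C J"
| bar_Comp: "\<lbrakk>f \<in> Arr C; g \<in> Arr C; Dom C g = Cod C f\<rbrakk> \<Longrightarrow>
    (epath C J (wunit C, Bar (g \<cdot>\<^bsub>C\<^esub> f), wunit C),
     epath C J (wunit C, Bar g, wunit C) \<cdot>\<^bsub>free_cat C J\<^esub> epath C J (wunit C, Bar f, wunit C))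
    \<in> base_rel C J"
| interchange: "\<lbrakk>a \<in> edges C; esrc C J a = U; etgt C J a = V;
                 b \<in> edges C; esrc C J b = W; etgt C J b = X\<rbrakk> \<Longrightarrow>
    (epath C J (ewhisker C V b (wunit C)) \<cdot>\<^bsub>free_cat C J\<^esub> epath C J (ewhisker C (wunit C) a W),
     epath C J (ewhisker C (wunit C) a X) \<cdot>\<^bsub>free_cat C J\<^esub> epath C J (ewhisker C U b (wunit C)))
    \<in> base_rel C J"
| triangle_J:
    "(epath C J (wunit C, Eps, [J]) \<cdot>\<^bsub>free_cat C J\<^esub> epath C J ([J], Eta, wunit C),
      Id (free_cat C J) [J]) \<in> base_rel C J"
| triangle_Jdual:
    "(epath C J (Jdual C, Eps, wunit C) \<cdot>\<^bsub>free_cat C J\<^esub> epath C J (wunit C, Eta, Jdual C),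
      Id (free_cat C J) (Jdual C)) \<in> base_rel C J"

definition adj_rel ::
  "('o, 'm, 'z) smcat_scheme \<Rightarrow> 'o \<Rightarrow> (('o, 'm) path \<times> ('o, 'm) path) set" where
  "adj_rel C J = congruence (free_cat C J)
     (base_rel C J \<union>
      {(whisker C Y p Z, whisker C Y q Z) | Y p q Z.
         Y \<in> words C \<and> (p, q) \<in> base_rel C J \<and> Z \<in> words C})"

definition ptensor ::
  "('o, 'm, 'z) smcat_scheme \<Rightarrow> 'o \<Rightarrow> ('o, 'm) path \<Rightarrow> ('o, 'm) path \<Rightarrow> ('o, 'm) path" where
  "ptensor C J a b =
     whisker C (Cod (free_cat C J) a) b (wunit C) \<cdot>\<^bsub>free_cat C J\<^esub>
     whisker C (wunit C) a (Dom (free_cat C J) b)"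

text \<open>The strict monoidal category \<open>C[J\<^sup>\<or>]\<close>.\<close>

definition adjoin_dual ::
  "('o, 'm, 'z) smcat_scheme \<Rightarrow> 'o \<Rightarrow> ('o list, ('o, 'm) path set) smcat" where
  "adjoin_dual C J = (let Q = quot_cat (free_cat C J) (adj_rel C J) in
     \<lparr>Obj = Obj Q, Arr = Arr Q, Dom = Dom Q, Cod = Cod Q, Id = Id Q, Comp = Comp Q,
      tob = wtensor C,
      tar = (\<lambda>c d. adj_rel C J `` {ptensor C J (rep c) (rep d)}),
      unit_ob = wunit C\<rparr>)"

definition edge_class ::
  "('o, 'm, 'z) smcat_scheme \<Rightarrow> 'o \<Rightarrow> 'm prim \<Rightarrow> ('o, 'm) path set" where
  "edge_class C J p = adj_rel C J `` {epath C J (wunit C, p, wunit C)}"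

definition Omega ::
  "('o, 'm, 'z) smcat_scheme \<Rightarrow> 'o \<Rightarrow> ('o, 'm, 'o list, ('o, 'm) path set) func" where
  "Omega C J = \<lparr>Fo = (\<lambda>A \<in> Obj C. [A]), Fa = (\<lambda>f \<in> Arr C. edge_class C J (Bar f))\<rparr>"

section \<open>Modules\<close>

text \<open>The universe of elements of sets. It contains the arrows of \<open>C\<close> and of \<open>C[J\<^sup>\<or>]\<close>, and is
  closed under pairing and under tagging with an object of \<open>C\<close>, which suffices to form coends
  over \<open>C\<close>: the class of \<open>x \<in> P B B\<close> in \<open>\<integral>\<^sup>B P B B\<close> is represented by a chosen element
  \<open>At B' x'\<close> of this class. This keeps all sets, and in particular all iterated tensor products
  of modules, in one type.\<close>

datatype ('o, 'm) elt =
    Mor 'm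
  | DMor "('o, 'm) path set"
  | Pr "('o, 'm) elt" "('o, 'm) elt"
  | At 'o "('o, 'm) elt"

type_synonym ('o, 'm) sarr = "('o, 'm) elt set_arrow"
type_synonym ('o, 'm) psh = "('o, 'm, ('o, 'm) elt set, ('o, 'm) sarr) func"
type_synonym ('o, 'm) psh_arr = "('o, 'm, ('o, 'm) elt set, ('o, 'm) sarr) trans"
type_synonym ('o, 'm) bimod = "('o \<times> 'o, 'm \<times> 'm, ('o, 'm) elt set, ('o, 'm) sarr) func"
type_synonym ('o, 'm) mod_arr = "('o \<times> 'o, 'm \<times> 'm, ('o, 'm) elt set, ('o, 'm) sarr) trans"

text \<open>Coends of functors \<open>P : C\<^sup>o\<^sup>p \<times> C \<rightarrow> Set\<close>.\<close>

definition coend_sum :: "('o, 'm, 'z) cat_scheme \<Rightarrow> ('o, 'm) bimod \<Rightarrow> ('o, 'm) elt set" where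
  "coend_sum C P = {At B x | B x. B \<in> Obj C \<and> x \<in> Fo P (B, B)}"

definition coend_rel ::
  "('o, 'm, 'z) cat_scheme \<Rightarrow> ('o, 'm) bimod \<Rightarrow> (('o, 'm) elt \<times> ('o, 'm) elt) set" where
  "coend_rel C P = equiv_closure (coend_sum C P)
     {(At B (app (Fa P (h, Id C B)) x), At B' (app (Fa P (Id C B', h)) x)) | B B' h x.
        h \<in> Hom C B B' \<and> x \<in> Fo P (B', B)}"

definition coend_class ::
  "('o, 'm, 'z) cat_scheme \<Rightarrow> ('o, 'm) bimod \<Rightarrow> ('o, 'm) elt \<Rightarrow> ('o, 'm) elt" where
  "coend_class C P x = rep (coend_rel C P `` {x})"

definition coend :: "('o, 'm, 'z) cat_scheme \<Rightarrow> ('o, 'm) bimod \<Rightarrow> ('o, 'm) elt set" where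
  "coend C P = coend_class C P ` coend_sum C P"

abbreviation bi_cat :: "('o, 'm, 'z) cat_scheme \<Rightarrow> ('o \<times> 'o, 'm \<times> 'm) cat" where
  "bi_cat C \<equiv> prod_cat (op_cat C) C"

definition act :: "('o, 'm) bimod \<Rightarrow> 'm \<Rightarrow> 'm \<Rightarrow> ('o, 'm) elt \<Rightarrow> ('o, 'm) elt" where
  "act M h k = app (Fa M (h, k))"

definition mk_mod ::
  "('o, 'm, 'z) cat_scheme \<Rightarrow> ('o \<Rightarrow> 'o \<Rightarrow> ('o, 'm) elt set) \<Rightarrow>
   ('m \<Rightarrow> 'm \<Rightarrow> ('o, 'm) elt \<Rightarrow> ('o, 'm) elt) \<Rightarrow> ('o, 'm) bimod" where
  "mk_mod C S a =
     \<lparr>Fo = (\<lambda>(X, A) \<in> Obj (bi_cat C). S X A),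
      Fa = (\<lambda>(h, k) \<in> Arr (bi_cat C).
              mk_fun (S (Cod C h) (Dom C k)) (a h k) (S (Dom C h) (Cod C k)))\<rparr>"

definition mk_mod_arr ::
  "('o, 'm, 'z) cat_scheme \<Rightarrow> ('o, 'm) bimod \<Rightarrow>
   ('o \<Rightarrow> 'o \<Rightarrow> ('o, 'm) elt \<Rightarrow> ('o, 'm) elt) \<Rightarrow> ('o, 'm) bimod \<Rightarrow> ('o, 'm) mod_arr" where
  "mk_mod_arr C M t N =
     (M, \<lambda>(X, A) \<in> Obj (bi_cat C). mk_fun (Fo M (X, A)) (t X A) (Fo N (X, A)), N)"

text \<open>The integrand \<open>(B', B) \<mapsto> M (B', A) \<times> N (X, B)\<close> of
  \<open>(N \<otimes> M) (X, A) = \<integral>\<^sup>B M (B, A) \<times> N (X, B)\<close>.\<close>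

definition integrand ::
  "('o, 'm, 'z) cat_scheme \<Rightarrow> ('o, 'm) bimod \<Rightarrow> ('o, 'm) bimod \<Rightarrow> 'o \<Rightarrow> 'o \<Rightarrow> ('o, 'm) bimod" where
  "integrand C N M X A = mk_mod C
     (\<lambda>B' B. {Pr m n | m n. m \<in> Fo M (B', A) \<and> n \<in> Fo N (X, B)})
     (\<lambda>h k z. case z of Pr m n \<Rightarrow> Pr (act M h (Id C A) m) (act N (Id C X) k n))"

definition mod_tensor ::
  "('o, 'm, 'z) cat_scheme \<Rightarrow> ('o, 'm) bimod \<Rightarrow> ('o, 'm) bimod \<Rightarrow> ('o, 'm) bimod" where
  "mod_tensor C N M = mk_mod C
     (\<lambda>X A. coend C (integrand C N M X A))
     (\<lambda>h k z. case z of At B (Pr m n) \<Rightarrow>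
        coend_class C (integrand C N M (Dom C h) (Cod C k))
          (At B (Pr (act M (Id C B) k m) (act N h (Id C B) n))))"

definition mod_hom :: "('o, 'm, 'z) cat_scheme \<Rightarrow> ('o, 'm) bimod" where
  "mod_hom C = mk_mod C
     (\<lambda>X A. Mor ` Hom C X A)
     (\<lambda>h k z. case z of Mor f \<Rightarrow> Mor (k \<cdot>\<^bsub>C\<^esub> f \<cdot>\<^bsub>C\<^esub> h))"

definition mod_tensor_arr ::
  "('o, 'm, 'z) cat_scheme \<Rightarrow> ('o, 'm) mod_arr \<Rightarrow> ('o, 'm) mod_arr \<Rightarrow> ('o, 'm) mod_arr" where
  "mod_tensor_arr C = (\<lambda>(N, \<beta>, N') (M, \<alpha>, M').
     mk_mod_arr C (mod_tensor C N M)
       (\<lambda>X A z. case z of At B (Pr m n) \<Rightarrow>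
          coend_class C (integrand C N' M' X A)
            (At B (Pr (app (\<alpha> (B, A)) m) (app (\<beta> (X, B)) n))))
       (mod_tensor C N' M'))"

definition mod_assoc ::
  "('o, 'm, 'z) cat_scheme \<Rightarrow> ('o, 'm) bimod \<Rightarrow> ('o, 'm) bimod \<Rightarrow> ('o, 'm) bimod \<Rightarrow> ('o, 'm) mod_arr"
  where
  "mod_assoc C L N M =
     mk_mod_arr C (mod_tensor C (mod_tensor C L N) M)
       (\<lambda>X A z. case z of At B (Pr m (At D (Pr n l))) \<Rightarrow>
          coend_class C (integrand C L (mod_tensor C N M) X A)
            (At D (Pr (coend_class C (integrand C N M D A) (At B (Pr m n))) l)))
       (mod_tensor C L (mod_tensor C N M))"

definition mod_lunit :: "('o, 'm, 'z) cat_scheme \<Rightarrow> ('o, 'm) bimod \<Rightarrow> ('o, 'm) mod_arr" where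
  "mod_lunit C M = mk_mod_arr C (mod_tensor C (mod_hom C) M)
     (\<lambda>X A z. case z of At B (Pr m (Mor f)) \<Rightarrow> act M f (Id C A) m) M"

definition mod_runit :: "('o, 'm, 'z) cat_scheme \<Rightarrow> ('o, 'm) bimod \<Rightarrow> ('o, 'm) mod_arr" where
  "mod_runit C N = mk_mod_arr C (mod_tensor C N (mod_hom C))
     (\<lambda>X A z. case z of At B (Pr (Mor g) n) \<Rightarrow> act N (Id C X) g n) N"

definition psh_cat ::
  "('o, 'm, 'z) cat_scheme \<Rightarrow> (('o, 'm) psh, ('o, 'm) psh_arr) cat" where
  "psh_cat C = functor_cat (op_cat C) set_cat"

definition Mod :: "('o, 'm, 'z) cat_scheme \<Rightarrow> (('o, 'm) bimod, ('o, 'm) mod_arr) moncat" where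
  "Mod C = (let F = functor_cat (bi_cat C) set_cat in
     \<lparr>Obj = Obj F, Arr = Arr F, Dom = Dom F, Cod = Cod F, Id = Id F, Comp = Comp F,
      tob = mod_tensor C, tar = mod_tensor_arr C, unit_ob = mod_hom C,
      assoc = mod_assoc C, lunit = mod_lunit C, runit = mod_runit C\<rparr>)"

text \<open>The strong monoidal functor \<open>\<Upsilon>\<close> with its structure isomorphisms.\<close>

definition Ups_ob :: "('o, 'm, 'z) smcat_scheme \<Rightarrow> 'o \<Rightarrow> ('o, 'm) bimod" where
  "Ups_ob C X = mk_mod C
     (\<lambda>Z Y. Mor ` Hom C Z (X \<otimes>\<^bsub>C\<^esub> Y))
     (\<lambda>h k z. case z of Mor f \<Rightarrow> Mor ((Id C X \<star>\<^bsub>C\<^esub> k) \<cdot>\<^bsub>C\<^esub> f \<cdot>\<^bsub>C\<^esub> h))"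

definition Ups :: "('o, 'm, 'z) smcat_scheme \<Rightarrow> ('o, 'm, ('o, 'm) bimod, ('o, 'm) mod_arr) func"
  where
  "Ups C =
     \<lparr>Fo = (\<lambda>X \<in> Obj C. Ups_ob C X),
      Fa = (\<lambda>u \<in> Arr C. mk_mod_arr C (Ups_ob C (Dom C u))
              (\<lambda>Z Y z. case z of Mor f \<Rightarrow> Mor ((u \<star>\<^bsub>C\<^esub> Id C Y) \<cdot>\<^bsub>C\<^esub> f))
              (Ups_ob C (Cod C u)))\<rparr>"

definition Ups_mult :: "('o, 'm, 'z) smcat_scheme \<Rightarrow> 'o \<Rightarrow> 'o \<Rightarrow> ('o, 'm) mod_arr" where
  "Ups_mult C X Y = mk_mod_arr C (mod_tensor C (Ups_ob C X) (Ups_ob C Y))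
     (\<lambda>Z A z. case z of At B (Pr (Mor g) (Mor f)) \<Rightarrow> Mor ((Id C X \<star>\<^bsub>C\<^esub> g) \<cdot>\<^bsub>C\<^esub> f))
     (Ups_ob C (X \<otimes>\<^bsub>C\<^esub> Y))"

definition Ups_unit :: "('o, 'm, 'z) smcat_scheme \<Rightarrow> ('o, 'm) mod_arr" where
  "Ups_unit C = mk_mod_arr C (mod_hom C) (\<lambda>Z A z. z) (Ups_ob C \<one>\<^bsub>C\<^esub>)"

text \<open>The right dual \<open>\<Upsilon>\<^sup>\<or>X\<close> of \<open>\<Upsilon>X\<close>. The unit sends \<open>f\<close> to the class in
  \<open>\<integral>\<^sup>Y C(X \<otimes> Z, Y) \<times> C(Y, X \<otimes> A)\<close> of the pairs with composite \<open>X \<otimes> f\<close>; the counit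
  is composition.\<close>

definition Ups_dual :: "('o, 'm, 'z) smcat_scheme \<Rightarrow> 'o \<Rightarrow> ('o, 'm) bimod" where
  "Ups_dual C X = mk_mod C
     (\<lambda>Z Y. Mor ` Hom C (X \<otimes>\<^bsub>C\<^esub> Z) Y)
     (\<lambda>h k z. case z of Mor f \<Rightarrow> Mor (k \<cdot>\<^bsub>C\<^esub> f \<cdot>\<^bsub>C\<^esub> (Id C X \<star>\<^bsub>C\<^esub> h)))"

definition Ups_coev :: "('o, 'm, 'z) smcat_scheme \<Rightarrow> 'o \<Rightarrow> ('o, 'm) mod_arr" where
  "Ups_coev C X = mk_mod_arr C (mod_hom C)
     (\<lambda>Z A z. case z of Mor f \<Rightarrow>
        coend_class C (integrand C (Ups_dual C X) (Ups_ob C X) Z A)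
          (At (X \<otimes>\<^bsub>C\<^esub> Z) (Pr (Mor (Id C X \<star>\<^bsub>C\<^esub> f)) (Mor (Id C (X \<otimes>\<^bsub>C\<^esub> Z))))))
     (mod_tensor C (Ups_dual C X) (Ups_ob C X))"

definition Ups_ev :: "('o, 'm, 'z) smcat_scheme \<Rightarrow> 'o \<Rightarrow> ('o, 'm) mod_arr" where
  "Ups_ev C X = mk_mod_arr C (mod_tensor C (Ups_ob C X) (Ups_dual C X))
     (\<lambda>Z A z. case z of At B (Pr (Mor g) (Mor f)) \<Rightarrow> Mor (g \<cdot>\<^bsub>C\<^esub> f))
     (mod_hom C)"

section \<open>The functor \<open>\<Gamma>\<close>\<close>

text \<open>\<open>\<Gamma>\<close>, with structure isomorphisms \<open>\<phi>\<close> and \<open>\<phi>0\<close>, is a strong monoidal functor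
  equipped with a monoidal isomorphism \<open>\<theta> : \<Upsilon> \<cong> \<Gamma>\<Omega>\<close>, sending \<open>J\<^sup>\<or>\<close> to \<open>\<Upsilon>\<^sup>\<or>J\<close> and
  \<open>\<eta>\<close>, \<open>\<epsilon>\<close> to the unit and counit of the duality of \<open>\<Upsilon>J\<close> and \<open>\<Upsilon>\<^sup>\<or>J\<close>.\<close>

type_synonym ('o, 'm) Gamma_functor =
  "('o list, ('o, 'm) path set, ('o, 'm) bimod, ('o, 'm) mod_arr) func"

definition is_Gamma ::
  "('o, 'm, 'z) smcat_scheme \<Rightarrow> 'o \<Rightarrow> ('o, 'm) Gamma_functor \<Rightarrow>
   ('o list \<Rightarrow> 'o list \<Rightarrow> ('o, 'm) mod_arr) \<Rightarrow> ('o, 'm) mod_arr \<Rightarrow> ('o \<Rightarrow> ('o, 'm) mod_arr) \<Rightarrow>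
   bool" where
  "is_Gamma C J \<Gamma> \<phi> \<phi>0 \<theta> \<longleftrightarrow>
     strong_monoidal_functor (adjoin_dual C J) (Mod C) \<Gamma> \<phi> \<phi>0 \<and>
     monoidal_nat_iso C (Mod C) (Ups C) (Ups_mult C) (Ups_unit C)
       (comp_functor C \<Gamma> (Omega C J)) (\<lambda>X Y. \<phi> [X] [Y]) \<phi>0 \<theta> \<and>
     Fo \<Gamma> (Jdual C) = Ups_dual C J \<and>
     Fa \<Gamma> (edge_class C J Eta) \<cdot>\<^bsub>Mod C\<^esub> \<phi>0
       = \<phi> (Jdual C) [J] \<cdot>\<^bsub>Mod C\<^esub> (Id (Mod C) (Ups_dual C J) \<star>\<^bsub>Mod C\<^esub> \<theta> J) \<cdot>\<^bsub>Mod C\<^esub> Ups_coev C J \<and>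
     Fa \<Gamma> (edge_class C J Eps) \<cdot>\<^bsub>Mod C\<^esub> \<phi> [J] (Jdual C) \<cdot>\<^bsub>Mod C\<^esub>
       (\<theta> J \<star>\<^bsub>Mod C\<^esub> Id (Mod C) (Ups_dual C J))
       = \<phi>0 \<cdot>\<^bsub>Mod C\<^esub> Ups_ev C J"

text \<open>The isomorphism \<open>\<Upsilon>W\<^sub>0 \<otimes> (\<Upsilon>\<^sup>\<or>J \<otimes> (\<Upsilon>W\<^sub>1 \<otimes> \<dots> (\<Upsilon>\<^sup>\<or>J \<otimes> \<Upsilon>W\<^sub>p))) \<cong> \<Gamma>W\<close>.\<close>

fun Gamma_iso ::
  "('o, 'm, 'z) smcat_scheme \<Rightarrow> 'o \<Rightarrow> ('o list \<Rightarrow> 'o list \<Rightarrow> ('o, 'm) mod_arr) \<Rightarrow>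
   ('o \<Rightarrow> ('o, 'm) mod_arr) \<Rightarrow> 'o list \<Rightarrow> ('o, 'm) mod_arr" where
  "Gamma_iso C J \<phi> \<theta> [X] = \<theta> X"
| "Gamma_iso C J \<phi> \<theta> (X # X' # Ws) =
     \<phi> [X] (wtensor C (Jdual C) (X' # Ws)) \<cdot>\<^bsub>Mod C\<^esub>
     (\<theta> X \<star>\<^bsub>Mod C\<^esub>
       (\<phi> (Jdual C) (X' # Ws) \<cdot>\<^bsub>Mod C\<^esub>
        (Id (Mod C) (Ups_dual C J) \<star>\<^bsub>Mod C\<^esub> Gamma_iso C J \<phi> \<theta> (X' # Ws))))"

section \<open>The natural transformation\<close>

text \<open>A chain \<open>(Ys, fs)\<close> for \<open>W\<close> of length \<open>p + 1\<close> and \<open>A\<close> consists of objects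
  \<open>Ys = [Y\<^sub>1, \<dots>, Y\<^sub>p]\<close> and arrows \<open>fs = [f\<^sub>0, \<dots>, f\<^sub>p]\<close>, where \<open>f\<^sub>i\<close> has source \<open>A\<close> for
  \<open>i = 0\<close> and \<open>J \<otimes> Y\<^sub>i\<close> otherwise, and target \<open>W\<^sub>p\<close> for \<open>i = p\<close> and \<open>W\<^sub>i \<otimes> Y\<^sub>i\<^sub>+\<^sub>1\<close>
  otherwise. Note that \<open>Y\<^sub>i\<close> is \<open>Ys ! (i - 1)\<close>.\<close>

type_synonym ('o, 'm) chain = "'o list \<times> 'm list"

definition csrc :: "('o, 'm, 'z) smcat_scheme \<Rightarrow> 'o \<Rightarrow> 'o \<Rightarrow> 'o list \<Rightarrow> nat \<Rightarrow> 'o" where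
  "csrc C J A Ys i = (if i = 0 then A else J \<otimes>\<^bsub>C\<^esub> Ys ! (i - 1))"

definition ctgt :: "('o, 'm, 'z) smcat_scheme \<Rightarrow> 'o list \<Rightarrow> 'o list \<Rightarrow> nat \<Rightarrow> 'o" where
  "ctgt C W Ys i = (if i < length Ys then W ! i \<otimes>\<^bsub>C\<^esub> Ys ! i else W ! i)"

definition chains ::
  "('o, 'm, 'z) smcat_scheme \<Rightarrow> 'o \<Rightarrow> 'o list \<Rightarrow> 'o \<Rightarrow> ('o, 'm) chain set" where
  "chains C J W A = {(Ys, fs). length W = Suc (length Ys) \<and> length fs = length W \<and>
     set Ys \<subseteq> Obj C \<and> (\<forall>i < length W. fs ! i \<in> Hom C (csrc C J A Ys i) (ctgt C W Ys i))}"

text \<open>The coend \<open>\<integral>\<^bsup>Y\<^sub>1,\<dots>,Y\<^sub>p\<^esup> C(A, W\<^sub>0 \<otimes> Y\<^sub>1) \<times> C(J \<otimes> Y\<^sub>1, W\<^sub>1 \<otimes> Y\<^sub>2) \<times> \<dots> \<times> C(J \<otimes> Y\<^sub>p, W\<^sub>p)\<close>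
  is the quotient of the set of chains by the equivalence generated by the two actions of
  arrows \<open>hs = [h\<^sub>1, \<dots>, h\<^sub>p]\<close>, \<open>h\<^sub>i : Y\<^sub>i \<rightarrow> Y\<^sub>i'\<close>, of \<open>C\<^sup>p\<close>.\<close>

definition chain_rel ::
  "('o, 'm, 'z) smcat_scheme \<Rightarrow> 'o \<Rightarrow> 'o list \<Rightarrow> 'o \<Rightarrow> (('o, 'm) chain \<times> ('o, 'm) chain) set"
  where
  "chain_rel C J W A = equiv_closure (chains C J W A)
     {((Ys, map (\<lambda>i. if i = 0 then gs ! i else gs ! i \<cdot>\<^bsub>C\<^esub> (Id C J \<star>\<^bsub>C\<^esub> hs ! (i - 1)))
              [0..<length W]),
       (Ys', map (\<lambda>i. if i < length Ys then (Id C (W ! i) \<star>\<^bsub>C\<^esub> hs ! i) \<cdot>\<^bsub>C\<^esub> gs ! i else gs ! i)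
              [0..<length W])) | Ys Ys' hs gs.
        length W = Suc (length Ys) \<and> length Ys' = length Ys \<and> length hs = length Ys \<and>
        length gs = length W \<and> set Ys \<subseteq> Obj C \<and> set Ys' \<subseteq> Obj C \<and>
        (\<forall>i < length Ys. hs ! i \<in> Hom C (Ys ! i) (Ys' ! i)) \<and>
        (\<forall>i < length W. gs ! i \<in> Hom C (csrc C J A Ys' i) (ctgt C W Ys i))}"

text \<open>Evaluation at \<open>(A, \<one>)\<close> of
  \<open>\<Upsilon>W\<^sub>0 \<otimes> (\<Upsilon>\<^sup>\<or>J \<otimes> M)\<close> is \<open>\<integral>\<^sup>B (\<integral>\<^sup>Y M(Y, \<one>) \<times> C(J \<otimes> B, Y)) \<times> C(A, W\<^sub>0 \<otimes> B)\<close>; the Yoneda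
  lemma eliminates \<open>Y\<close> by composing \<open>g : J \<otimes> B \<rightarrow> Y\<close> into the first arrow of the chain
  obtained from \<open>n \<in> M(Y, \<one>)\<close>.\<close>

fun chain_of ::
  "('o, 'm, 'z) smcat_scheme \<Rightarrow> 'o list \<Rightarrow> ('o, 'm) elt \<Rightarrow> ('o, 'm) chain" where
  "chain_of C [X] z = (case z of Mor f \<Rightarrow> ([], [f]))"
| "chain_of C (X # X' # Ws) z = (case z of At B (Pr (At Y (Pr n (Mor g))) (Mor f)) \<Rightarrow>
     (case chain_of C (X' # Ws) n of (Ys, f' # fs) \<Rightarrow> (B # Ys, f # (f' \<cdot>\<^bsub>C\<^esub> g) # fs)))"

text \<open>The canonical isomorphism from \<open>\<Gamma>W(A, \<one>)\<close> to the coend.\<close>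

definition canonical_iso ::
  "('o, 'm, 'z) smcat_scheme \<Rightarrow> 'o \<Rightarrow> ('o list \<Rightarrow> 'o list \<Rightarrow> ('o, 'm) mod_arr) \<Rightarrow>
   ('o \<Rightarrow> ('o, 'm) mod_arr) \<Rightarrow> 'o list \<Rightarrow> 'o \<Rightarrow> ('o, 'm) elt \<Rightarrow> ('o, 'm) chain set" where
  "canonical_iso C J \<phi> \<theta> W A x = chain_rel C J W A ``
     {chain_of C W (app (component (inv_arr (Mod C) (Gamma_iso C J \<phi> \<theta> W)) (A, \<one>\<^bsub>C\<^esub>)) x)}"

text \<open>The composite \<open>U \<otimes> A \<rightarrow> U \<otimes> W\<^sub>0 \<otimes> Y\<^sub>1 \<rightarrow> U \<otimes> W\<^sub>0 \<otimes> J\<^sup>\<or> \<otimes> J \<otimes> Y\<^sub>1 \<rightarrow> \<dots> \<rightarrow> U \<otimes> W\<close> in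
  \<open>C[J\<^sup>\<or>]\<close> attached to a chain, where \<open>U\<close> collects the part of \<open>W\<close> already split off.\<close>

fun chain_comp ::
  "('o, 'm, 'z) smcat_scheme \<Rightarrow> 'o \<Rightarrow> 'o list \<Rightarrow> 'o list \<Rightarrow> ('o, 'm) chain \<Rightarrow> ('o, 'm) path set"
  where
  "chain_comp C J U [X] ([], [f]) =
     Id (adjoin_dual C J) U \<star>\<^bsub>adjoin_dual C J\<^esub> Fa (Omega C J) f"
| "chain_comp C J U (X # X' # Ws) (Y # Ys, f # fs) =
     chain_comp C J (U \<otimes>\<^bsub>adjoin_dual C J\<^esub> [X] \<otimes>\<^bsub>adjoin_dual C J\<^esub> Jdual C) (X' # Ws) (Ys, fs)
     \<cdot>\<^bsub>adjoin_dual C J\<^esub>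
     (Id (adjoin_dual C J) (U \<otimes>\<^bsub>adjoin_dual C J\<^esub> [X]) \<star>\<^bsub>adjoin_dual C J\<^esub>
       edge_class C J Eta \<star>\<^bsub>adjoin_dual C J\<^esub> Id (adjoin_dual C J) [Y])
     \<cdot>\<^bsub>adjoin_dual C J\<^esub>
     (Id (adjoin_dual C J) U \<star>\<^bsub>adjoin_dual C J\<^esub> Fa (Omega C J) f)"

definition Ev_unit ::
  "('o, 'm, 'z) smcat_scheme \<Rightarrow> (('o, 'm) bimod, ('o, 'm) mod_arr, ('o, 'm) psh, ('o, 'm) psh_arr) func"
  where
  "Ev_unit C = (let E = (\<lambda>M. \<lparr>Fo = (\<lambda>A \<in> Obj C. Fo M (A, \<one>\<^bsub>C\<^esub>)),
                             Fa = (\<lambda>h \<in> Arr C. Fa M (h, Id C \<one>\<^bsub>C\<^esub>))\<rparr>) in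
     \<lparr>Fo = (\<lambda>M \<in> Obj (Mod C). E M),
      Fa = (\<lambda>t \<in> Arr (Mod C).
        (E (Dom (Mod C) t), \<lambda>A \<in> Obj C. component t (A, \<one>\<^bsub>C\<^esub>), E (Cod (Mod C) t)))\<rparr>)"

definition Omega_tilde ::
  "('o, 'm, 'z) smcat_scheme \<Rightarrow> 'o \<Rightarrow>
   ('o list, ('o, 'm) path set, ('o, 'm) psh, ('o, 'm) psh_arr) func" where
  "Omega_tilde C J = (let Q = adjoin_dual C J; S = (\<lambda>W A. DMor ` Hom Q (Fo (Omega C J) A) W);
       P = (\<lambda>W. \<lparr>Fo = (\<lambda>A \<in> Obj C. S W A),
                 Fa = (\<lambda>h \<in> Arr C. mk_fun (S W (Cod C h))
                   (\<lambda>z. case z of DMor x \<Rightarrow> DMor (x \<cdot>\<^bsub>Q\<^esub> Fa (Omega C J) h)) (S W (Dom C h)))\<rparr>) in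
     \<lparr>Fo = (\<lambda>W \<in> Obj Q. P W),
      Fa = (\<lambda>w \<in> Arr Q. (P (Dom Q w),
        \<lambda>A \<in> Obj C. mk_fun (S (Dom Q w) A) (\<lambda>z. case z of DMor x \<Rightarrow> DMor (w \<cdot>\<^bsub>Q\<^esub> x))
                     (S (Cod Q w) A),
        P (Cod Q w)))\<rparr>)"

text \<open>The composite of the canonical isomorphism with the function induced by
  \<^const>\<open>chain_comp\<close> on equivalence classes: \<^const>\<open>the_elem\<close> selects the common value on
  the class.\<close>

definition zeta_fun ::
  "('o, 'm, 'z) smcat_scheme \<Rightarrow> 'o \<Rightarrow> ('o list \<Rightarrow> 'o list \<Rightarrow> ('o, 'm) mod_arr) \<Rightarrow>
   ('o \<Rightarrow> ('o, 'm) mod_arr) \<Rightarrow> 'o list \<Rightarrow> 'o \<Rightarrow> ('o, 'm) elt \<Rightarrow> ('o, 'm) elt" where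
  "zeta_fun C J \<phi> \<theta> W A x =
     DMor (the_elem (chain_comp C J (wunit C) W ` canonical_iso C J \<phi> \<theta> W A x))"

type_synonym ('o, 'm) zeta_trans =
  "('o list, ('o, 'm) path set, ('o, 'm) psh, ('o, 'm) psh_arr) trans"

definition zeta ::
  "('o, 'm, 'z) smcat_scheme \<Rightarrow> 'o \<Rightarrow> ('o, 'm) Gamma_functor \<Rightarrow>
   ('o list \<Rightarrow> 'o list \<Rightarrow> ('o, 'm) mod_arr) \<Rightarrow> ('o \<Rightarrow> ('o, 'm) mod_arr) \<Rightarrow> ('o, 'm) zeta_trans" where
  "zeta C J \<Gamma> \<phi> \<theta> =
     (let F = comp_functor (adjoin_dual C J) (Ev_unit C) \<Gamma>; G = Omega_tilde C J in
      (F,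
       \<lambda>W \<in> Obj (adjoin_dual C J).
         (Fo F W,
          \<lambda>A \<in> Obj C. mk_fun (Fo (Fo F W) A) (zeta_fun C J \<phi> \<theta> W A) (Fo (Fo G W) A),
          Fo G W),
       G))"

end

(* The inverse of zeta sends an arrow w : A -> W of C[J^v] to the image under Gamma w of the
   element of Gamma A (A, 1) that corresponds to the identity of A; naturality in A and W is
   immediate for this map.  Splitting W = X (x) J^v (x) V, an arrow A -> W of the special form
   (X (x) c^) f, with f : A -> X (x) B in C and c^ : B -> J^v (x) V the mate of c : J (x) B -> V,
   is sent to the element of the iterated tensor product of modules given by f and c; this uses
   only the coherence of Gamma, the monoidality of theta and the value of Gamma on eta.  Hence
   zeta is injective.  It is surjective because, by induction along paths, every arrow out of an
   object of C has this form: an edge on the tail V is absorbed into c, a bar edge or an eta edge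
   at the head slides past c^, and an eps edge cancels against c^ by a triangle identity. *)
theory Submission
  imports Defs
begin

text \<open>The canonical isomorphism is the inverse of \<open>Gamma_iso\<close>, a composite of
  \<phi>s and \<theta>s whose compatibility with arrows of C[J^v] is not visible. This is why
  naturality is shown for the inverse \<open>transport\<close>, a Yoneda map, and carried over to
  zeta. Both composites come from two equations for elements t of the iterated tensor product at (A,
  1): zeta sends the \<open>Gamma_iso\<close>-image of t to \<open>tensor_arrow W t\<close>, and
  \<open>transport\<close> sends \<open>tensor_arrow W t\<close> back to that image. Bijectivity of
  \<open>Gamma_iso\<close> gives one composite; the other needs that \<open>tensor_arrow\<close>
  reaches every arrow out of A. The special form of an arrow is not unique, since B may be changed
  along arrows of C. Only existence is proved along paths; uniqueness up to the coend relation is a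
  consequence of injectivity. A further obstacle is that an element of a coend is a chosen
  representative. A map out of a coend is a case distinction on it, so evaluating it on a class
  requires an invariance proof, once for every level of an iterated tensor product.\<close>

context category
begin

section \<open>Elementary facts about hom sets\<close>

lemma HomD: "f \<in> Hom C A B \<Longrightarrow> f \<in> Arr C \<and> A \<in> Obj C \<and> B \<in> Obj C \<and> Dom C f = A \<and> Cod C f = B"
  using Dom_Obj[of f] Cod_Obj[of f] by (auto simp: Hom_def)

lemma Arr_Hom: "f \<in> Arr C \<Longrightarrow> f \<in> Hom C (Dom C f) (Cod C f)"
  by (simp add: Hom_def)

lemma Comp_assoc4:
  assumes "f \<in> Hom C A B" "g \<in> Hom C B D" "h \<in> Hom C D E" "k \<in> Hom C E G"
  shows "(k \<cdot> h) \<cdot> (g \<cdot> f) = k \<cdot> ((h \<cdot> g) \<cdot> f)"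
proof -
  have "(k \<cdot> h) \<cdot> (g \<cdot> f) = k \<cdot> (h \<cdot> (g \<cdot> f))"
    by (rule Comp_assoc[OF Comp_Hom[OF assms(1,2)] assms(3,4)])
  then show ?thesis
    by (simp add: Comp_assoc[OF assms(1-3)])
qed

end

section \<open>Words\<close>

locale adjoined_dual = strict_monoidal_category C
  for C :: "('o, 'm, 'z) smcat_scheme" (structure) +
  fixes J :: 'o
  assumes J_Obj: "J \<in> Obj C"
begin

lemma wtensor_words: "U \<in> words C \<Longrightarrow> V \<in> words C \<Longrightarrow> wtensor C U V \<in> words C"
  unfolding words_def wtensor_def
  by (cases V; cases U rule: rev_cases) (auto intro!: tob_Obj)

lemma wtensor_Cons: "U \<noteq> [] \<Longrightarrow> wtensor C (X # U) V = X # wtensor C U V"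
  by (simp add: wtensor_def)

lemma wtensor_single: "wtensor C [X] V = (X \<otimes> hd V) # tl V"
  by (simp add: wtensor_def)

lemma wtensor_assoc:
  assumes "U \<in> words C" "V \<in> words C" "W \<in> words C"
  shows "wtensor C (wtensor C U V) W = wtensor C U (wtensor C V W)"
proof -
  have "U \<noteq> []" using assms by (simp add: words_def)
  then show ?thesis using assms
  proof (induction U rule: list_nonempty_induct)
    case (single X)
    then obtain Y Ys Z Zs where "V = Y # Ys" "W = Z # Zs"
      by (cases V; cases W) (auto simp: words_def)
    \<comment> \<open>If \<open>V\<close> has one letter, both products merge into that letter and
      associativity on objects is used; otherwise the two merges happen at different
      letters.\<close>
    with single show ?case
      by (cases "Ys = []") (auto simp: wtensor_def words_def tob_assoc)
  next
    case (cons X U)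
    then have "wtensor C U V \<noteq> []" "U \<in> words C"
      by (auto simp: wtensor_def words_def)
    with cons show ?case by (simp add: wtensor_Cons)
  qed
qed

lemma wunit_words: "wunit C \<in> words C"
  by (simp add: words_def wunit_def unit_Obj)

lemma single_words: "A \<in> Obj C \<Longrightarrow> [A] \<in> words C"
  by (simp add: words_def)

lemma Jdual_words: "Jdual C \<in> words C"
  by (simp add: words_def Jdual_def unit_Obj)

lemma wtensor_wunit: "U \<in> words C \<Longrightarrow> wtensor C U (wunit C) = U"
  unfolding words_def wtensor_def wunit_def
  by (auto simp: tob_unit subset_iff)

lemma wunit_wtensor: "U \<in> words C \<Longrightarrow> wtensor C (wunit C) U = U"
  unfolding words_def wtensor_def wunit_def
  by (cases U) (auto simp: unit_tob)

text \<open>Oriented so that products of words are bracketed to the right. Where two adjacent single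
  letters have to be merged, \<open>wtensor_assoc\<close> is removed from the set or
  reversed.\<close>

lemmas word_simps = wtensor_words wunit_words single_words Jdual_words wtensor_assoc
  wtensor_wunit wunit_wtensor J_Obj unit_Obj tob_Obj Dom_Obj Cod_Obj

lemma psrc_words: "p \<in> {Eps, Eta} \<union> Bar ` Arr C \<Longrightarrow> psrc C J p \<in> words C"
  by (auto simp: word_simps)

lemma ptgt_words: "p \<in> {Eps, Eta} \<union> Bar ` Arr C \<Longrightarrow> ptgt C J p \<in> words C"
  by (auto simp: word_simps)

lemma edge_words: "e \<in> edges C \<Longrightarrow> esrc C J e \<in> words C \<and> etgt C J e \<in> words C"
  unfolding edges_def esrc_def etgt_def
  by (clarsimp) (use psrc_words ptgt_words in \<open>auto simp: word_simps\<close>)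

lemma ewhisker_edges:
  "e \<in> edges C \<Longrightarrow> T \<in> words C \<Longrightarrow> W \<in> words C \<Longrightarrow> ewhisker C T e W \<in> edges C"
  unfolding edges_def ewhisker_def by (auto simp: word_simps)

lemma esrc_ewhisker:
  "e \<in> edges C \<Longrightarrow> T \<in> words C \<Longrightarrow> W \<in> words C \<Longrightarrow>
    esrc C J (ewhisker C T e W) = wtensor C T (wtensor C (esrc C J e) W)"
  unfolding edges_def ewhisker_def esrc_def
  by clarsimp (use psrc_words in \<open>auto simp: word_simps\<close>)

lemma etgt_ewhisker:
  "e \<in> edges C \<Longrightarrow> T \<in> words C \<Longrightarrow> W \<in> words C \<Longrightarrow>
    etgt C J (ewhisker C T e W) = wtensor C T (wtensor C (etgt C J e) W)"
  unfolding edges_def ewhisker_def etgt_def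
  by clarsimp (use ptgt_words in \<open>auto simp: word_simps\<close>)

section \<open>The free category\<close>

lemma is_path_append:
  "is_path C J U (es @ es') W \<longleftrightarrow> (\<exists>V. is_path C J U es V \<and> is_path C J V es' W)"
  by (induction es arbitrary: U) auto

lemma is_path_edges: "is_path C J U es V \<Longrightarrow> set es \<subseteq> edges C"
  by (induction es arbitrary: U) auto

abbreviation "F \<equiv> free_cat C J"
abbreviation "Q \<equiv> adjoin_dual C J"

abbreviation Q_Comp (infixr "\<bullet>" 70) where "Q_Comp \<equiv> Comp Q"
abbreviation Q_tar (infixr "\<diamondop>" 75) where "Q_tar \<equiv> tar Q"

lemma F_Obj: "Obj F = words C"
  by (simp add: free_cat_def)

lemma F_Hom: "(U', es, V') \<in> Hom F U V \<longleftrightarrow> U' = U \<and> V' = V \<and> U \<in> words C \<and> V \<in> words C \<and> is_path C J U es V"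
  by (auto simp: free_cat_def Hom_def)

lemma F_HomE:
  assumes "p \<in> Hom F U V"
  obtains es where "p = (U, es, V)" "U \<in> words C" "V \<in> words C" "is_path C J U es V"
  using assms by (cases p) (auto simp: F_Hom)

lemma F_Comp: "(V', es', W) \<cdot>\<^bsub>F\<^esub> (U, es, V) = (U, es @ es', W)"
  by (simp add: free_cat_def)

lemma F_Id: "Id F U = (U, [], U)"
  by (simp add: free_cat_def)

lemma F_category: "category F"
  by unfold_locales
    (auto simp: F_Obj F_Hom F_Comp F_Id is_path_append elim!: F_HomE,
     auto simp: free_cat_def)

sublocale F: category F
  by (rule F_category)

lemma F_HomD: "p \<in> Hom F U V \<Longrightarrow> p \<in> Arr F \<and> U \<in> words C \<and> V \<in> words C \<and> Dom F p = U \<and> Cod F p = V"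
  using F.Dom_Obj[of p] F.Cod_Obj[of p] by (auto simp: Hom_def F_Obj)

lemma epath_Hom: "e \<in> edges C \<Longrightarrow> epath C J e \<in> Hom F (esrc C J e) (etgt C J e)"
  by (simp add: epath_def F_Hom edge_words)

lemma whisker_Hom:
  assumes "p \<in> Hom F U V" "T \<in> words C" "W \<in> words C"
  shows "whisker C T p W \<in> Hom F (wtensor C T (wtensor C U W)) (wtensor C T (wtensor C V W))"
proof -
  have "is_path C J U es V \<Longrightarrow> is_path C J (wtensor C T (wtensor C U W))
      (map (\<lambda>e. ewhisker C T e W) es) (wtensor C T (wtensor C V W))" for es
    by (induction es arbitrary: U) (auto simp: assms ewhisker_edges esrc_ewhisker etgt_ewhisker)
  then show ?thesis
    using assms by (auto elim!: F_HomE simp: whisker_def F_Hom word_simps)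
qed

lemma whisker_Comp:
  "p \<in> Hom F U V \<Longrightarrow> q \<in> Hom F V X \<Longrightarrow>
    whisker C T (q \<cdot>\<^bsub>F\<^esub> p) W = whisker C T q W \<cdot>\<^bsub>F\<^esub> whisker C T p W"
  by (auto elim!: F_HomE simp: whisker_def F_Comp)

lemma whisker_Id: "whisker C T (Id F U) W = Id F (wtensor C T (wtensor C U W))"
  by (simp add: whisker_def F_Id)

lemma whisker_whisker:
  assumes "p \<in> Hom F U V" "T \<in> words C" "W \<in> words C" "T' \<in> words C" "W' \<in> words C"
  shows "whisker C T (whisker C T' p W') W = whisker C (wtensor C T T') p (wtensor C W' W)"
proof -
  have "set es \<subseteq> edges C \<Longrightarrow> map (\<lambda>e. ewhisker C T e W) (map (\<lambda>e. ewhisker C T' e W') es) =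
      map (\<lambda>e. ewhisker C (wtensor C T T') e (wtensor C W' W)) es" for es
    using assms by (auto simp: ewhisker_def edges_def word_simps)
  then show ?thesis
    using assms by (auto elim!: F_HomE dest!: is_path_edges simp: whisker_def word_simps)
qed

lemma whisker_wunit:
  assumes "p \<in> Hom F U V"
  shows "whisker C (wunit C) p (wunit C) = p"
proof -
  have "set es \<subseteq> edges C \<Longrightarrow> map (\<lambda>e. ewhisker C (wunit C) e (wunit C)) es = es" for es
    by (induction es) (auto simp: ewhisker_def edges_def word_simps)
  then show ?thesis
    using assms by (auto elim!: F_HomE dest!: is_path_edges simp: whisker_def word_simps)
qed

lemma whisker_epath:
  "e \<in> edges C \<Longrightarrow> T \<in> words C \<Longrightarrow> W \<in> words C \<Longrightarrow>
    whisker C T (epath C J e) W = epath C J (ewhisker C T e W)"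
  by (simp add: whisker_def epath_def esrc_ewhisker etgt_ewhisker)

section \<open>The congruence\<close>

text \<open>\<open>quot_cat\<close> reads source and target off a chosen representative of a class,
  so the congruence must relate only well-formed paths with common ends.\<close>

definition parallel :: "('o, 'm) path \<Rightarrow> ('o, 'm) path \<Rightarrow> bool" where
  "parallel p q \<longleftrightarrow> (\<exists>U V. p \<in> Hom F U V \<and> q \<in> Hom F U V)"

lemma edgesI:
  "U \<in> words C \<Longrightarrow> V \<in> words C \<Longrightarrow> (U, Eps, V) \<in> edges C"
  "U \<in> words C \<Longrightarrow> V \<in> words C \<Longrightarrow> (U, Eta, V) \<in> edges C"
  "U \<in> words C \<Longrightarrow> V \<in> words C \<Longrightarrow> f \<in> Arr C \<Longrightarrow> (U, Bar f, V) \<in> edges C"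
  by (auto simp: edges_def)

lemma base_rel_parallel: "(p, q) \<in> base_rel C J \<Longrightarrow> parallel p q"
proof (induction rule: base_rel.induct)
  case (bar_whisker E f B)
  have f: "Id C E \<star> f \<star> Id C B \<in> Hom C (E \<otimes> Dom C f \<otimes> B) (E \<otimes> Cod C f \<otimes> B)"
    using bar_whisker by (intro tar_Hom Id_Hom) (auto simp: Hom_def)
  have "epath C J (wunit C, Bar (Id C E \<star> f \<star> Id C B), wunit C) \<in> Hom F [E \<otimes> Dom C f \<otimes> B] [E \<otimes> Cod C f \<otimes> B]"
    using epath_Hom[of "(wunit C, Bar (Id C E \<star> f \<star> Id C B), wunit C)"] HomD[OF f]
    by (simp add: edgesI word_simps esrc_def etgt_def)
  moreover have "epath C J ([E], Bar f, [B]) \<in> Hom F [E \<otimes> Dom C f \<otimes> B] [E \<otimes> Cod C f \<otimes> B]"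
    using epath_Hom[of "([E], Bar f, [B])"] bar_whisker
    by (simp add: edgesI word_simps esrc_def etgt_def wtensor_single)
  ultimately show ?case
    unfolding parallel_def by blast
next
  case (bar_Id A)
  have i: "Id C A \<in> Arr C" "Dom C (Id C A) = A" "Cod C (Id C A) = A"
    using HomD[OF Id_Hom[OF bar_Id]] by auto
  have "epath C J (wunit C, Bar (Id C A), wunit C) \<in> Hom F [A] [A]"
    using epath_Hom[of "(wunit C, Bar (Id C A), wunit C)"] i bar_Id
    by (simp add: edgesI word_simps esrc_def etgt_def)
  then show ?case
    unfolding parallel_def using F.Id_Hom[of "[A]"] bar_Id by (auto simp: F_Obj word_simps)
next
  case (bar_Comp f g)
  then have gf: "g \<cdot> f \<in> Hom C (Dom C f) (Cod C g)"
    by (intro Comp_Hom) (auto simp: Hom_def)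
  have "epath C J (wunit C, Bar k, wunit C) \<in> Hom F [Dom C k] [Cod C k]" if "k \<in> Arr C" for k
    using epath_Hom[of "(wunit C, Bar k, wunit C)"] that
    by (simp add: edgesI word_simps esrc_def etgt_def)
  from this[of f] this[of g] this[of "g \<cdot> f"] show ?case
    unfolding parallel_def using bar_Comp HomD[OF gf]
    by (metis F.Comp_Hom)
next
  case (interchange a U V b W X)
  note e = edge_words[OF interchange(1)] edge_words[OF interchange(4)]
  have "epath C J (ewhisker C T k S) \<in> Hom F (wtensor C T (wtensor C (esrc C J k) S)) (wtensor C T (wtensor C (etgt C J k) S))"
    if "k \<in> edges C" "T \<in> words C" "S \<in> words C" for k T S
    using epath_Hom[OF ewhisker_edges[OF that]] that by (simp add: esrc_ewhisker etgt_ewhisker)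
  from this[of b V "wunit C"] this[of b U "wunit C"] this[of a "wunit C" W] this[of a "wunit C" X]
  show ?case
    unfolding parallel_def using interchange e
    by (simp add: word_simps) (metis F.Comp_Hom)
next
  case triangle_J
  have "epath C J (wunit C, Eps, [J]) \<in> Hom F (wtensor C [J] (wtensor C (Jdual C) [J])) [J]"
    using epath_Hom[of "(wunit C, Eps, [J])"] by (simp add: edgesI word_simps esrc_def etgt_def)
  moreover have "epath C J ([J], Eta, wunit C) \<in> Hom F [J] (wtensor C [J] (wtensor C (Jdual C) [J]))"
    using epath_Hom[of "([J], Eta, wunit C)"] by (simp add: edgesI word_simps esrc_def etgt_def)
  ultimately show ?case
    unfolding parallel_def using F.Id_Hom[of "[J]"] F.Comp_Hom
    by (fastforce simp: F_Obj word_simps)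
next
  case triangle_Jdual
  have "epath C J (Jdual C, Eps, wunit C) \<in> Hom F (wtensor C (Jdual C) (wtensor C [J] (Jdual C))) (Jdual C)"
    using epath_Hom[of "(Jdual C, Eps, wunit C)"] by (simp add: edgesI word_simps esrc_def etgt_def)
  moreover have "epath C J (wunit C, Eta, Jdual C) \<in> Hom F (Jdual C) (wtensor C (Jdual C) (wtensor C [J] (Jdual C)))"
    using epath_Hom[of "(wunit C, Eta, Jdual C)"] by (simp add: edgesI word_simps esrc_def etgt_def)
  ultimately show ?case
    unfolding parallel_def using F.Id_Hom[of "Jdual C"] F.Comp_Hom
    by (fastforce simp: F_Obj word_simps)
qed

lemma adj_rel_parallel: "(p, q) \<in> adj_rel C J \<Longrightarrow> parallel p q"
  unfolding adj_rel_def
proof (induction rule: congruence.induct)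
  case (gen p q)
  then show ?case
  proof
    assume "(p, q) \<in> base_rel C J"
    then show ?thesis by (rule base_rel_parallel)
  next
    assume "(p, q) \<in> {(whisker C Y p Z, whisker C Y q Z) | Y p q Z.
         Y \<in> words C \<and> (p, q) \<in> base_rel C J \<and> Z \<in> words C}"
    then show ?thesis
      using base_rel_parallel whisker_Hom unfolding parallel_def mem_Collect_eq prod.inject by metis
  qed
next
  case (comp p p' q q')
  then obtain U V U' V' where h: "p \<in> Hom F U V" "p' \<in> Hom F U V" "q \<in> Hom F U' V'" "q' \<in> Hom F U' V'"
    unfolding parallel_def by blast
  with comp(3) have "U' = V"
    by (simp add: Hom_def)
  with h show ?case
    unfolding parallel_def using F.Comp_Hom[of p U V q V'] F.Comp_Hom[of p' U V q' V'] by blast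
next
  case (trans p q r)
  then obtain U V U' V' where h: "p \<in> Hom F U V" "q \<in> Hom F U V" "q \<in> Hom F U' V'" "r \<in> Hom F U' V'"
    unfolding parallel_def by blast
  then have "U' = U" "V' = V"
    by (auto simp: Hom_def)
  with h show ?case
    unfolding parallel_def by blast
qed (auto simp: parallel_def Hom_def)

text \<open>Clause (vi) whiskers the generators only. Stability passes to the whole congruence
  because whiskering is functorial on paths, and a generator that is already whiskered remains one
  because two whiskerings compose to a single one.\<close>

lemma whisker_adj_rel:
  assumes "(p, q) \<in> adj_rel C J" and T: "T \<in> words C" and W: "W \<in> words C"
  shows "(whisker C T p W, whisker C T q W) \<in> adj_rel C J"
  using assms(1) unfolding adj_rel_def
proof (induction rule: congruence.induct)
  case (gen p q)
  then show ?case
  proof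
    assume "(p, q) \<in> base_rel C J"
    then show ?thesis
      using T W by (intro congruence.gen) blast
  next
    assume "(p, q) \<in> {(whisker C Y p Z, whisker C Y q Z) | Y p q Z.
         Y \<in> words C \<and> (p, q) \<in> base_rel C J \<and> Z \<in> words C}"
    then obtain Y p' q' Z where h: "p = whisker C Y p' Z" "q = whisker C Y q' Z"
      "Y \<in> words C" "(p', q') \<in> base_rel C J" "Z \<in> words C" by blast
    obtain U V where "p' \<in> Hom F U V" "q' \<in> Hom F U V"
      using base_rel_parallel[OF h(4)] unfolding parallel_def by blast
    then have "whisker C T p W = whisker C (wtensor C T Y) p' (wtensor C Z W)"
      "whisker C T q W = whisker C (wtensor C T Y) q' (wtensor C Z W)"
      using h T W by (simp_all add: whisker_whisker)
    moreover have "wtensor C T Y \<in> words C" "wtensor C Z W \<in> words C"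
      using h T W by (simp_all add: wtensor_words)
    ultimately show ?thesis
      using h(4) by (intro congruence.gen UnI2) blast
  qed
next
  case (refl p)
  then show ?case
    using whisker_Hom[of p "Dom F p" "Cod F p", OF _ T W]
    by (intro congruence.refl) (auto simp: Hom_def)
next
  \<comment> \<open>\<open>whisker_Comp\<close> asks for composable paths; for the primed pair this
    comes from \<open>adj_rel_parallel\<close>.\<close>
  case (comp p p' q q')
  obtain U V where pp: "p \<in> Hom F U V" "p' \<in> Hom F U V"
    using adj_rel_parallel[unfolded adj_rel_def, OF comp(1)] unfolding parallel_def by blast
  obtain U' V' where "q \<in> Hom F U' V'" "q' \<in> Hom F U' V'"
    using adj_rel_parallel[unfolded adj_rel_def, OF comp(2)] unfolding parallel_def by blast
  with pp comp(3) have qq: "q \<in> Hom F V V'" "q' \<in> Hom F V V'"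
    by (auto simp: Hom_def)
  have "Dom F (whisker C T q W) = Cod F (whisker C T p W)"
    using F_HomD whisker_Hom[OF pp(1) T W] whisker_Hom[OF qq(1) T W] by metis
  then show ?case
    using comp.IH pp qq by (simp add: whisker_Comp congruence.comp)
qed (blast intro: congruence.sym congruence.trans)+

lemma adj_rel_equiv: "equiv (Arr F) (adj_rel C J)"
proof (rule equivI)
  show "adj_rel C J \<subseteq> Arr F \<times> Arr F"
  proof (rule subrelI)
    fix p q assume "(p, q) \<in> adj_rel C J"
    from adj_rel_parallel[OF this] obtain U V where "p \<in> Hom F U V" "q \<in> Hom F U V"
      unfolding parallel_def by blast
    then show "(p, q) \<in> Arr F \<times> Arr F" using F_HomD by blast
  qed
  show "refl_on (Arr F) (adj_rel C J)"
    by (auto simp: adj_rel_def refl_on_def intro: congruence.refl)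
  show "sym (adj_rel C J)" "trans (adj_rel C J)"
    by (auto simp: adj_rel_def intro: symI transI congruence.sym congruence.trans)
qed

section \<open>Classes of paths and the category they form\<close>

definition cls :: "('o, 'm) path \<Rightarrow> ('o, 'm) path set" where
  "cls p = adj_rel C J `` {p}"

lemma cls_eq: "(p, q) \<in> adj_rel C J \<Longrightarrow> cls p = cls q"
  unfolding cls_def by (rule equiv_class_eq[OF adj_rel_equiv])

lemma rep_cls: 
  assumes "p \<in> Hom F U V" 
  shows "rep (cls p) \<in> Hom F U V" "cls (rep (cls p)) = cls p" "(p, rep (cls p)) \<in> adj_rel C J"
proof -
  have "p \<in> cls p"
    using assms equiv_class_self[OF adj_rel_equiv] by (auto simp: cls_def Hom_def)
  then have "rep (cls p) \<in> cls p"
    unfolding rep_def by (rule someI)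
  then show r: "(p, rep (cls p)) \<in> adj_rel C J"
    by (simp add: cls_def)
  then show "cls (rep (cls p)) = cls p"
    by (metis cls_eq)
  show "rep (cls p) \<in> Hom F U V"
    using adj_rel_parallel[OF r] assms F_HomD unfolding parallel_def by metis
qed

lemma Q_sel: "Obj Q = words C" "Arr Q = Arr F // adj_rel C J" "Dom Q c = Dom F (rep c)"
  "Cod Q c = Cod F (rep c)" "Id Q U = cls (Id F U)" "d \<bullet> c = cls (rep d \<cdot>\<^bsub>F\<^esub> rep c)"
  "U \<otimes>\<^bsub>Q\<^esub> V = wtensor C U V" "\<one>\<^bsub>Q\<^esub> = wunit C"
  "c \<diamondop> d = cls (ptensor C J (rep c) (rep d))"
  by (auto simp: adjoin_dual_def Let_def quot_cat_def cls_def F_Obj)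

lemma cls_Hom: "p \<in> Hom F U V \<Longrightarrow> cls p \<in> Hom Q U V"
  using rep_cls[of p U V] unfolding Hom_def mem_Collect_eq Q_sel by (auto simp: cls_def intro: quotientI)

lemma Q_HomE:
  assumes "c \<in> Hom Q U V"
  obtains p where "p \<in> Hom F U V" "c = cls p"
proof -
  obtain p where p: "p \<in> Arr F" "c = cls p"
    using assms by (auto simp: Hom_def Q_sel cls_def quotient_def)
  then have "p \<in> Hom F U V"
    using rep_cls[of p "Dom F p" "Cod F p"] assms by (auto simp: Hom_def Q_sel)
  with p that show thesis by blast
qed

lemma cls_Comp:
  assumes "p \<in> Hom F U V" "q \<in> Hom F V W"
  shows "cls q \<bullet> cls p = cls (q \<cdot>\<^bsub>F\<^esub> p)"
proof -
  have "Dom F q = Cod F p"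
    using assms by (auto simp: Hom_def)
  then have "(q \<cdot>\<^bsub>F\<^esub> p, rep (cls q) \<cdot>\<^bsub>F\<^esub> rep (cls p)) \<in> adj_rel C J"
    using rep_cls(3)[OF assms(1)] rep_cls(3)[OF assms(2)] unfolding adj_rel_def by (rule congruence.comp[rotated 2])
  then show ?thesis
    by (simp add: Q_sel cls_eq)
qed

lemma Q_category: "category Q"
proof
  fix c assume "c \<in> Arr Q"
  then have "c \<in> Hom Q (Dom Q c) (Cod Q c)" by (simp add: Hom_def)
  then obtain p where "p \<in> Hom F (Dom Q c) (Cod Q c)" 
    by (rule Q_HomE)
  then show "Dom Q c \<in> Obj Q" "Cod Q c \<in> Obj Q" 
    using F_HomD Q_sel(1) by blast+
next
  fix A assume "A \<in> Obj Q"
  then show "Id Q A \<in> Hom Q A A"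
    using cls_Hom F.Id_Hom by (simp add: Q_sel F_Obj)
next
  fix f g A B D assume "f \<in> Hom Q A B" "g \<in> Hom Q B D"
  then show "g \<bullet> f \<in> Hom Q A D"
    by (elim Q_HomE) (auto simp: cls_Comp intro!: cls_Hom F.Comp_Hom)
next
  fix f A B assume f: "f \<in> Hom Q A B"
  then have "Id F A \<in> Hom F A A" "Id F B \<in> Hom F B B"
    by (auto elim!: Q_HomE dest!: F_HomD simp: F_Obj intro!: F.Id_Hom)
  with f show "f \<bullet> Id Q A = f" "Id Q B \<bullet> f = f"
    by (auto elim!: Q_HomE simp: Q_sel(5) cls_Comp F.Comp_Id F.Id_Comp)
next
  fix f g h A B D E assume "f \<in> Hom Q A B" "g \<in> Hom Q B D" "h \<in> Hom Q D E"
  then obtain p q r where "p \<in> Hom F A B" "q \<in> Hom F B D" "r \<in> Hom F D E"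
    "f = cls p" "g = cls q" "h = cls r" by (metis Q_HomE)
  then show "(h \<bullet> g) \<bullet> f = h \<bullet> g \<bullet> f"
    using F.Comp_Hom[of p A B q D] F.Comp_Hom[of q B D r E]
    by (simp add: cls_Comp[of _ A B] cls_Comp[of _ B D] cls_Comp[of _ A D] F.Comp_assoc)
qed

sublocale Q: category Q
  by (rule Q_category)

lemma Q_HomD: "c \<in> Hom Q U V \<Longrightarrow> c \<in> Arr Q \<and> U \<in> words C \<and> V \<in> words C \<and> Dom Q c = U \<and> Cod Q c = V"
  using Q.Dom_Obj[of c] Q.Cod_Obj[of c] by (auto simp: Hom_def Q_sel(1))

text \<open>A representing path is taken apart at its target end, so the source stays fixed while
  the predicate follows the target. This is the shape needed for statements about all arrows out of
  one object.\<close>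

lemma Q_arrow_induct [consumes 1, case_names Id edge]:
  assumes "c \<in> Hom Q U V"
    and "P U (Id Q U)"
    and "\<And>e c. \<lbrakk>e \<in> edges C; c \<in> Hom Q U (esrc C J e); P (esrc C J e) c\<rbrakk> \<Longrightarrow>
      P (etgt C J e) (cls (epath C J e) \<bullet> c)"
  shows "P V c"
proof -
  obtain es where es: "c = cls (U, es, V)" "U \<in> words C" "V \<in> words C" "is_path C J U es V"
    using assms(1) by (auto elim!: Q_HomE F_HomE)
  from es(3,4) have "P V (cls (U, es, V))"
  proof (induction es arbitrary: V rule: rev_induct)
    case Nil
    then show ?case using assms(2) by (simp add: Q_sel F_Id)
  next
    case (snoc e es)
    then have e: "e \<in> edges C" "is_path C J U es (esrc C J e)" "etgt C J e = V"
      by (auto simp: is_path_append)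
    have h: "(U, es, esrc C J e) \<in> Hom F U (esrc C J e)"
      using es e edge_words by (simp add: F_Hom)
    have "cls (U, es @ [e], V) = cls (epath C J e) \<bullet> cls (U, es, esrc C J e)"
      using cls_Comp[OF h epath_Hom[OF e(1)]] e by (simp add: epath_def F_Comp)
    then show ?case
      using assms(3)[OF e(1) cls_Hom[OF h]] snoc.IH e edge_words by auto
  qed
  with es show ?thesis by simp
qed

section \<open>The tensor product\<close>

text \<open>Whiskering of classes, available before the tensor product is known to be functorial.
  The interchange law is formulated with it; \<open>wh_eq_tar\<close> later identifies it with
  tensoring by identities.\<close>

definition wh :: "'o list \<Rightarrow> ('o, 'm) path set \<Rightarrow> 'o list \<Rightarrow> ('o, 'm) path set" where
  "wh T c W = cls (whisker C T (rep c) W)"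

lemma wh_cls: "p \<in> Hom F U V \<Longrightarrow> T \<in> words C \<Longrightarrow> W \<in> words C \<Longrightarrow> wh T (cls p) W = cls (whisker C T p W)"
  unfolding wh_def by (metis rep_cls(3) whisker_adj_rel cls_eq)

lemma wh_Hom: "c \<in> Hom Q U V \<Longrightarrow> T \<in> words C \<Longrightarrow> W \<in> words C \<Longrightarrow>
    wh T c W \<in> Hom Q (wtensor C T (wtensor C U W)) (wtensor C T (wtensor C V W))"
  by (auto elim!: Q_HomE simp: wh_cls intro!: cls_Hom whisker_Hom)

lemma wh_Comp: "c \<in> Hom Q U V \<Longrightarrow> d \<in> Hom Q V X \<Longrightarrow> T \<in> words C \<Longrightarrow> W \<in> words C \<Longrightarrow>
    wh T (d \<bullet> c) W = wh T d W \<bullet> wh T c W"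
  apply (elim Q_HomE)
  subgoal for p q
    using cls_Comp[OF whisker_Hom[of p U V T W] whisker_Hom[of q V X T W]] F.Comp_Hom[of p U V q X]
    by (simp add: cls_Comp wh_cls whisker_Comp)
  done

lemma wh_Id: "U \<in> words C \<Longrightarrow> T \<in> words C \<Longrightarrow> W \<in> words C \<Longrightarrow> wh T (Id Q U) W = Id Q (wtensor C T (wtensor C U W))"
  using wh_cls[OF F.Id_Hom] by (simp add: Q_sel F_Obj whisker_Id)

lemma wh_wh:
  assumes "c \<in> Hom Q U V" "T \<in> words C" "W \<in> words C" "T' \<in> words C" "W' \<in> words C"
  shows "wh T (wh T' c W') W = wh (wtensor C T T') c (wtensor C W' W)"
  using assms by (auto elim!: Q_HomE simp: wh_cls whisker_whisker wtensor_words whisker_Hom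
    wh_cls[OF whisker_Hom])

lemma wh_wunit: "c \<in> Hom Q U V \<Longrightarrow> wh (wunit C) c (wunit C) = c"
  by (auto elim!: Q_HomE simp: wh_cls wunit_words whisker_wunit)

lemma wh_epath:
  "e \<in> edges C \<Longrightarrow> T \<in> words C \<Longrightarrow> W \<in> words C \<Longrightarrow>
    wh T (cls (epath C J e)) W = cls (epath C J (ewhisker C T e W))"
  by (simp add: wh_cls[OF epath_Hom] whisker_epath)

lemma wh_interchange_edges:
  assumes a: "a \<in> edges C" and b: "b \<in> edges C"
  shows "wh (etgt C J a) (cls (epath C J b)) (wunit C) \<bullet> wh (wunit C) (cls (epath C J a)) (esrc C J b) =
    wh (wunit C) (cls (epath C J a)) (etgt C J b) \<bullet> wh (esrc C J a) (cls (epath C J b)) (wunit C)"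
proof -
  have w: "ewhisker C T e W \<in> edges C \<and> 
      epath C J (ewhisker C T e W) \<in> Hom F (wtensor C T (wtensor C (esrc C J e) W)) (wtensor C T (wtensor C (etgt C J e) W))"
    if "e \<in> edges C" "T \<in> words C" "W \<in> words C" for e T W
    using epath_Hom[OF ewhisker_edges[OF that]] ewhisker_edges[OF that] that by (simp add: esrc_ewhisker etgt_ewhisker)
  note ab = edge_words[OF a] edge_words[OF b]
  let ?l = "epath C J (ewhisker C (etgt C J a) b (wunit C)) \<cdot>\<^bsub>F\<^esub> epath C J (ewhisker C (wunit C) a (esrc C J b))"
  let ?r = "epath C J (ewhisker C (wunit C) a (etgt C J b)) \<cdot>\<^bsub>F\<^esub> epath C J (ewhisker C (esrc C J a) b (wunit C))"
  have "(?l, ?r) \<in> adj_rel C J"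
    unfolding adj_rel_def by (intro congruence.gen UnI1 base_rel.interchange a b) simp_all
  then have "cls ?l = cls ?r" by (rule cls_eq)
  then show ?thesis
    using a b ab w[OF b, of "etgt C J a" "wunit C"] w[OF b, of "esrc C J a" "wunit C"]
     w[OF a, of "wunit C" "esrc C J b"] w[OF a, of "wunit C" "etgt C J b"]
    by (simp add: wh_epath wunit_words word_simps) (metis cls_Comp)
qed

text \<open>The square of relation (iii) for arbitrary arrows. The relation imposes it on edges
  only, and the next lemmas extend it by closure under identities and composition in either
  argument.\<close>

definition interchanges :: "('o, 'm) path set \<Rightarrow> ('o, 'm) path set \<Rightarrow> bool" where
  "interchanges c d \<longleftrightarrow> wh (Cod Q c) d (wunit C) \<bullet> wh (wunit C) c (Dom Q d) =
    wh (wunit C) c (Cod Q d) \<bullet> wh (Dom Q c) d (wunit C)"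

lemma wh_left_Hom: "c \<in> Hom Q U V \<Longrightarrow> W \<in> words C \<Longrightarrow> wh (wunit C) c W \<in> Hom Q (wtensor C U W) (wtensor C V W)"
  using wh_Hom[of c U V "wunit C" W] Q_HomD[of c U V] by (simp add: word_simps)

lemma wh_right_Hom: "c \<in> Hom Q U V \<Longrightarrow> W \<in> words C \<Longrightarrow> wh W c (wunit C) \<in> Hom Q (wtensor C W U) (wtensor C W V)"
  using wh_Hom[of c U V W "wunit C"] Q_HomD[of c U V] by (simp add: word_simps)

text \<open>The squares of \<open>c\<close> and \<open>c'\<close> are pasted along their common
  side, which is \<open>d\<close> whiskered by the middle object \<open>V\<close>.\<close>

lemma interchanges_Comp_left:
  assumes c: "c \<in> Hom Q U V" "c' \<in> Hom Q V W" and d: "d \<in> Hom Q X Y"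
    and i: "interchanges c d" "interchanges c' d"
  shows "interchanges (c' \<bullet> c) d"
proof -
  note w = Q_HomD[OF c(1)] Q_HomD[OF c(2)] Q_HomD[OF d] Q_HomD[OF Q.Comp_Hom[OF c]]
  note h = wh_left_Hom[OF c(1)] wh_left_Hom[OF c(2)] wh_right_Hom[OF d]
  have "wh W d (wunit C) \<bullet> (wh (wunit C) c' X \<bullet> wh (wunit C) c X) =
    (wh W d (wunit C) \<bullet> wh (wunit C) c' X) \<bullet> wh (wunit C) c X"
    using h w by (metis Q.Comp_assoc)
  also have "\<dots> = (wh (wunit C) c' Y \<bullet> wh V d (wunit C)) \<bullet> wh (wunit C) c X"
    using i(2) w by (simp add: interchanges_def)
  also have "\<dots> = wh (wunit C) c' Y \<bullet> (wh V d (wunit C) \<bullet> wh (wunit C) c X)"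
    using h w by (metis Q.Comp_assoc)
  also have "\<dots> = wh (wunit C) c' Y \<bullet> (wh (wunit C) c Y \<bullet> wh U d (wunit C))"
    using i(1) w by (simp add: interchanges_def)
  also have "\<dots> = (wh (wunit C) c' Y \<bullet> wh (wunit C) c Y) \<bullet> wh U d (wunit C)"
    using h w by (metis Q.Comp_assoc)
  finally show ?thesis
    unfolding interchanges_def using w wh_Comp[OF c] by (simp add: wunit_words)
qed

lemma interchanges_Comp_right:
  assumes c: "c \<in> Hom Q U V" "c' \<in> Hom Q V W" and d: "d \<in> Hom Q X Y"
    and i: "interchanges d c" "interchanges d c'"
  shows "interchanges d (c' \<bullet> c)"
proof -
  note w = Q_HomD[OF c(1)] Q_HomD[OF c(2)] Q_HomD[OF d] Q_HomD[OF Q.Comp_Hom[OF c]]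
  note h = wh_right_Hom[OF c(1)] wh_right_Hom[OF c(2)] wh_left_Hom[OF d]
  have "(wh Y c' (wunit C) \<bullet> wh Y c (wunit C)) \<bullet> wh (wunit C) d U =
    wh Y c' (wunit C) \<bullet> (wh Y c (wunit C) \<bullet> wh (wunit C) d U)"
    using h w by (metis Q.Comp_assoc)
  also have "\<dots> = wh Y c' (wunit C) \<bullet> (wh (wunit C) d V \<bullet> wh X c (wunit C))"
    using i(1) w by (simp add: interchanges_def)
  also have "\<dots> = (wh Y c' (wunit C) \<bullet> wh (wunit C) d V) \<bullet> wh X c (wunit C)"
    using h w by (metis Q.Comp_assoc)
  also have "\<dots> = (wh (wunit C) d W \<bullet> wh X c' (wunit C)) \<bullet> wh X c (wunit C)"
    using i(2) w by (simp add: interchanges_def)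
  also have "\<dots> = wh (wunit C) d W \<bullet> (wh X c' (wunit C) \<bullet> wh X c (wunit C))"
    using h w by (metis Q.Comp_assoc)
  finally show ?thesis
    unfolding interchanges_def using w wh_Comp[OF c] by (simp add: wunit_words)
qed

lemma interchanges_Id:
  assumes c: "c \<in> Hom Q U V" and W: "W \<in> words C"
  shows "interchanges c (Id Q W)" "interchanges (Id Q W) c"
proof -
  note w = Q_HomD[OF c] Q_HomD[OF Q.Id_Hom[of W]] W wunit_words wtensor_words
  note l = wh_left_Hom[OF c W] wh_right_Hom[OF c W]
  show "interchanges c (Id Q W)" "interchanges (Id Q W) c"
    unfolding interchanges_def using w l
    by (simp_all add: wh_Id word_simps Q.Comp_Id[OF l(1)] Q.Comp_Id[OF l(2)] Q.Id_Comp[OF l(1)] Q.Id_Comp[OF l(2)] Q_sel(1))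
qed

text \<open>An outer induction along a path for \<open>c\<close> and an inner one along a path for
  \<open>d\<close> leave a pair of edges, where the square is a generating relation.\<close>

lemma interchanges:
  assumes c: "c \<in> Hom Q U V" and d: "d \<in> Hom Q W X"
  shows "interchanges c d"
proof -
  have e: "interchanges a d" if "a = cls (epath C J e)" "e \<in> edges C" for a e
    using d
  proof (induction rule: Q_arrow_induct)
    case Id
    then show ?case
      using that interchanges_Id(1)[OF cls_Hom[OF epath_Hom]] Q_HomD[OF d] by blast
  next
    case (edge b c)
    have "interchanges a (cls (epath C J b))"
      using wh_interchange_edges[OF that(2) edge(1)] 
        Q_HomD[OF cls_Hom[OF epath_Hom[OF edge(1)]]] Q_HomD[OF cls_Hom[OF epath_Hom[OF that(2)]]]
      by (simp add: interchanges_def that)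
    then show ?case
      using edge that interchanges_Comp_right[OF edge(2) cls_Hom[OF epath_Hom[OF edge(1)]] cls_Hom[OF epath_Hom[OF that(2)]]] by simp
  qed
  show ?thesis
    using c
  proof (induction rule: Q_arrow_induct)
    case Id
    then show ?case
      using interchanges_Id(2)[OF d] Q_HomD[OF c] by blast
  next
    case (edge b c)
    then show ?case
      using e by (intro interchanges_Comp_left[OF edge(2) cls_Hom[OF epath_Hom[OF edge(1)]] d]) auto
  qed
qed

text \<open>The first form is the definition freed from its chosen representatives; the second goes
  round the interchange square the other way.\<close>

lemma Q_tar:
  assumes "c \<in> Hom Q U V" "d \<in> Hom Q W X"
  shows "c \<diamondop> d = wh V d (wunit C) \<bullet> wh (wunit C) c W"
    "c \<diamondop> d = wh (wunit C) c X \<bullet> wh U d (wunit C)"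
proof -
  obtain p q where pq: "p \<in> Hom F U V" "q \<in> Hom F W X" "c = cls p" "d = cls q"
    using assms by (metis Q_HomE)
  note r = rep_cls(1)[OF pq(1)] rep_cls(1)[OF pq(2)]
  note u = Q_HomD[OF assms(1)] Q_HomD[OF assms(2)]
  have "c \<diamondop> d = cls (whisker C V (rep d) (wunit C) \<cdot>\<^bsub>F\<^esub> whisker C (wunit C) (rep c) W)"
    using F_HomD[OF r(1)] F_HomD[OF r(2)] by (simp add: Q_sel(9) ptensor_def pq)
  also have "\<dots> = wh V d (wunit C) \<bullet> wh (wunit C) c W"
    unfolding wh_def using u r pq(3,4) whisker_Hom[OF r(1), of "wunit C" W] whisker_Hom[OF r(2), of V "wunit C"]
    by (subst cls_Comp) (auto simp: word_simps)
  finally show "c \<diamondop> d = wh V d (wunit C) \<bullet> wh (wunit C) c W" .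
  then show "c \<diamondop> d = wh (wunit C) c X \<bullet> wh U d (wunit C)"
    using interchanges[OF assms] u by (simp add: interchanges_def)
qed

lemma wh_eq_tar:
  assumes c: "c \<in> Hom Q U V" and T: "T \<in> words C" and W: "W \<in> words C"
  shows "wh T c W = Id Q T \<diamondop> (c \<diamondop> Id Q W)"
proof -
  note u = Q_HomD[OF c] T W
  have "c \<diamondop> Id Q W = Id Q (wtensor C V W) \<bullet> wh (wunit C) c W"
    using Q_tar(1)[OF c Q.Id_Hom] u by (simp add: wh_Id word_simps Q_sel(1))
  then have 1: "c \<diamondop> Id Q W = wh (wunit C) c W"
    using Q.Id_Comp[OF wh_left_Hom[OF c W]] by simp
  have "Id Q T \<diamondop> (wh (wunit C) c W) = wh T c W \<bullet> Id Q (wtensor C T (wtensor C U W))"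
    using Q_tar(1)[OF Q.Id_Hom wh_left_Hom[OF c W]] u by (simp add: wh_Id wh_wh[OF c] word_simps Q_sel(1))
  then show ?thesis
    using Q.Comp_Id[OF wh_Hom[OF c T W]] 1 by simp
qed

text \<open>Functoriality of the tensor product is the interchange law; associativity and unit laws
  reduce to those of whiskering.\<close>

lemma Q_strict_monoidal: "strict_monoidal_category Q"
proof (intro strict_monoidal_category.intro Q_category strict_monoidal_category_axioms.intro)
  show "\<one>\<^bsub>Q\<^esub> \<in> Obj Q"
    by (simp add: Q_sel word_simps)
  fix A B assume A: "A \<in> Obj Q" and B: "B \<in> Obj Q"
  then show "A \<otimes>\<^bsub>Q\<^esub> B \<in> Obj Q"
    by (simp add: Q_sel word_simps)
  show "Id Q A \<diamondop> Id Q B = Id Q (A \<otimes>\<^bsub>Q\<^esub> B)"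
    using A B Q.Id_Hom[of "A \<otimes>\<^bsub>Q\<^esub> B"] Q_tar(1)[OF Q.Id_Hom[OF A] Q.Id_Hom[OF B]] 
      Q.Id_Comp[OF Q.Id_Hom[of "A \<otimes>\<^bsub>Q\<^esub> B"]]
    by (simp add: wh_Id Q_sel(1,7) word_simps)
  show "(A \<otimes>\<^bsub>Q\<^esub> B) \<otimes>\<^bsub>Q\<^esub> D = A \<otimes>\<^bsub>Q\<^esub> B \<otimes>\<^bsub>Q\<^esub> D" if "D \<in> Obj Q" for D
    using A B that by (simp add: Q_sel word_simps)
  show "\<one>\<^bsub>Q\<^esub> \<otimes>\<^bsub>Q\<^esub> A = A" "A \<otimes>\<^bsub>Q\<^esub> \<one>\<^bsub>Q\<^esub> = A"
    using A by (simp_all add: Q_sel word_simps)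
next
  fix f f' A B A' B' assume f: "f \<in> Hom Q A B" "f' \<in> Hom Q A' B'"
  note u = Q_HomD[OF f(1)] Q_HomD[OF f(2)]
  show "f \<diamondop> f' \<in> Hom Q (A \<otimes>\<^bsub>Q\<^esub> A') (B \<otimes>\<^bsub>Q\<^esub> B')"
    using Q.Comp_Hom[OF wh_left_Hom[OF f(1)] wh_right_Hom[OF f(2)]] u
    by (simp add: Q_tar(1)[OF f] Q_sel(7))
  fix g g' D D' assume g: "g \<in> Hom Q B D" "g' \<in> Hom Q B' D'"
  note v = Q_HomD[OF g(1)] Q_HomD[OF g(2)]
  note l = wh_left_Hom[OF f(1)] wh_left_Hom[OF g(1)] wh_right_Hom[OF f(2)] wh_right_Hom[OF g(2)]
  have "(g \<bullet> f) \<diamondop> (g' \<bullet> f') = 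
    (wh D g' (wunit C) \<bullet> wh D f' (wunit C)) \<bullet> (wh (wunit C) g A' \<bullet> wh (wunit C) f A')"
    using u v by (simp add: Q_tar(1)[OF Q.Comp_Hom[OF f(1) g(1)] Q.Comp_Hom[OF f(2) g(2)]]
       wh_Comp[OF f(1) g(1)] wh_Comp[OF f(2) g(2)] word_simps)
  also have "\<dots> = wh D g' (wunit C) \<bullet> ((wh D f' (wunit C) \<bullet> wh (wunit C) g A') \<bullet> wh (wunit C) f A')"
    using u v by (intro Q.Comp_assoc4[OF l(1)[of A'] l(2)[of A'] l(3)[of D] l(4)[of D]]) simp_all
  \<comment> \<open>The two inner arrows act on different tensor factors. Exchanging them is the
    only step that is not regrouping.\<close>
  also have "\<dots> = wh D g' (wunit C) \<bullet> ((wh (wunit C) g B' \<bullet> wh B f' (wunit C)) \<bullet> wh (wunit C) f A')"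
    using interchanges[OF g(1) f(2)] u v by (simp add: interchanges_def)
  also have "\<dots> = (wh D g' (wunit C) \<bullet> wh (wunit C) g B') \<bullet> (wh B f' (wunit C) \<bullet> wh (wunit C) f A')"
    using u v by (intro Q.Comp_assoc4[OF l(1)[of A'] l(3)[of B] l(2)[of B'] l(4)[of D], symmetric]) simp_all
  finally show "(g \<bullet> f) \<diamondop> (g' \<bullet> f') = (g \<diamondop> g') \<bullet> (f \<diamondop> f')"
    by (simp add: Q_tar(1)[OF f] Q_tar(1)[OF g])
next
  fix f assume "f \<in> Arr Q"
  then obtain A B where f: "f \<in> Hom Q A B" by (auto simp: Hom_def)
  note u = Q_HomD[OF f]
  have o: "wunit C \<in> Obj Q" by (simp add: Q_sel wunit_words)
  show "Id Q \<one>\<^bsub>Q\<^esub> \<diamondop> f = f" "f \<diamondop> Id Q \<one>\<^bsub>Q\<^esub> = f"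
    using u Q_tar(1)[OF Q.Id_Hom[OF o] f] Q_tar(1)[OF f Q.Id_Hom[OF o]]
    by (simp_all add: wh_Id wh_wunit[OF f] word_simps Q_sel(8) Q.Id_Comp[OF f] Q.Comp_Id[OF f])
  fix g h assume "g \<in> Arr Q" "h \<in> Arr Q"
  then obtain A' B' A'' B'' where g: "g \<in> Hom Q A' B'" and h: "h \<in> Hom Q A'' B''" by (auto simp: Hom_def)
  note v = Q_HomD[OF g] Q_HomD[OF h]
  have fg: "wh B g (wunit C) \<bullet> wh (wunit C) f A' \<in> Hom Q (wtensor C A A') (wtensor C B B')"
    using u v by (intro Q.Comp_Hom[OF wh_left_Hom[OF f] wh_right_Hom[OF g]]) auto
  have gh: "wh B' h (wunit C) \<bullet> wh (wunit C) g A'' \<in> Hom Q (wtensor C A' A'') (wtensor C B' B'')"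
    using u v by (intro Q.Comp_Hom[OF wh_left_Hom[OF g] wh_right_Hom[OF h]]) auto
  note ww = wh_wh[OF f] wh_wh[OF g] wh_wh[OF h]
  note wl = wh_left_Hom[OF f] wh_left_Hom[OF g] wh_left_Hom[OF h]  wh_right_Hom[OF f] wh_right_Hom[OF g] wh_right_Hom[OF h]
  \<comment> \<open>Both bracketings unfold to one composite of three whiskerings, with
    \<open>f\<close> applied first, then \<open>g\<close>, then \<open>h\<close>.\<close>
  have "(f \<diamondop> g) \<diamondop> h = wh (wtensor C B B') h (wunit C) \<bullet> (wh B g A'' \<bullet> wh (wunit C) f (wtensor C A' A''))"
    using u v fg wl wh_Comp[OF wh_left_Hom[OF f, of A'] wh_right_Hom[OF g, of B], of "wunit C" A'']
    by (simp add: Q_tar(1)[OF f g] Q_tar(1)[OF fg h] ww word_simps)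
  also have "\<dots> = (wh (wtensor C B B') h (wunit C) \<bullet> wh B g A'') \<bullet> wh (wunit C) f (wtensor C A' A'')"
    apply (rule Q.Comp_assoc[symmetric])
      apply (rule wl(1))
    using u v wl wh_Hom[OF g, of B A''] wh_right_Hom[OF h, of "wtensor C B B'"] by (auto simp: word_simps)
  also have "\<dots> = f \<diamondop> (g \<diamondop> h)"
    using u v gh wl wh_Comp[OF wh_left_Hom[OF g, of A''] wh_right_Hom[OF h, of B'], of B "wunit C"]
    by (simp add: Q_tar(1)[OF g h] Q_tar(1)[OF f gh] ww word_simps)
  finally show "(f \<diamondop> g) \<diamondop> h = f \<diamondop> g \<diamondop> h" .
qed

sublocale Q: strict_monoidal_category Q
  by (rule Q_strict_monoidal)

end

section \<open>Transposition along a dual pair\<close>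

context strict_monoidal_category
begin

lemma tar_Hom': "\<lbrakk>f \<in> Hom C A B; f' \<in> Hom C A' B'; U = A \<otimes> A'; V = B \<otimes> B'\<rbrakk> \<Longrightarrow> f \<star> f' \<in> Hom C U V"
  by (simp add: tar_Hom)

lemma left_Comp: 
  assumes "A \<in> Obj C" "f \<in> Hom C B D" "g \<in> Hom C D E"
  shows "Id C A \<star> (g \<cdot> f) = (Id C A \<star> g) \<cdot> (Id C A \<star> f)"
  using tar_Comp[OF Id_Hom Id_Hom assms(2,3)] Id_Comp[OF Id_Hom] assms by simp

lemma right_Comp: 
  assumes "A \<in> Obj C" "f \<in> Hom C B D" "g \<in> Hom C D E"
  shows "(g \<cdot> f) \<star> Id C A = (g \<star> Id C A) \<cdot> (f \<star> Id C A)"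
  using tar_Comp[OF assms(2,3) Id_Hom Id_Hom] Id_Comp[OF Id_Hom] assms by simp

lemma tar_split:
  assumes "f \<in> Hom C A B" "g \<in> Hom C A' B'"
  shows "(f \<star> Id C B') \<cdot> (Id C A \<star> g) = f \<star> g" "(Id C B \<star> g) \<cdot> (f \<star> Id C A') = f \<star> g"
  using assms tar_Comp[OF Id_Hom assms(1,2) Id_Hom] tar_Comp[OF assms(1) Id_Hom Id_Hom assms(2)]
  by (simp_all add: HomD Comp_Id[OF assms(1)] Id_Comp[OF assms(1)] Comp_Id[OF assms(2)] Id_Comp[OF assms(2)])

lemma tar_Id_Id:
  assumes "f \<in> Hom C U V" "A \<in> Obj C" "B \<in> Obj C"
  shows "Id C A \<star> (Id C B \<star> f) = Id C (A \<otimes> B) \<star> f"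
    "(f \<star> Id C A) \<star> Id C B = f \<star> Id C (A \<otimes> B)"
    "(Id C A \<star> f) \<star> Id C B = Id C A \<star> (f \<star> Id C B)"
  using assms HomD[OF Id_Hom[of A]] HomD[OF Id_Hom[of B]] HomD[OF assms(1)] 
    tar_assoc[of "Id C A" "Id C B" f] by (simp_all add: tar_assoc tar_Id)

end

text \<open>Separated from C[J^v] so that transposition is calculated from a few abstract facts. The
  identity \<open>triangle\<close> is the one by which the counit undoes a transposition.\<close>

locale dual_pair = strict_monoidal_category D
  for D :: "('o, 'm, 'z) smcat_scheme" (structure) +
  fixes X Xd :: 'o and unit counit :: 'm
  assumes X_Obj: "X \<in> Obj D" and Xd_Obj: "Xd \<in> Obj D"
    and unit_Hom: "unit \<in> Hom D \<one> (Xd \<otimes> X)"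
    and counit_Hom: "counit \<in> Hom D (X \<otimes> Xd) \<one>"
    and triangle: "(counit \<star> Id D X) \<cdot> (Id D X \<star> unit) = Id D X"
begin

text \<open>The transpose of \<open>c : X \<otimes> B -> V\<close> to an arrow
  \<open>B -> Xd \<otimes> V\<close>. The object \<open>B\<close> is a separate argument because it
  cannot be recovered from \<open>X \<otimes> B\<close>.\<close>

definition mate :: "'o \<Rightarrow> 'm \<Rightarrow> 'm" where
  "mate B c = (Id D Xd \<star> c) \<cdot> (unit \<star> Id D B)"

lemma unit_right_Hom: "B \<in> Obj D \<Longrightarrow> unit \<star> Id D B \<in> Hom D B (Xd \<otimes> (X \<otimes> B))"
  using tar_Hom[OF unit_Hom Id_Hom] by (simp add: unit_tob tob_assoc X_Obj Xd_Obj)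

lemma counit_right_Hom: "B \<in> Obj D \<Longrightarrow> counit \<star> Id D B \<in> Hom D (X \<otimes> (Xd \<otimes> B)) B"
  using tar_Hom[OF counit_Hom Id_Hom] by (simp add: unit_tob tob_assoc X_Obj Xd_Obj)

lemma mate_Hom:
  assumes "c \<in> Hom D (X \<otimes> B) V" "B \<in> Obj D"
  shows "mate B c \<in> Hom D B (Xd \<otimes> V)"
  unfolding mate_def
  by (rule Comp_Hom[OF unit_right_Hom tar_Hom[OF Id_Hom]]) (use assms Xd_Obj in auto)

lemma mate_post:
  assumes "c \<in> Hom D (X \<otimes> B) V" "B \<in> Obj D" "e \<in> Hom D V W"
  shows "mate B (e \<cdot> c) = (Id D Xd \<star> e) \<cdot> mate B c"
  unfolding mate_def left_Comp[OF Xd_Obj assms(1,3)]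
  using assms Xd_Obj by (intro Comp_assoc[OF unit_right_Hom]) (auto intro!: tar_Hom Id_Hom)

text \<open>\<open>h\<close> and \<open>unit\<close> act on different tensor factors, so
  \<open>h\<close> can be moved in front of \<open>unit\<close>.\<close>

lemma mate_pre:
  assumes "c \<in> Hom D (X \<otimes> B) V" "h \<in> Hom D B' B"
  shows "mate B' (c \<cdot> (Id D X \<star> h)) = mate B c \<cdot> h"
proof -
  have o: "B \<in> Obj D" "B' \<in> Obj D"
    using HomD[OF assms(2)] by auto
  note h = tar_Hom[OF Id_Hom[OF X_Obj] assms(2)]
  have "mate B' (c \<cdot> (Id D X \<star> h)) = (Id D Xd \<star> c) \<cdot> ((Id D (Xd \<otimes> X) \<star> h) \<cdot> (unit \<star> Id D B'))"
    unfolding mate_def left_Comp[OF Xd_Obj h assms(1)]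
    using Comp_assoc[OF unit_right_Hom[OF o(2)] tar_Hom[OF Id_Hom h] tar_Hom[OF Id_Hom assms(1)]] Xd_Obj
    by (simp add: tar_Id_Id(1)[OF assms(2) Xd_Obj X_Obj])
  also have "(Id D (Xd \<otimes> X) \<star> h) \<cdot> (unit \<star> Id D B') = (unit \<star> Id D B) \<cdot> h"
    using tar_split[OF unit_Hom assms(2)] assms by (simp add: HomD unit_tar)
  finally show ?thesis
    unfolding mate_def using Comp_assoc[OF assms(2) unit_right_Hom tar_Hom[OF Id_Hom assms(1)]] o Xd_Obj
    by simp
qed

lemma mate_Id:
  assumes "B \<in> Obj D"
  shows "mate B (Id D (X \<otimes> B)) = unit \<star> Id D B"
  unfolding mate_def
  using Id_Comp[OF unit_right_Hom] assms by (simp add: X_Obj Xd_Obj tob_Obj tar_Id)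

text \<open>This turns an arrow followed by the unit into a transpose, which is how an
  \<open>Eta\<close> edge is brought into the special form.\<close>

lemma mate_left:
  assumes "k \<in> Hom D B V"
  shows "mate B (Id D X \<star> k) = (unit \<star> Id D V) \<cdot> k"
proof -
  have o: "B \<in> Obj D" "V \<in> Obj D"
    using HomD[OF assms] by auto
  show ?thesis
    using mate_pre[OF Id_Hom[of "X \<otimes> V"] assms] Id_Comp[OF tar_Hom[OF Id_Hom[OF X_Obj] assms]] o
    by (simp add: mate_Id tob_Obj X_Obj)
qed

text \<open>\<open>counit\<close> interchanges with \<open>c\<close>, then meets
  \<open>unit\<close>, and the triangle identity cancels the two.\<close>

lemma counit_mate:
  assumes "c \<in> Hom D (X \<otimes> B) V" "B \<in> Obj D"
  shows "(counit \<star> Id D V) \<cdot> (Id D X \<star> mate B c) = c"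
proof -
  have V: "V \<in> Obj D" using HomD[OF assms(1)] by simp
  note o = assms(2) X_Obj Xd_Obj V tob_Obj
  note eB = tar_Hom[OF Id_Hom[OF X_Obj] unit_right_Hom[OF assms(2)]]
  note c1 = tar_Hom[OF Id_Hom[OF Xd_Obj] assms(1)]
  note c2 = tar_Hom[OF Id_Hom[OF X_Obj] c1]
  have "(counit \<star> Id D V) \<cdot> (Id D X \<star> mate B c) =
    (counit \<star> Id D V) \<cdot> ((Id D X \<star> (Id D Xd \<star> c)) \<cdot> (Id D X \<star> (unit \<star> Id D B)))"
    unfolding mate_def using o by (subst left_Comp[OF _ unit_right_Hom c1]) simp_all
  also have "\<dots> = ((counit \<star> Id D V) \<cdot> (Id D (X \<otimes> Xd) \<star> c)) \<cdot> (Id D X \<star> (unit \<star> Id D B))"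
    using o Comp_assoc[OF eB c2 counit_right_Hom] by (simp add: tar_Id_Id(1)[OF assms(1)])
  also have "(counit \<star> Id D V) \<cdot> (Id D (X \<otimes> Xd) \<star> c) = c \<cdot> (counit \<star> Id D (X \<otimes> B))"
    using tar_split[OF counit_Hom assms(1)] HomD[OF assms(1)] by (simp add: unit_tar)
  also have "(c \<cdot> (counit \<star> Id D (X \<otimes> B))) \<cdot> (Id D X \<star> (unit \<star> Id D B)) =
      c \<cdot> ((counit \<star> Id D (X \<otimes> B)) \<cdot> (Id D X \<star> (unit \<star> Id D B)))"
    using o by (intro Comp_assoc[OF eB counit_right_Hom assms(1)]) simp
  also have "(counit \<star> Id D (X \<otimes> B)) \<cdot> (Id D X \<star> (unit \<star> Id D B)) = 
      ((counit \<star> Id D X) \<cdot> (Id D X \<star> unit)) \<star> Id D B"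
    using o by (subst right_Comp[OF _ tar_Hom[OF Id_Hom unit_Hom] tar_Hom'[OF counit_Hom Id_Hom]])
      (auto simp: tob_assoc tar_Id_Id(2)[OF counit_Hom] tar_Id_Id(3)[OF unit_Hom])
  finally show ?thesis
    using o Comp_Id[OF assms(1)] by (simp add: triangle tar_Id)
qed

end

section \<open>Arrows out of an object of the base category\<close>

context adjoined_dual
begin

lemmas Q_simps [simp] = Q_sel(1,7,8)

text \<open>Agrees with \<open>Fa (Omega C J)\<close> on the arrows of \<open>C\<close>, but without
  its restriction, so that no membership has to be discharged when it is unfolded.\<close>

definition emb :: "'m \<Rightarrow> ('o, 'm) path set" where
  "emb f = edge_class C J (Bar f)"

section \<open>Primitive edges as arrows of C[J^v]\<close>

lemma edge_class_cls: "edge_class C J p = cls (epath C J (wunit C, p, wunit C))"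
  by (simp add: edge_class_def cls_def)

lemma edge_class_Hom:
  assumes "p \<in> {Eps, Eta} \<union> Bar ` Arr C"
  shows "edge_class C J p \<in> Hom Q (psrc C J p) (ptgt C J p)"
proof -
  have "(wunit C, p, wunit C) \<in> edges C"
    using assms by (auto simp: edges_def wunit_words)
  from cls_Hom[OF epath_Hom[OF this]] show ?thesis
    using psrc_words[OF assms] ptgt_words[OF assms] by (simp add: edge_class_cls esrc_def etgt_def word_simps)
qed

lemma emb_Hom: "f \<in> Hom C A B \<Longrightarrow> emb f \<in> Hom Q [A] [B]"
  using edge_class_Hom[of "Bar f"] by (auto simp: emb_def Hom_def)

text \<open>Formal whiskering becomes tensoring with identities, so composing with an edge reduces
  to the three kinds of primitive edges.\<close>

lemma cls_epath:
  assumes "(U, p, V) \<in> edges C"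
  shows "cls (epath C J (U, p, V)) = Id Q U \<diamondop> (edge_class C J p \<diamondop> Id Q V)"
proof -
  have e: "(wunit C, p, wunit C) \<in> edges C" "U \<in> words C" "V \<in> words C"
    using assms by (auto simp: edges_def wunit_words)
  have "cls (epath C J (U, p, V)) = wh U (edge_class C J p) V"
    using wh_epath[OF e(1), of U V] e by (simp add: edge_class_cls ewhisker_def word_simps)
  also have "\<dots> = Id Q U \<diamondop> (edge_class C J p \<diamondop> Id Q V)"
    by (rule wh_eq_tar[OF edge_class_Hom]) (use assms e in \<open>auto simp: edges_def\<close>)
  finally show ?thesis .
qed

lemma adj_rel_base: "(p, q) \<in> base_rel C J \<Longrightarrow> cls p = cls q"
  unfolding adj_rel_def by (intro cls_eq) (auto simp: adj_rel_def intro: congruence.gen)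

lemma emb_Id: "A \<in> Obj C \<Longrightarrow> emb (Id C A) = Id Q [A]"
  using adj_rel_base[OF base_rel.bar_Id] by (simp add: emb_def edge_class_cls Q_sel)

lemma emb_Comp:
  assumes "f \<in> Hom C A B" "g \<in> Hom C B D"
  shows "emb (g \<cdot> f) = emb g \<bullet> emb f"
proof -
  have e: "(wunit C, Bar f, wunit C) \<in> edges C" "(wunit C, Bar g, wunit C) \<in> edges C"
    using assms by (auto simp: edges_def wunit_words Hom_def)
  have "emb (g \<cdot> f) = cls (epath C J (wunit C, Bar g, wunit C) \<cdot>\<^bsub>F\<^esub> epath C J (wunit C, Bar f, wunit C))"
    unfolding emb_def edge_class_cls using assms by (intro adj_rel_base base_rel.bar_Comp) (auto simp: Hom_def)
  also have "\<dots> = emb g \<bullet> emb f"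
    unfolding emb_def edge_class_cls
    using cls_Comp[of "epath C J (wunit C, Bar f, wunit C)" "[A]" "[B]" "epath C J (wunit C, Bar g, wunit C)" "[D]"]
      epath_Hom[OF e(1)] epath_Hom[OF e(2)] HomD[OF assms(1)] HomD[OF assms(2)]
    by (simp add: esrc_def etgt_def word_simps)
  finally show ?thesis .
qed

lemma emb_whisker:
  assumes "f \<in> Arr C" "E \<in> Obj C" "G \<in> Obj C"
  shows "Id Q [E] \<diamondop> (emb f \<diamondop> Id Q [G]) = emb (Id C E \<star> (f \<star> Id C G))"
proof -
  have "([E], Bar f, [G]) \<in> edges C"
    using assms by (auto simp: edges_def word_simps)
  from cls_epath[OF this] show ?thesis
    unfolding emb_def using adj_rel_base[OF base_rel.bar_whisker[OF assms(2,1,3)]] by (simp add: edge_class_cls)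
qed

text \<open>Relation (i) with the unit as right factor.\<close>

lemma emb_left:
  assumes "f \<in> Hom C A B" "E \<in> Obj C"
  shows "Id Q [E] \<diamondop> emb f = emb (Id C E \<star> f)"
  using emb_whisker[of f E "\<one>"] assms HomD[OF assms(1)] Q.HomD[OF emb_Hom[OF assms(1)]] Q.tar_unit
  by (simp add: unit_Obj tar_unit wunit_def)

lemma Q_triangle:
  "(edge_class C J Eps \<diamondop> Id Q [J]) \<bullet> (Id Q [J] \<diamondop> edge_class C J Eta) = Id Q [J]"
proof -
  note h = edge_class_Hom[of Eps] edge_class_Hom[of Eta]
  have e: "(wunit C, Eps, [J]) \<in> edges C" "([J], Eta, wunit C) \<in> edges C"
    by (auto simp: edges_def word_simps)
  have a: "edge_class C J Eps \<diamondop> Id Q [J] \<in> Arr Q" 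
    using h Q.HomD[OF Q.tar_Hom[OF h(1) Q.Id_Hom[of "[J]"]]] by (simp add: word_simps)
  have 1: "cls (epath C J (wunit C, Eps, [J])) = edge_class C J Eps \<diamondop> Id Q [J]"
    using cls_epath[OF e(1)] Q.unit_tar[OF a] by simp
  have 2: "cls (epath C J ([J], Eta, wunit C)) = Id Q [J] \<diamondop> edge_class C J Eta"
    using cls_epath[OF e(2)] Q.tar_unit[of "edge_class C J Eta"] Q.HomD[OF h(2)] by simp
  have "epath C J (wunit C, Eps, [J]) \<in> Hom F (wtensor C [J] (wtensor C (Jdual C) [J])) [J]"
    "epath C J ([J], Eta, wunit C) \<in> Hom F [J] (wtensor C [J] (wtensor C (Jdual C) [J]))"
    using epath_Hom[OF e(1)] epath_Hom[OF e(2)] by (simp_all add: word_simps esrc_def etgt_def)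
  from cls_Comp[OF this(2,1)] show ?thesis
    using adj_rel_base[OF base_rel.triangle_J] 1 2 by (simp add: Q_sel(5))
qed

sublocale Q: dual_pair Q "[J]" "Jdual C" "edge_class C J Eta" "edge_class C J Eps"
  using edge_class_Hom[of Eta] edge_class_Hom[of Eps] Q_triangle
  by unfold_locales (auto simp: word_simps)

text \<open>The arrows of the special form, with tails again of this form, starting at
  \<open>J \<otimes> B\<close>. It is a set of arrows and not a normal form: different
  \<open>B\<close>, \<open>c\<close>, \<open>f\<close> may give the same arrow. No word is empty, so
  the empty list gets the empty set.\<close>

fun composites :: "'o list \<Rightarrow> 'o \<Rightarrow> ('o, 'm) path set set" where
  "composites [] A = {}"
| "composites [X] A = emb ` Hom C A X"
| "composites (X # X' # Ws) A = {(Id Q [X] \<diamondop> Q.mate [B] c) \<bullet> emb f | B c f.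
     B \<in> Obj C \<and> f \<in> Hom C A (X \<otimes> B) \<and> c \<in> composites (X' # Ws) (J \<otimes> B)}"

lemma composites_Cons: "W \<noteq> [] \<Longrightarrow> composites (X # W) A = {(Id Q [X] \<diamondop> Q.mate [B] c) \<bullet> emb f | B c f.
     B \<in> Obj C \<and> f \<in> Hom C A (X \<otimes> B) \<and> c \<in> composites W (J \<otimes> B)}"
  by (cases W) auto

text \<open>The two unit letters of \<open>Jdual C\<close> are absorbed by their neighbours, so
  putting a letter in front of a word is tensoring with this letter and
  \<open>Jdual C\<close>.\<close>

lemma single_wtensor_Jdual: "W \<in> words C \<Longrightarrow> X \<in> Obj C \<Longrightarrow> wtensor C [X] (wtensor C (Jdual C) W) = X # W"
  by (cases W) (auto simp: wtensor_def Jdual_def words_def tob_unit unit_tob)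

lemma words_Cons: "W \<noteq> [] \<Longrightarrow> X # W \<in> words C \<longleftrightarrow> X \<in> Obj C \<and> W \<in> words C"
  by (auto simp: words_def)

lemma single_wtensor_single: "wtensor C [X] [Y] = [X \<otimes> Y]"
  by (simp add: wtensor_def)

lemma step_Hom:
  assumes "c \<in> Hom Q [J \<otimes> B] W" "B \<in> Obj C" "X \<in> Obj C" "f \<in> Hom C A (X \<otimes> B)"
  shows "Id Q [X] \<diamondop> Q.mate [B] c \<in> Hom Q [X \<otimes> B] (X # W)" 
    "(Id Q [X] \<diamondop> Q.mate [B] c) \<bullet> emb f \<in> Hom Q [A] (X # W)"
proof -
  have W: "W \<in> words C" using Q_HomD[OF assms(1)] by simp
  have "Q.mate [B] c \<in> Hom Q [B] (wtensor C (Jdual C) W)"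
    using Q.mate_Hom[of c "[B]" W] assms by (simp add: single_wtensor_single word_simps)
  with Q.tar_Hom[OF Q.Id_Hom[of "[X]"] this] show 1: "Id Q [X] \<diamondop> Q.mate [B] c \<in> Hom Q [X \<otimes> B] (X # W)"
    using assms W by (simp add: single_wtensor_single word_simps single_wtensor_Jdual del: wtensor_assoc)
  show "(Id Q [X] \<diamondop> Q.mate [B] c) \<bullet> emb f \<in> Hom Q [A] (X # W)"
    by (rule Q.Comp_Hom[OF emb_Hom[OF assms(4)] 1])
qed

lemma composites_Hom: "W \<in> words C \<Longrightarrow> w \<in> composites W A \<Longrightarrow> w \<in> Hom Q [A] W"
proof (induction W A arbitrary: w rule: composites.induct)
  case (3 X X' Ws A)
  then show ?case
    using step_Hom(2) by (auto simp: words_Cons)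
qed (auto intro: emb_Hom)

lemma wtensor_single_Cons: "wtensor C [X] (Y # V) = (X \<otimes> Y) # V"
  by (simp add: wtensor_def)

text \<open>\<open>X\<close> merges with the first letter of \<open>V\<close>. The base part of
  \<open>c\<close> tensored with \<open>X\<close> is again a base arrow by relation (i), so it
  composes with \<open>f\<close> inside \<open>C\<close>, and the transposed tail stays as it
  is.\<close>

lemma composites_tensor:
  assumes "V \<in> words C" "c \<in> composites V D" "f \<in> Hom C A (X \<otimes> D)" "X \<in> Obj C" "D \<in> Obj C"
  shows "(Id Q [X] \<diamondop> c) \<bullet> emb f \<in> composites (wtensor C [X] V) A"
proof (cases V)
  case (Cons Z V')
  show ?thesis
  proof (cases "V' = []")
    case True
    with Cons assms obtain g where g: "g \<in> Hom C D Z" "c = emb g" by auto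
    note Xg = tar_Hom[OF Id_Hom[OF assms(4)] g(1)]
    have "(Id Q [X] \<diamondop> c) \<bullet> emb f = emb ((Id C X \<star> g) \<cdot> f)"
      using g emb_Comp[OF assms(3) Xg] emb_left[OF g(1) assms(4)] by simp
    with Comp_Hom[OF assms(3) Xg] show ?thesis
      by (simp add: Cons True wtensor_single_Cons)
  next
    case False
    with Cons assms obtain B c' g where g: "B \<in> Obj C" "g \<in> Hom C D (Z \<otimes> B)" "c' \<in> composites V' (J \<otimes> B)"
      "c = (Id Q [Z] \<diamondop> Q.mate [B] c') \<bullet> emb g" by (auto simp: composites_Cons)
    have Z: "Z \<in> Obj C" "V' \<in> words C"
      using assms(1) Cons False by (auto simp: words_Cons)
    have c': "c' \<in> Hom Q [J \<otimes> B] V'"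
      using composites_Hom Z g by blast
    have t: "Q.mate [B] c' \<in> Hom Q [B] (wtensor C (Jdual C) V')"
      using Q.mate_Hom[of c' "[B]" V'] c' g by (simp add: single_wtensor_single word_simps)
    note s = step_Hom(1)[OF c' g(1) Z(1) g(2)]
    note Xg = tar_Hom[OF Id_Hom[OF assms(4)] g(2)]
    note Xs = Q.tar_Hom[OF Q.Id_Hom[of "[X]"] s]
    have "(Id Q [X] \<diamondop> c) \<bullet> emb f = 
      ((Id Q [X] \<diamondop> (Id Q [Z] \<diamondop> Q.mate [B] c')) \<bullet> emb (Id C X \<star> g)) \<bullet> emb f"
      unfolding g(4) using Q.left_Comp[OF _ emb_Hom[OF g(2)] s, of "[X]"] emb_left[OF g(2) assms(4)] assms
      by (simp add: word_simps)
    also have "\<dots> = (Id Q [X] \<diamondop> (Id Q [Z] \<diamondop> Q.mate [B] c')) \<bullet> (emb (Id C X \<star> g) \<bullet> emb f)"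
      using Q.Comp_assoc[OF emb_Hom[OF assms(3)] emb_Hom[OF Xg]] Xs assms(4)
      by (simp add: single_wtensor_single word_simps)
    also have "\<dots> = (Id Q [X \<otimes> Z] \<diamondop> Q.mate [B] c') \<bullet> emb ((Id C X \<star> g) \<cdot> f)"
      using Q.tar_Id_Id(1)[OF t, of "[X]" "[Z]"] emb_Comp[OF assms(3) Xg] Z assms by (simp add: word_simps single_wtensor_single)
    finally show ?thesis
      using Comp_Hom[OF assms(3) Xg] g(1,3) tob_assoc[OF assms(4) Z(1) g(1)]
      by (simp add: Cons wtensor_single_Cons composites_Cons[OF False]) metis
  qed
qed (use assms in auto)

text \<open>Converse of \<open>composites_tensor\<close>. With \<open>Z\<close> the first letter of
  \<open>V\<close>, the witness \<open>D\<close> is \<open>Z\<close> for a one-letter word and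
  \<open>Z \<otimes> B\<close> otherwise; the base part of \<open>c\<close> is an identity, so the
  whole of \<open>f\<close> remains outside.\<close>

lemma composites_split:
  assumes "V \<in> words C" "X \<in> Obj C" "w \<in> composites (wtensor C [X] V) A"
  obtains D c f where "D \<in> Obj C" "c \<in> composites V D" "f \<in> Hom C A (X \<otimes> D)" "w = (Id Q [X] \<diamondop> c) \<bullet> emb f"
proof (cases V)
  case (Cons Z V')
  show ?thesis
  proof (cases "V' = []")
    case True
    then have Z: "Z \<in> Obj C"
      using assms(1) Cons by (auto simp: words_def)
    obtain f where f: "f \<in> Hom C A (X \<otimes> Z)" "w = emb f"
      using assms by (auto simp: Cons True wtensor_single_Cons)
    have "Id C Z \<in> Hom C Z Z" using Z by (rule Id_Hom)
    moreover have "w = (Id Q [X] \<diamondop> emb (Id C Z)) \<bullet> emb f"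
      using f Q.Id_Comp[OF emb_Hom[OF f(1)]] emb_left[OF Id_Hom[OF Z] assms(2)] Z assms(2)
      by (simp add: tar_Id emb_Id tob_Obj)
    ultimately show ?thesis
      using that[of Z "emb (Id C Z)" f] f Z by (simp add: Cons True)
  next
    case False
    then have Z: "Z \<in> Obj C" "V' \<in> words C"
      using assms(1) Cons by (auto simp: words_Cons)
    obtain B c f where "B \<in> Obj C" "f \<in> Hom C A ((X \<otimes> Z) \<otimes> B)" "c \<in> composites V' (J \<otimes> B)"
      "w = (Id Q [X \<otimes> Z] \<diamondop> Q.mate [B] c) \<bullet> emb f"
      using assms(3) by (auto simp: Cons wtensor_single_Cons composites_Cons[OF False])
    then have f: "B \<in> Obj C" "f \<in> Hom C A (X \<otimes> (Z \<otimes> B))" "c \<in> composites V' (J \<otimes> B)"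
      "w = (Id Q [X \<otimes> Z] \<diamondop> Q.mate [B] c) \<bullet> emb f"
      using assms(2) Z(1) by (simp_all add: tob_assoc)
    have ZB: "Z \<otimes> B \<in> Obj C" using Z f by (simp add: tob_Obj)
    have c: "c \<in> Hom Q [J \<otimes> B] V'"
      using composites_Hom Z f by blast
    have t: "Q.mate [B] c \<in> Hom Q [B] (wtensor C (Jdual C) V')"
      using Q.mate_Hom[of c "[B]" V'] c f by (simp add: single_wtensor_single word_simps)
    note s = step_Hom(1)[OF c f(1) Z(1) Id_Hom[OF ZB]]
    have "(Id Q [Z] \<diamondop> Q.mate [B] c) \<bullet> emb (Id C (Z \<otimes> B)) \<in> composites V (Z \<otimes> B)"
      unfolding Cons composites_Cons[OF False] using f(1,3) Id_Hom[OF ZB] by blast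
    moreover have "(Id Q [Z] \<diamondop> Q.mate [B] c) \<bullet> emb (Id C (Z \<otimes> B)) = Id Q [Z] \<diamondop> Q.mate [B] c"
      using Q.Comp_Id[OF s] by (simp add: emb_Id ZB)
    moreover have "w = (Id Q [X] \<diamondop> (Id Q [Z] \<diamondop> Q.mate [B] c)) \<bullet> emb f"
      using Q.tar_Id_Id(1)[OF t, of "[X]" "[Z]"] f Z assms(2) by (simp add: word_simps single_wtensor_single)
    ultimately show ?thesis
      using that[OF ZB _ f(2)] by simp
  qed
qed (use assms in \<open>auto simp: words_def\<close>)

text \<open>The left whisker is a single letter, the case in which the edge touches the head of the
  word; longer whiskers are reduced to this one in \<open>composites_edge\<close>.\<close>

lemma composites_prim:
  assumes p: "p \<in> {Eps, Eta} \<union> Bar ` Arr C" and V: "V \<in> words C" and X: "X \<in> Obj C"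
    and w: "w \<in> composites (wtensor C [X] (wtensor C (psrc C J p) V)) A"
  shows "(Id Q [X] \<diamondop> (edge_class C J p \<diamondop> Id Q V)) \<bullet> w \<in> composites (wtensor C [X] (wtensor C (ptgt C J p) V)) A"
proof -
  note o = V X word_simps
  have e: "Id Q [X] \<diamondop> (edge_class C J p \<diamondop> Id Q V) \<in> 
      Hom Q (wtensor C [X] (wtensor C (psrc C J p) V)) (wtensor C [X] (wtensor C (ptgt C J p) V))"
    using Q.tar_Hom[OF Q.Id_Hom[of "[X]"] Q.tar_Hom[OF edge_class_Hom[OF p] Q.Id_Hom[of V]]] o by simp
  have Bar: ?thesis if u: "p = Bar u" "u \<in> Hom C D E" for u D E
  proof -
    note DE = HomD[OF u(2)]
    note XD = tob_Obj[OF X, of D]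
    \<comment> \<open>The source letter \<open>D\<close> of \<open>u\<close> merges with
      \<open>X\<close>. Splitting \<open>w\<close> at \<open>X \<otimes> D\<close> leaves a base
      arrow into \<open>(X \<otimes> D) \<otimes> B\<close>, on which \<open>u\<close> can act
      inside \<open>C\<close>.\<close>
    have "w \<in> composites (wtensor C [X \<otimes> D] V) A"
      using w u DE o by (simp add: wtensor_assoc[symmetric] single_wtensor_single del: wtensor_assoc)
    then obtain B c f where f: "B \<in> Obj C" "c \<in> composites V B" "f \<in> Hom C A ((X \<otimes> D) \<otimes> B)" 
      "w = (Id Q [X \<otimes> D] \<diamondop> c) \<bullet> emb f"
      using composites_split[OF V XD] DE by metis
    note c = composites_Hom[OF V f(2)]
    have f': "f \<in> Hom C A (X \<otimes> (D \<otimes> B))" using f DE o by (simp add: tob_assoc)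
    note uB = tar_Hom[OF u(2) Id_Hom[OF f(1)]]
    note XuB = tar_Hom[OF Id_Hom[OF X] uB]
    have Xu: "Id Q [X] \<diamondop> emb u \<in> Hom Q [X \<otimes> D] [X \<otimes> E]"
      using Q.tar_Hom[OF Q.Id_Hom[of "[X]"] emb_Hom[OF u(2)]] o by (simp add: single_wtensor_single)
    have 1: "Id Q [X] \<diamondop> (emb u \<diamondop> Id Q S) = (Id Q [X] \<diamondop> emb u) \<diamondop> Id Q S" if "S \<in> words C" for S
      using Q.tar_Id_Id(3)[OF emb_Hom[OF u(2)], of "[X]" S] that o by simp
    have "(Id Q [X] \<diamondop> (emb u \<diamondop> Id Q V)) \<bullet> w =
      (((Id Q [X] \<diamondop> emb u) \<diamondop> Id Q V) \<bullet> (Id Q [X \<otimes> D] \<diamondop> c)) \<bullet> emb f"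
      unfolding f(4) 1[OF V]
      by (rule Q.Comp_assoc[OF emb_Hom[OF f(3)] Q.tar_Hom'[OF Q.Id_Hom c] Q.tar_Hom[OF Xu Q.Id_Hom], symmetric])
        (use DE o f(1) in \<open>auto simp: single_wtensor_single\<close>)
    also have "((Id Q [X] \<diamondop> emb u) \<diamondop> Id Q V) \<bullet> (Id Q [X \<otimes> D] \<diamondop> c) =
        (Id Q [X \<otimes> E] \<diamondop> c) \<bullet> ((Id Q [X] \<diamondop> emb u) \<diamondop> Id Q [B])"
      using Q.tar_split[OF Xu c] by simp
    also have "(Id Q [X] \<diamondop> emb u) \<diamondop> Id Q [B] = emb (Id C X \<star> (u \<star> Id C B))"
      using 1[of "[B]"] emb_whisker[of u X B] DE f(1) o by simp
    also have "((Id Q [X \<otimes> E] \<diamondop> c) \<bullet> emb (Id C X \<star> (u \<star> Id C B))) \<bullet> emb f =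
        (Id Q [X \<otimes> E] \<diamondop> c) \<bullet> (emb (Id C X \<star> (u \<star> Id C B)) \<bullet> emb f)"
      by (rule Q.Comp_assoc[OF emb_Hom[OF f'] emb_Hom[OF XuB] Q.tar_Hom'[OF Q.Id_Hom c]])
        (use DE o f(1) in \<open>auto simp: single_wtensor_single tob_assoc\<close>)
    also have "emb (Id C X \<star> (u \<star> Id C B)) \<bullet> emb f = emb ((Id C X \<star> (u \<star> Id C B)) \<cdot> f)"
      using emb_Comp[OF f' XuB] by simp
    finally show ?thesis
      using composites_tensor[OF V f(2), of "(Id C X \<star> (u \<star> Id C B)) \<cdot> f" A "X \<otimes> E"] Comp_Hom[OF f' XuB] f(1) DE o
      by (simp add: u emb_def wtensor_assoc[symmetric] single_wtensor_single tob_assoc del: wtensor_assoc)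
  qed
  have Eta: ?thesis if u: "p = Eta"
  proof -
    have "w \<in> composites (wtensor C [X] V) A"
      using w u V by (simp add: o)
    then obtain D c f where f: "D \<in> Obj C" "c \<in> composites V D" "f \<in> Hom C A (X \<otimes> D)" "w = (Id Q [X] \<diamondop> c) \<bullet> emb f"
      using composites_split[OF V X] by metis
    note c = composites_Hom[OF V f(2)]
    have JD: "J \<otimes> D \<in> Obj C" using f(1) by (simp add: o)
    \<comment> \<open>The new tail is \<open>J \<otimes> c\<close>, which has the special form by
      \<open>composites_tensor\<close> applied to an identity. The object \<open>B\<close> of the
      new outer layer will be \<open>D\<close>.\<close>
    have "(Id Q [J] \<diamondop> c) \<bullet> emb (Id C (J \<otimes> D)) \<in> composites (wtensor C [J] V) (J \<otimes> D)"
      by (rule composites_tensor[OF V f(2) Id_Hom[OF JD] J_Obj f(1)])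
    moreover have Jc: "Id Q [J] \<diamondop> c \<in> Hom Q [J \<otimes> D] (wtensor C [J] V)"
      using Q.tar_Hom[OF Q.Id_Hom[of "[J]"] c] by (simp add: o single_wtensor_single)
    ultimately have g: "Id Q [J] \<diamondop> c \<in> composites (wtensor C [J] V) (J \<otimes> D)"
      using Q.Comp_Id[OF Jc] by (simp add: emb_Id JD)
    have Ve: "edge_class C J Eta \<diamondop> Id Q V \<in> Hom Q V (wtensor C (Jdual C) (wtensor C [J] V))"
      using Q.unit_right_Hom[of V] V by simp
    have "(Id Q [X] \<diamondop> (edge_class C J Eta \<diamondop> Id Q V)) \<bullet> w = 
        ((Id Q [X] \<diamondop> (edge_class C J Eta \<diamondop> Id Q V)) \<bullet> (Id Q [X] \<diamondop> c)) \<bullet> emb f"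
      unfolding f(4)
      by (rule Q.Comp_assoc[OF emb_Hom[OF f(3)] Q.tar_Hom'[OF Q.Id_Hom c] Q.tar_Hom'[OF Q.Id_Hom Ve], symmetric])
        (use f(1) in \<open>auto simp: o single_wtensor_single\<close>)
    also have "(Id Q [X] \<diamondop> (edge_class C J Eta \<diamondop> Id Q V)) \<bullet> (Id Q [X] \<diamondop> c) =
        Id Q [X] \<diamondop> Q.mate [D] (Id Q [J] \<diamondop> c)"
      using Q.left_Comp[OF _ c Ve, of "[X]"] Q.mate_left[OF c] by (simp add: o)
    finally have "(Id Q [X] \<diamondop> (edge_class C J Eta \<diamondop> Id Q V)) \<bullet> w =
        (Id Q [X] \<diamondop> Q.mate [D] (Id Q [J] \<diamondop> c)) \<bullet> emb f" .
    moreover have "wtensor C [X] (wtensor C (ptgt C J p) V) = X # wtensor C [J] V"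
      using single_wtensor_Jdual[of "wtensor C [J] V" X] V X u by (simp add: word_simps)
    moreover have "wtensor C [J] V \<noteq> []"
      by (simp add: wtensor_def)
    ultimately show ?thesis
      using g f(1,3) u by (auto simp: composites_Cons)
  qed
  have Eps: ?thesis if u: "p = Eps"
  proof -
    have V0: "V \<noteq> []" using V by (simp add: words_def)
    have XJ: "X \<otimes> J \<in> Obj C" by (simp add: o)
    \<comment> \<open>The source of an \<open>Eps\<close> edge is one letter longer than its target:
      \<open>J\<close> merges with \<open>X\<close>, the units of \<open>Jdual C\<close> are
      absorbed, and the word is \<open>X \<otimes> J\<close> in front of \<open>V\<close>. So the
      outer layer of \<open>w\<close> is exactly the transpose on which the counit acts.\<close>
    have "wtensor C [X] (wtensor C (psrc C J p) V) = wtensor C [X \<otimes> J] (wtensor C (Jdual C) V)"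
      using wtensor_assoc[of "[X]" "[J]" "wtensor C (Jdual C) V"] u by (simp add: o single_wtensor_single)
    then have d: "wtensor C [X] (wtensor C (psrc C J p) V) = (X \<otimes> J) # V"
      using single_wtensor_Jdual[OF V XJ] by simp
    then obtain B c f where f: "B \<in> Obj C" "f \<in> Hom C A ((X \<otimes> J) \<otimes> B)" "c \<in> composites V (J \<otimes> B)"
      "w = (Id Q [X \<otimes> J] \<diamondop> Q.mate [B] c) \<bullet> emb f"
      using w V0 by (auto simp: composites_Cons)
    have JB: "J \<otimes> B \<in> Obj C" using f(1) by (simp add: o)
    note c = composites_Hom[OF V f(3)]
    have t: "Q.mate [B] c \<in> Hom Q [B] (wtensor C (Jdual C) V)"
      using Q.mate_Hom[of c "[B]" V] c f by (simp add: single_wtensor_single word_simps)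
    have Jt: "Id Q [J] \<diamondop> Q.mate [B] c \<in> Hom Q [J \<otimes> B] (wtensor C [J] (wtensor C (Jdual C) V))"
      using Q.tar_Hom[OF Q.Id_Hom[of "[J]"] t] by (simp add: o single_wtensor_single)
    have Ve: "edge_class C J Eps \<diamondop> Id Q V \<in> Hom Q (wtensor C [J] (wtensor C (Jdual C) V)) V"
      using Q.counit_right_Hom[of V] V by simp
    have 1: "Id Q [X \<otimes> J] \<diamondop> Q.mate [B] c = Id Q [X] \<diamondop> (Id Q [J] \<diamondop> Q.mate [B] c)"
      using Q.tar_Id_Id(1)[OF t, of "[X]" "[J]"] by (simp add: o single_wtensor_single)
    have "(Id Q [X] \<diamondop> (edge_class C J Eps \<diamondop> Id Q V)) \<bullet> w = 
        ((Id Q [X] \<diamondop> (edge_class C J Eps \<diamondop> Id Q V)) \<bullet> (Id Q [X] \<diamondop> (Id Q [J] \<diamondop> Q.mate [B] c))) \<bullet> emb f"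
      unfolding f(4) 1
      by (rule Q.Comp_assoc[OF emb_Hom[OF f(2)] Q.tar_Hom'[OF Q.Id_Hom Jt] Q.tar_Hom'[OF Q.Id_Hom Ve], symmetric])
        (use f(1) in \<open>auto simp: o single_wtensor_single tob_assoc\<close>)
    also have "(Id Q [X] \<diamondop> (edge_class C J Eps \<diamondop> Id Q V)) \<bullet> (Id Q [X] \<diamondop> (Id Q [J] \<diamondop> Q.mate [B] c)) =
       Id Q [X] \<diamondop> c"
      using Q.left_Comp[OF _ Jt Ve, of "[X]"] Q.counit_mate[of c "[B]" V] c f(1) by (simp add: o single_wtensor_single)
    \<comment> \<open>\<open>f\<close> ends in \<open>X \<otimes> (J \<otimes> B)\<close> after
      rebracketing, and \<open>J \<otimes> B\<close> is the source of \<open>c\<close>: the letter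
      \<open>J\<close> has moved from the word into the source of the tail.\<close>
    finally show ?thesis
      using composites_tensor[OF V f(3), of f A X] f(1,2) u JB tob_assoc[OF X J_Obj f(1)] by (simp add: o)
  qed
  from p Bar Eta Eps Arr_Hom show ?thesis by blast
qed

text \<open>Induction on the left whisker \<open>U\<close>. Beyond its last letter the edge acts on
  the tail only, and transposition is natural in its target. The source \<open>A\<close> is
  generalised because the tail starts at \<open>J \<otimes> B\<close>.\<close>

lemma composites_edge:
  assumes e: "(U, p, V) \<in> edges C" and w: "w \<in> composites (esrc C J (U, p, V)) A"
  shows "cls (epath C J (U, p, V)) \<bullet> w \<in> composites (etgt C J (U, p, V)) A"
proof -
  have p: "p \<in> {Eps, Eta} \<union> Bar ` Arr C" and V: "V \<in> words C" and U: "U \<in> words C" "U \<noteq> []"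
    using e by (auto simp: edges_def words_def)
  let ?s = "wtensor C (psrc C J p) V" and ?t = "wtensor C (ptgt C J p) V"
    and ?e = "edge_class C J p \<diamondop> Id Q V"
  have st: "?s \<in> words C" "?t \<in> words C"
    using psrc_words[OF p] ptgt_words[OF p] V by (simp_all add: wtensor_words)
  have eh: "?e \<in> Hom Q ?s ?t"
    using Q.tar_Hom[OF edge_class_Hom[OF p] Q.Id_Hom[of V]] V by simp
  from U(2,1) w[unfolded esrc_def, simplified] have "(Id Q U \<diamondop> ?e) \<bullet> w \<in> composites (wtensor C U ?t) A"
  proof (induction U arbitrary: A w rule: list_nonempty_induct)
    case (single X)
    then show ?case
      using composites_prim[OF p V] by (simp add: words_def)
  next
    case (cons X U)
    have X: "X \<in> Obj C" "U \<in> words C"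
      using cons by (simp_all add: words_Cons)
    have ne: "wtensor C U ?s \<noteq> []" "wtensor C U ?t \<noteq> []" "wtensor C U ?s \<in> words C" "wtensor C U ?t \<in> words C"
      using wtensor_words[OF X(2) st(1)] wtensor_words[OF X(2) st(2)] by (auto simp: words_def)
    obtain B c f where f: "B \<in> Obj C" "f \<in> Hom C A (X \<otimes> B)" "c \<in> composites (wtensor C U ?s) (J \<otimes> B)"
      "w = (Id Q [X] \<diamondop> Q.mate [B] c) \<bullet> emb f"
      using cons.prems(2) ne by (auto simp: wtensor_Cons[OF cons(1)] composites_Cons)
    note c = composites_Hom[OF ne(3) f(3)]
    have e1: "Id Q U \<diamondop> ?e \<in> Hom Q (wtensor C U ?s) (wtensor C U ?t)"
      using Q.tar_Hom[OF Q.Id_Hom[of U] eh] X by simp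
    have e2: "Id Q (Jdual C) \<diamondop> (Id Q U \<diamondop> ?e) \<in>
        Hom Q (wtensor C (Jdual C) (wtensor C U ?s)) (wtensor C (Jdual C) (wtensor C U ?t))"
      using Q.tar_Hom[OF Q.Id_Hom[of "Jdual C"] e1] Jdual_words by simp
    have t: "Q.mate [B] c \<in> Hom Q [B] (wtensor C (Jdual C) (wtensor C U ?s))"
      using Q.mate_Hom[of c "[B]"] c f by (simp add: single_wtensor_single word_simps)
    \<comment> \<open>The leading letter is split off together with a copy of
      \<open>Jdual C\<close>, the one that the transpose of \<open>c\<close> supplies.\<close>
    have "Id Q (X # U) \<diamondop> ?e = Id Q [X] \<diamondop> (Id Q (Jdual C) \<diamondop> (Id Q U \<diamondop> ?e))"
      using Q.tar_Id_Id(1)[OF eh, of "Jdual C" U] Q.tar_Id_Id(1)[OF eh, of "[X]" "wtensor C (Jdual C) U"] X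
      by (simp add: single_wtensor_Jdual word_simps)
    then have "(Id Q (X # U) \<diamondop> ?e) \<bullet> w = 
      ((Id Q [X] \<diamondop> (Id Q (Jdual C) \<diamondop> (Id Q U \<diamondop> ?e))) \<bullet> (Id Q [X] \<diamondop> Q.mate [B] c)) \<bullet> emb f"
      unfolding f(4)
      apply (simp only:)
      apply (rule Q.Comp_assoc[OF emb_Hom[OF f(2)] Q.tar_Hom'[OF Q.Id_Hom t] Q.tar_Hom'[OF Q.Id_Hom e2], symmetric])
      using f(1) X by (auto simp: single_wtensor_single word_simps simp del: wtensor_assoc)
    also have "(Id Q [X] \<diamondop> (Id Q (Jdual C) \<diamondop> (Id Q U \<diamondop> ?e))) \<bullet> (Id Q [X] \<diamondop> Q.mate [B] c) =
      Id Q [X] \<diamondop> Q.mate [B] ((Id Q U \<diamondop> ?e) \<bullet> c)"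
      using Q.left_Comp[OF _ t e2, of "[X]"] Q.mate_post[of c "[B]" _ _, OF _ _ e1] X c f(1)
      by (simp add: word_simps single_wtensor_single del: wtensor_assoc)
    finally show ?case
      using cons.IH[OF X(2) f(3)] f(1,2) ne by (auto simp: wtensor_Cons[OF cons(1)] composites_Cons)
  qed
  then show ?thesis
    by (simp add: cls_epath[OF e] etgt_def)
qed

text \<open>The empty path is the image of an identity of \<open>C\<close>, and each further edge
  preserves the special form. This is the source of surjectivity.\<close>

lemma arrow_from_base:
  assumes "w \<in> Hom Q [A] W"
  shows "w \<in> composites W A"
proof -
  have A: "A \<in> Obj C"
    using Q_HomD[OF assms] by (simp add: words_def)
  have "U = [A] \<Longrightarrow> w \<in> composites W A" if "w \<in> Hom Q U W" for U
    using that
  proof (induction rule: Q_arrow_induct)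
    case Id
    then show ?case
      using A Id_Hom[OF A] emb_Id[OF A] by auto
  next
    case (edge e c)
    then show ?case
      by (cases e) (auto intro: composites_edge)
  qed
  with assms show ?thesis by simp
qed

end

section \<open>Chains\<close>

context adjoined_dual
begin

lemma Fa_Omega: "f \<in> Arr C \<Longrightarrow> Fa (Omega C J) f = emb f"
  by (simp add: Omega_def emb_def)

lemma Fo_Omega: "A \<in> Obj C \<Longrightarrow> Fo (Omega C J) A = [A]"
  by (simp add: Omega_def)

lemma chains_single: "(Ys, fs) \<in> chains C J [X] A \<longleftrightarrow> Ys = [] \<and> (\<exists>f. fs = [f] \<and> f \<in> Hom C A X)"
  by (auto simp: chains_def csrc_def ctgt_def length_Suc_conv)

text \<open>Dropping the first arrow leaves a chain whose source is \<open>J \<otimes> Y\<close>. At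
  index 0 the shorter chain reads this source argument, where the longer one reads it off the list
  of objects.\<close>

lemma chains_Cons:
  assumes "W \<noteq> []"
  shows "(Y # Ys, f # fs) \<in> chains C J (X # W) A \<longleftrightarrow>
    Y \<in> Obj C \<and> f \<in> Hom C A (X \<otimes> Y) \<and> (Ys, fs) \<in> chains C J W (J \<otimes> Y)"
proof -
  have "csrc C J A (Y # Ys) (Suc i) = csrc C J (J \<otimes> Y) Ys i" for i
    by (cases i) (auto simp: csrc_def)
  moreover have "ctgt C (X # W) (Y # Ys) (Suc i) = ctgt C W Ys i" for i
    by (auto simp: ctgt_def)
  moreover have "csrc C J A (Y # Ys) 0 = A" "ctgt C (X # W) (Y # Ys) 0 = X \<otimes> Y"
    by (auto simp: csrc_def ctgt_def)
  ultimately show ?thesis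
    by (auto simp: chains_def All_less_Suc2)
qed

lemma chains_ConsE:
  assumes "ch \<in> chains C J (X # W) A" "W \<noteq> []"
  obtains Y Ys f fs where "ch = (Y # Ys, f # fs)" "Y \<in> Obj C" "f \<in> Hom C A (X \<otimes> Y)" "(Ys, fs) \<in> chains C J W (J \<otimes> Y)"
proof -
  obtain Y Ys f fs where "ch = (Y # Ys, f # fs)"
    using assms by (cases W; cases ch; cases "fst ch"; cases "snd ch") (auto simp: chains_def)
  then show thesis
    using that assms chains_Cons[OF assms(2)] by blast
qed

lemma chains_hdE:
  assumes "ch \<in> chains C J W A"
  obtains Ys f fs where "ch = (Ys, f # fs)"
  using assms by (auto simp: chains_def length_Suc_conv)

text \<open>The composite of the statement in nested form: the tail is transposed and tensored with
  its letter, in place of carrying the letters already split off as a prefix. The comparison is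
  \<open>chain_comp_chain_arrow\<close>.\<close>

fun chain_arrow :: "'o list \<Rightarrow> ('o, 'm) chain \<Rightarrow> ('o, 'm) path set" where
  "chain_arrow [X] (Ys, f # fs) = emb f"
| "chain_arrow (X # X' # Ws) (Y # Ys, f # fs) = (Id Q [X] \<diamondop> Q.mate [Y] (chain_arrow (X' # Ws) (Ys, fs))) \<bullet> emb f"

lemma chain_arrow_Cons: "W \<noteq> [] \<Longrightarrow> chain_arrow (X # W) (Y # Ys, f # fs) = (Id Q [X] \<diamondop> Q.mate [Y] (chain_arrow W (Ys, fs))) \<bullet> emb f"
  by (cases W) auto

lemma words_induct [consumes 1, case_names single Cons]:
  assumes "W \<in> words C"
    and "\<And>X. X \<in> Obj C \<Longrightarrow> P [X]"
    and "\<And>X W. X \<in> Obj C \<Longrightarrow> W \<in> words C \<Longrightarrow> W \<noteq> [] \<Longrightarrow> P W \<Longrightarrow> P (X # W)"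
  shows "P W"
proof -
  have "W \<noteq> []" using assms(1) by (simp add: words_def)
  then show ?thesis using assms(1)
    by (induction W rule: list_nonempty_induct) (auto simp: words_Cons words_def intro: assms(2,3))
qed

lemma chain_arrow_composites: "W \<in> words C \<Longrightarrow> ch \<in> chains C J W A \<Longrightarrow> chain_arrow W ch \<in> composites W A"
proof (induction W arbitrary: ch A rule: words_induct)
  case (single X)
  then show ?case
    by (cases ch) (auto simp: chains_single)
next
  case (Cons X W)
  obtain Y Ys f fs where ch: "ch = (Y # Ys, f # fs)" "Y \<in> Obj C" "f \<in> Hom C A (X \<otimes> Y)" "(Ys, fs) \<in> chains C J W (J \<otimes> Y)"
    using chains_ConsE[OF Cons.prems Cons.hyps(3)] by blast
  then show ?case
    using Cons.IH[OF ch(4)] Cons.hyps(3) by (auto simp: composites_Cons chain_arrow_Cons)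
qed

lemma chain_arrow_Hom: "W \<in> words C \<Longrightarrow> ch \<in> chains C J W A \<Longrightarrow> chain_arrow W ch \<in> Hom Q [A] W"
  by (rule composites_Hom[OF _ chain_arrow_composites])

lemma step_pre:
  assumes "c \<in> Hom Q [J \<otimes> B] W" "B \<in> Obj C" "X \<in> Obj C" "f \<in> Hom C A (X \<otimes> B)" "h \<in> Hom C A' A"
  shows "(Id Q [X] \<diamondop> Q.mate [B] c) \<bullet> emb (f \<cdot> h) = ((Id Q [X] \<diamondop> Q.mate [B] c) \<bullet> emb f) \<bullet> emb h"
  using Q.Comp_assoc[OF emb_Hom[OF assms(5)] emb_Hom[OF assms(4)] step_Hom(1)[OF assms(1-4)]]
  by (simp add: emb_Comp[OF assms(5,4)])

text \<open>Only the first arrow of a chain sees the source, and it is the first factor of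
  \<open>chain_arrow\<close>.\<close>

lemma chains_pre:
  assumes "W \<in> words C" "(Ys, f # fs) \<in> chains C J W A" "h \<in> Hom C A' A"
  shows "(Ys, (f \<cdot> h) # fs) \<in> chains C J W A'" "chain_arrow W (Ys, (f \<cdot> h) # fs) = chain_arrow W (Ys, f # fs) \<bullet> emb h"
  unfolding atomize_conj using assms
proof (induction W rule: words_induct)
  case (single X)
  then show ?case
    by (auto simp: chains_single emb_Comp intro: Comp_Hom)
next
  case (Cons X W)
  obtain Y Yt where ch: "Ys = Y # Yt" "Y \<in> Obj C" "f \<in> Hom C A (X \<otimes> Y)" "(Yt, fs) \<in> chains C J W (J \<otimes> Y)"
    using chains_ConsE[OF Cons.prems(1) Cons.hyps(3)] by blast
  show ?case
    using step_pre[OF chain_arrow_Hom[OF Cons.hyps(2) ch(4)] ch(2) Cons.hyps(1) ch(3) Cons.prems(2)]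
      Comp_Hom[OF Cons.prems(2) ch(3)] ch
    by (simp add: chains_Cons[OF Cons.hyps(3)] chain_arrow_Cons[OF Cons.hyps(3)])
qed

text \<open>The generating relation of the coend over \<open>B\<close>. Transposition is natural in
  its source, so \<open>J \<otimes> h\<close> in front of the tail becomes \<open>h\<close> in front
  of the transpose, and this becomes \<open>X \<otimes> h\<close> after \<open>f\<close>.\<close>

lemma step_slide:
  assumes "c \<in> Hom Q [J \<otimes> B'] W" "X \<in> Obj C" "h \<in> Hom C B B'" "f \<in> Hom C A (X \<otimes> B)"
  shows "(Id Q [X] \<diamondop> Q.mate [B] (c \<bullet> emb (Id C J \<star> h))) \<bullet> emb f =
    (Id Q [X] \<diamondop> Q.mate [B'] c) \<bullet> emb ((Id C X \<star> h) \<cdot> f)"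
proof -
  have B: "B \<in> Obj C" "B' \<in> Obj C" using HomD[OF assms(3)] by auto
  note Xh = tar_Hom[OF Id_Hom[OF assms(2)] assms(3)]
  have W: "W \<in> words C" using Q_HomD[OF assms(1)] by simp
  have t: "Q.mate [B'] c \<in> Hom Q [B'] (wtensor C (Jdual C) W)"
    using Q.mate_Hom[of c "[B']" W] assms B by (simp add: single_wtensor_single word_simps)
  have "Q.mate [B] (c \<bullet> emb (Id C J \<star> h)) = Q.mate [B'] c \<bullet> emb h"
    using Q.mate_pre[of c "[B']" W "emb h" "[B]"] emb_Hom[OF assms(3)] assms(1) emb_left[OF assms(3) J_Obj]
    by (simp add: single_wtensor_single)
  then have "Id Q [X] \<diamondop> Q.mate [B] (c \<bullet> emb (Id C J \<star> h)) = (Id Q [X] \<diamondop> Q.mate [B'] c) \<bullet> emb (Id C X \<star> h)"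
    using Q.left_Comp[OF _ emb_Hom[OF assms(3)] t, of "[X]"] emb_left[OF assms(3,2)] assms(2)
    by (simp add: word_simps)
  then show ?thesis
    using Q.Comp_assoc[OF emb_Hom[OF assms(4)] emb_Hom[OF Xh] step_Hom(1)[OF assms(1) B(2) assms(2) Id_Hom]] 
    by (simp add: emb_Comp[OF assms(4) Xh] tob_Obj B assms(2))
qed

text \<open>All arrows \<open>hs\<close> act at once. The induction slides the first of them by
  \<open>step_slide\<close> and leaves the others to the tail.\<close>

lemma chain_slide:
  assumes "W \<in> words C" "length W = Suc (length Ys)" "length Ys' = length Ys" "length hs = length Ys"
    "length gs = length W" "set Ys \<subseteq> Obj C" "set Ys' \<subseteq> Obj C"
    "\<forall>i < length Ys. hs ! i \<in> Hom C (Ys ! i) (Ys' ! i)"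
    "\<forall>i < length W. gs ! i \<in> Hom C (csrc C J A Ys' i) (ctgt C W Ys i)"
  defines "l \<equiv> (Ys, map (\<lambda>i. if i = 0 then gs ! i else gs ! i \<cdot> (Id C J \<star> hs ! (i - 1))) [0..<length W])"
    and "r \<equiv> (Ys', map (\<lambda>i. if i < length Ys then (Id C (W ! i) \<star> hs ! i) \<cdot> gs ! i else gs ! i) [0..<length W])"
  shows "l \<in> chains C J W A \<and> r \<in> chains C J W A \<and> chain_arrow W l = chain_arrow W r"
  unfolding l_def r_def using assms(1-9)
proof (induction W arbitrary: Ys Ys' hs gs A rule: words_induct)
  case (single X)
  then show ?case
    by (auto simp: chains_single csrc_def ctgt_def length_Suc_conv)
next
  case (Cons X W)
  obtain Y Yt Y' Yt' h ht g gt where l: "Ys = Y # Yt" "Ys' = Y' # Yt'" "hs = h # ht" "gs = g # gt"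
    using Cons.prems Cons.hyps(3) by (cases W; cases Ys; cases Ys'; cases hs; cases gs) auto
  have "csrc C J A (Y' # Yt') (Suc i) = csrc C J (J \<otimes> Y') Yt' i" for i
    by (cases i) (auto simp: csrc_def)
  moreover have "ctgt C (X # W) (Y # Yt) (Suc i) = ctgt C W Yt i" for i
    by (auto simp: ctgt_def)
  moreover have "csrc C J A (Y' # Yt') 0 = A" "ctgt C (X # W) (Y # Yt) 0 = X \<otimes> Y"
    by (auto simp: csrc_def ctgt_def)
  ultimately have p: "Y \<in> Obj C" "Y' \<in> Obj C" "h \<in> Hom C Y Y'" "g \<in> Hom C A (X \<otimes> Y)"
     "\<forall>i < length W. gt ! i \<in> Hom C (csrc C J (J \<otimes> Y') Yt' i) (ctgt C W Yt i)"
     "\<forall>i < length Yt. ht ! i \<in> Hom C (Yt ! i) (Yt' ! i)"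
    using Cons.prems by (auto simp: l All_less_Suc2)
  let ?l = "map (\<lambda>i. if i = 0 then gt ! i else gt ! i \<cdot> (Id C J \<star> ht ! (i - 1))) [0..<length W]"
  let ?r = "map (\<lambda>i. if i < length Yt then (Id C (W ! i) \<star> ht ! i) \<cdot> gt ! i else gt ! i) [0..<length W]"
  \<comment> \<open>The tail is taken with source \<open>J \<otimes> Y'\<close>, where its first
    arrow starts before \<open>J \<otimes> h\<close> is composed to it.\<close>
  have IH: "(Yt, ?l) \<in> chains C J W (J \<otimes> Y')" "(Yt', ?r) \<in> chains C J W (J \<otimes> Y')" "chain_arrow W (Yt, ?l) = chain_arrow W (Yt', ?r)"
    using Cons.IH[of Yt Yt' ht gt "J \<otimes> Y'"] Cons.prems p unfolding l by simp_all
  obtain g1 gtt where gt: "gt = g1 # gtt"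
    using Cons.prems Cons.hyps(3) by (cases gt) (auto simp: l)
  obtain n where n: "length W = Suc n"
    using Cons.hyps(3) by (cases W) auto
  \<comment> \<open>The left family leaves index 0 alone. In the tail this index holds
    \<open>g1\<close> itself, whereas in the full chain the same arrow carries
    \<open>J \<otimes> h\<close>; after it both agree on \<open>?m\<close>. The difference is a
    precomposition, handled by \<open>chains_pre\<close>.\<close>
  let ?m = "map (\<lambda>i. gtt ! i \<cdot> (Id C J \<star> ht ! i)) [0..<n]"
  have 1: "?l = g1 # ?m"
    unfolding n gt by (simp add: upt_conv_Cons map_Suc_upt[symmetric] del: upt_Suc map_Suc_upt) 
  have 2: "map (\<lambda>i. if i = 0 then gs ! i else gs ! i \<cdot> (Id C J \<star> hs ! (i - 1))) [0..<length (X # W)] =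
    g # (g1 \<cdot> (Id C J \<star> h)) # ?m"
    unfolding l gt by (simp add: n upt_conv_Cons map_Suc_upt[symmetric] del: upt_Suc map_Suc_upt) 
  have 3: "map (\<lambda>i. if i < length Ys then (Id C ((X # W) ! i) \<star> hs ! i) \<cdot> gs ! i else gs ! i) [0..<length (X # W)] =
    ((Id C X \<star> h) \<cdot> g) # ?r"
    unfolding l by (simp add: upt_conv_Cons map_Suc_upt[symmetric] del: upt_Suc map_Suc_upt) 
  note Jh = tar_Hom[OF Id_Hom[OF J_Obj] p(3)]
  note Xh = tar_Hom[OF Id_Hom[OF Cons.hyps(1)] p(3)]
  note pre = chains_pre[OF Cons.hyps(2) IH(1)[unfolded 1] Jh]
  have e: "chain_arrow (X # W) (Y # Yt, g # (g1 \<cdot> (Id C J \<star> h)) # ?m) = chain_arrow (X # W) (Y' # Yt', ((Id C X \<star> h) \<cdot> g) # ?r)"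
    using step_slide[OF chain_arrow_Hom[OF Cons.hyps(2) IH(2)] Cons.hyps(1) p(3,4)] IH(3)
    by (simp add: chain_arrow_Cons[OF Cons.hyps(3)] pre(2) 1)
  have m: "(Y # Yt, g # (g1 \<cdot> (Id C J \<star> h)) # ?m) \<in> chains C J (X # W) A"
    "(Y' # Yt', ((Id C X \<star> h) \<cdot> g) # ?r) \<in> chains C J (X # W) A"
    using p IH(2) pre(1) Comp_Hom[OF p(4) Xh] by (simp_all only: chains_Cons[OF Cons.hyps(3)])
  show ?case
    unfolding 2 3 using e m unfolding l by simp
qed

lemma equiv_closure_const:
  assumes "(x, y) \<in> equiv_closure S R" "\<And>x y. (x, y) \<in> R \<Longrightarrow> f x = f y"
  shows "f x = f y"
proof -
  have "(x, y) \<in> (R \<union> R\<inverse>)\<^sup>*"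
    using assms(1) by (simp add: equiv_closure_def)
  then show ?thesis
    by (induction rule: rtrancl_induct) (auto dest: assms(2))
qed

lemma chain_rel_chain_arrow:
  assumes "W \<in> words C" "(x, y) \<in> chain_rel C J W A"
  shows "chain_arrow W x = chain_arrow W y"
  using assms(2) unfolding chain_rel_def
proof (rule equiv_closure_const, elim CollectE exE conjE, goal_cases)
  case (1 x y Ys Ys' hs gs)
  then show ?case
    using chain_slide[OF assms(1), of Ys Ys' hs gs A] by simp
qed

text \<open>The prefix \<open>U\<close> grows at each step of \<open>chain_comp\<close>, so it is
  generalised. Functoriality of tensoring on the left then gathers each unit and the tail after it
  into one transpose.\<close>

lemma chain_comp_chain_arrow:
  assumes "W \<in> words C" "ch \<in> chains C J W A" "U \<in> words C"
  shows "chain_comp C J U W ch = Id Q U \<diamondop> chain_arrow W ch"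
  using assms
proof (induction W arbitrary: ch A U rule: words_induct)
  case (single X)
  then show ?case
    by (cases ch) (auto simp: chains_single Fa_Omega HomD)
next
  case (Cons X W)
  obtain Y Ys f fs where ch: "ch = (Y # Ys, f # fs)" "Y \<in> Obj C" "f \<in> Hom C A (X \<otimes> Y)" "(Ys, fs) \<in> chains C J W (J \<otimes> Y)"
    using chains_ConsE[OF Cons.prems(1) Cons.hyps(3)] by blast
  note c = chain_arrow_Hom[OF Cons.hyps(2) ch(4)]
  note s = step_Hom(1)[OF c ch(2) Cons.hyps(1) ch(3)]
  note o = Cons.hyps(1,2) Cons.prems(2) ch(2) word_simps
  have e: "edge_class C J Eta \<diamondop> Id Q [Y] \<in> Hom Q [Y] (wtensor C (Jdual C) [J \<otimes> Y])"
    using Q.unit_right_Hom[of "[Y]"] by (simp add: o single_wtensor_single)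
  note Jc = Q.tar_Hom[OF Q.Id_Hom[of "Jdual C"] c]
  let ?U = "wtensor C U (wtensor C [X] (Jdual C))"
  have U: "?U \<in> words C" by (simp add: o)
  note Uc = Q.tar_Hom[OF Q.Id_Hom[of ?U] c]
  let ?V = "wtensor C U [X]"
  have V: "?V \<in> words C" by (simp add: o)
  have mate: "Q.mate [Y] (chain_arrow W (Ys, fs)) \<in> Hom Q [Y] (wtensor C (Jdual C) W)"
    using Q.mate_Hom[of _ "[Y]" W] c by (simp add: single_wtensor_single o)
  have "Id Q ?U \<diamondop> chain_arrow W (Ys, fs) = Id Q ?V \<diamondop> (Id Q (Jdual C) \<diamondop> chain_arrow W (Ys, fs))"
    using Q.tar_Id_Id(1)[OF c, of ?V "Jdual C"] by (simp add: o)
  \<comment> \<open>The whiskered unit followed by the whiskered tail is a whiskered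
    transpose.\<close>
  then have 1: "(Id Q ?U \<diamondop> chain_arrow W (Ys, fs)) \<bullet> (Id Q ?V \<diamondop> (edge_class C J Eta \<diamondop> Id Q [Y])) =
     Id Q ?V \<diamondop> Q.mate [Y] (chain_arrow W (Ys, fs))"
    unfolding Q.mate_def using Q.left_Comp[OF _ e, of ?V] Jc by (simp add: o)
  have e3: "Id Q U \<diamondop> emb f \<in> Hom Q (wtensor C U [A]) (wtensor C U [X \<otimes> Y])"
    using Q.tar_Hom[OF Q.Id_Hom[of U] emb_Hom[OF ch(3)]] Cons.prems(2) by simp
  have e1: "Id Q ?U \<diamondop> chain_arrow W (Ys, fs) \<in> Hom Q (wtensor C ?V (wtensor C (Jdual C) [J \<otimes> Y])) (wtensor C ?V (wtensor C (Jdual C) W))"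
    using Uc U by (simp add: o)
  have "wtensor C ?V [Y] = wtensor C U [X \<otimes> Y]"
    using wtensor_assoc[of U "[X]" "[Y]"] by (simp add: o single_wtensor_single)
  then have e2: "Id Q ?V \<diamondop> (edge_class C J Eta \<diamondop> Id Q [Y]) \<in> Hom Q (wtensor C U [X \<otimes> Y]) (wtensor C ?V (wtensor C (Jdual C) [J \<otimes> Y]))"
    using Q.tar_Hom[OF Q.Id_Hom[of ?V] e] V by simp
  have "chain_comp C J U (X # W) ch = 
    (Id Q ?U \<diamondop> chain_arrow W (Ys, fs)) \<bullet> ((Id Q ?V \<diamondop> (edge_class C J Eta \<diamondop> Id Q [Y])) \<bullet> (Id Q U \<diamondop> emb f))"
    using Cons.IH[OF ch(4) U] Cons.hyps(3) HomD[OF ch(3)] by (cases W) (simp_all add: ch Fa_Omega)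
  also have "\<dots> = ((Id Q ?U \<diamondop> chain_arrow W (Ys, fs)) \<bullet> (Id Q ?V \<diamondop> (edge_class C J Eta \<diamondop> Id Q [Y]))) \<bullet> (Id Q U \<diamondop> emb f)"
    by (rule Q.Comp_assoc[OF e3 e2 e1, symmetric])
  also have "\<dots> = (Id Q ?V \<diamondop> Q.mate [Y] (chain_arrow W (Ys, fs))) \<bullet> (Id Q U \<diamondop> emb f)"
    by (simp only: 1)
  also have "\<dots> = Id Q U \<diamondop> ((Id Q [X] \<diamondop> Q.mate [Y] (chain_arrow W (Ys, fs))) \<bullet> emb f)"
    using Q.left_Comp[OF _ emb_Hom[OF ch(3)] s, of U] Q.tar_Id_Id(1)[OF mate, of U "[X]"] by (simp add: o)
  finally show ?case
    by (simp add: ch chain_arrow_Cons[OF Cons.hyps(3)])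
qed

lemma chain_comp_wunit:
  assumes "W \<in> words C" "ch \<in> chains C J W A"
  shows "chain_comp C J (wunit C) W ch = chain_arrow W ch"
  using chain_comp_chain_arrow[OF assms wunit_words] Q.unit_tar[of "chain_arrow W ch"] Q_HomD[OF chain_arrow_Hom[OF assms]] by simp

text \<open>The composite is constant on the class, and the class contains \<open>ch\<close>; so the
  image is a singleton and \<open>the_elem\<close> in \<open>zeta_fun\<close> returns its
  element.\<close>

lemma chain_comp_class:
  assumes "W \<in> words C" "ch \<in> chains C J W A"
  shows "chain_comp C J (wunit C) W ` (chain_rel C J W A `` {ch}) = {chain_arrow W ch}"
proof -
  let ?S = "chain_rel C J W A `` {ch}"
  have "ch \<in> ?S"
    using assms(2) by (auto simp: chain_rel_def equiv_closure_def)
  have "ch' \<in> chains C J W A" if "(ch, ch') \<in> chain_rel C J W A" for ch'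
    using that by (simp add: chain_rel_def equiv_closure_def)
  then have "chain_comp C J (wunit C) W ` ?S = (\<lambda>_. chain_arrow W ch) ` ?S"
    using chain_comp_wunit[OF assms(1), of _ A] chain_rel_chain_arrow[OF assms(1), of ch _ A]
    by (intro image_cong) simp_all
  also have "\<dots> = {chain_arrow W ch}"
    using \<open>ch \<in> ?S\<close> by (rule image_constant)
  finally show ?thesis .
qed

end

section \<open>Functor categories and sets\<close>

context category
begin

section \<open>Isomorphisms, opposite categories and products\<close>

lemma is_inverse_unique: "is_inverse C f g \<Longrightarrow> is_inverse C f g' \<Longrightarrow> g = g'"
proof -
  assume a: "is_inverse C f g" "is_inverse C f g'"
  then have h: "f \<in> Hom C (Dom C f) (Cod C f)" "g \<in> Hom C (Cod C f) (Dom C f)" "g' \<in> Hom C (Cod C f) (Dom C f)"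
    by (simp_all add: is_inverse_def Hom_def)
  show "g = g'"
    using Comp_assoc[OF h(3,1,2)] a Comp_Id[OF h(2)] Id_Comp[OF h(3)] by (simp add: is_inverse_def)
qed

lemma inv_arr: "is_iso C f \<Longrightarrow> is_inverse C f (inv_arr C f)"
  unfolding is_iso_def inv_arr_def by (metis theI' is_inverse_unique)

lemma is_inverse_Hom:
  "f \<in> Hom C A B \<Longrightarrow> is_inverse C f g \<longleftrightarrow> g \<in> Hom C B A \<and> g \<cdot> f = Id C A \<and> f \<cdot> g = Id C B"
  by (auto simp: is_inverse_def Hom_def)

lemma is_iso_Comp:
  assumes "f \<in> Hom C A B" "g \<in> Hom C B D" "is_iso C f" "is_iso C g"
  shows "is_iso C (g \<cdot> f)"
proof -
  obtain f' g' where "is_inverse C f f'" "is_inverse C g g'"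
    using assms by (auto simp: is_iso_def)
  then have i: "f' \<in> Hom C B A" "f' \<cdot> f = Id C A" "f \<cdot> f' = Id C B" 
    "g' \<in> Hom C D B" "g' \<cdot> g = Id C B" "g \<cdot> g' = Id C D"
    by (simp_all add: is_inverse_Hom[OF assms(1)] is_inverse_Hom[OF assms(2)])
  have "(f' \<cdot> g') \<cdot> (g \<cdot> f) = Id C A"
    using Comp_assoc4[OF assms(1,2) i(4,1)] i Id_Comp[OF assms(1)] by simp
  moreover have "(g \<cdot> f) \<cdot> (f' \<cdot> g') = Id C D"
    using Comp_assoc4[OF i(4,1) assms(1,2)] i Id_Comp[OF i(4)] by simp
  ultimately show ?thesis
    using is_inverse_Hom[OF Comp_Hom[OF assms(1,2)]] Comp_Hom[OF i(4,1)] unfolding is_iso_def by blast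
qed

lemma is_iso_Id: "A \<in> Obj C \<Longrightarrow> is_iso C (Id C A)"
  unfolding is_iso_def using is_inverse_Hom[OF Id_Hom] Id_Hom Comp_Id[OF Id_Hom] by blast

lemma op_category: "category (op_cat C)"
proof -
  have H: "Hom (op_cat C) A B = Hom C B A" for A B
    by (auto simp: op_cat_def Hom_def)
  have sel: "Obj (op_cat C) = Obj C" "Id (op_cat C) = Id C" "g \<cdot>\<^bsub>op_cat C\<^esub> f = f \<cdot> g" for f g
    by (simp_all add: op_cat_def)
  show ?thesis
    by (unfold_locales, unfold H sel)
      (auto simp: op_cat_def Dom_Obj Cod_Obj Id_Comp Comp_Id Comp_assoc intro: Id_Hom Comp_Hom)
qed

end

lemma prod_category:
  assumes "category C" "category D"
  shows "category (prod_cat C D)"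
proof -
  interpret C: category C by fact
  interpret D: category D by fact
  have H: "(f, g) \<in> Hom (prod_cat C D) P R \<longleftrightarrow> f \<in> Hom C (fst P) (fst R) \<and> g \<in> Hom D (snd P) (snd R)" for f g P R
    by (cases P; cases R) (auto simp: prod_cat_def Hom_def)
  have K: "(f', g') \<cdot>\<^bsub>prod_cat C D\<^esub> (f, g) = (f' \<cdot>\<^bsub>C\<^esub> f, g' \<cdot>\<^bsub>D\<^esub> g)" for f' g' f g
    by (simp add: prod_cat_def)
  show ?thesis
  proof
    fix A assume "A \<in> Obj (prod_cat C D)"
    then show "Id (prod_cat C D) A \<in> Hom (prod_cat C D) A A"
      by (cases A) (auto simp: prod_cat_def Hom_def dest: C.Id_Hom[unfolded Hom_def] D.Id_Hom[unfolded Hom_def])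
  next
    fix f g P R S assume "f \<in> Hom (prod_cat C D) P R" "g \<in> Hom (prod_cat C D) R S"
    then show "g \<cdot>\<^bsub>prod_cat C D\<^esub> f \<in> Hom (prod_cat C D) P S"
      by (cases f; cases g) (auto simp: H K intro: C.Comp_Hom D.Comp_Hom)
  next
    fix f P R assume "f \<in> Hom (prod_cat C D) P R"
    then show "f \<cdot>\<^bsub>prod_cat C D\<^esub> Id (prod_cat C D) P = f" "Id (prod_cat C D) R \<cdot>\<^bsub>prod_cat C D\<^esub> f = f"
      by (cases f; cases P; cases R; auto simp: H; auto simp: prod_cat_def C.Comp_Id D.Comp_Id C.Id_Comp D.Id_Comp)+
  next
    fix f g h P R S T
    assume "f \<in> Hom (prod_cat C D) P R" "g \<in> Hom (prod_cat C D) R S" "h \<in> Hom (prod_cat C D) S T"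
    then show "(h \<cdot>\<^bsub>prod_cat C D\<^esub> g) \<cdot>\<^bsub>prod_cat C D\<^esub> f = h \<cdot>\<^bsub>prod_cat C D\<^esub> g \<cdot>\<^bsub>prod_cat C D\<^esub> f"
      by (cases f; cases g; cases h) (auto simp: H K intro: C.Comp_assoc D.Comp_assoc)
  qed (auto simp: prod_cat_def C.Dom_Obj C.Cod_Obj D.Dom_Obj D.Cod_Obj)
qed

section \<open>The category of sets\<close>

lemma set_cat_Hom: "(X', f, Y') \<in> Hom set_cat X Y \<longleftrightarrow> X' = X \<and> Y' = Y \<and> f \<in> X \<rightarrow>\<^sub>E Y"
  by (auto simp: set_cat_def Hom_def)

lemma set_cat_Comp: "(Y', g, Z) \<cdot>\<^bsub>set_cat\<^esub> (X, f, Y) = mk_fun X (\<lambda>x. g (f x)) Z"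
  by (simp add: set_cat_def)

lemma mk_fun_Hom: "f \<in> X \<rightarrow> Y \<Longrightarrow> mk_fun X f Y \<in> Hom set_cat X Y"
  by (auto simp: mk_fun_def set_cat_Hom)

lemma app_mk_fun: "x \<in> X \<Longrightarrow> app (mk_fun X f Y) x = f x"
  by (simp add: app_def mk_fun_def)

lemma fst_mk_fun [simp]: "fst (mk_fun X f Y) = X"
  by (simp add: mk_fun_def)

lemma app_in: "t \<in> Hom set_cat X Y \<Longrightarrow> x \<in> X \<Longrightarrow> app t x \<in> Y"
  by (cases t) (auto simp: set_cat_Hom app_def)

lemma set_arr_eqI: "t \<in> Hom set_cat X Y \<Longrightarrow> t' \<in> Hom set_cat X Y \<Longrightarrow> (\<And>x. x \<in> X \<Longrightarrow> app t x = app t' x) \<Longrightarrow> t = t'"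
  by (cases t; cases t') (auto simp: set_cat_Hom app_def intro: PiE_ext)

text \<open>Composition in \<open>set_cat\<close> consults only the source set of the arrow applied
  first, so membership in that set suffices and no typing of either arrow is asked.\<close>

lemma app_Comp: "x \<in> fst t \<Longrightarrow> app (t' \<cdot>\<^bsub>set_cat\<^esub> t) x = app t' (app t x)"
  by (cases t; cases t') (auto simp: set_cat_Comp app_def mk_fun_def)

lemma fst_set_arr: "t \<in> Hom set_cat X Y \<Longrightarrow> fst t = X"
  by (cases t) (auto simp: set_cat_Hom)

lemma set_Id: "Id set_cat X = mk_fun X (\<lambda>x. x) X"
  by (simp add: set_cat_def)

lemma set_category: "category set_cat"
proof
  fix f g :: "'u set_arrow" and A B D assume "f \<in> Hom set_cat A B" "g \<in> Hom set_cat B D"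
  then show "g \<cdot>\<^bsub>set_cat\<^esub> f \<in> Hom set_cat A D"
    by (cases f; cases g) (auto simp: set_cat_Hom set_cat_Comp intro!: mk_fun_Hom)
next
  fix f :: "'u set_arrow" and A B assume "f \<in> Hom set_cat A B"
  then show "f \<cdot>\<^bsub>set_cat\<^esub> Id set_cat A = f" "Id set_cat B \<cdot>\<^bsub>set_cat\<^esub> f = f"
    by (cases f; auto simp: set_cat_Hom set_Id mk_fun_def set_cat_Comp fun_eq_iff PiE_iff extensional_def)+
next
  fix f g h :: "'u set_arrow" and A B D E assume "f \<in> Hom set_cat A B" "g \<in> Hom set_cat B D" "h \<in> Hom set_cat D E"
  then show "(h \<cdot>\<^bsub>set_cat\<^esub> g) \<cdot>\<^bsub>set_cat\<^esub> f = h \<cdot>\<^bsub>set_cat\<^esub> g \<cdot>\<^bsub>set_cat\<^esub> f"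
    by (cases f; cases g; cases h; auto simp: set_cat_Hom set_cat_Comp mk_fun_def fun_eq_iff PiE_iff)
qed (auto simp: set_Id intro!: mk_fun_Hom, auto simp: set_cat_def)

lemma set_is_iso:
  assumes "f \<in> Hom set_cat X Y" "bij_betw (app f) X Y"
  shows "is_iso set_cat f"
proof -
  interpret category set_cat by (rule set_category)
  let ?g = "mk_fun Y (inv_into X (app f)) X"
  have inv: "inv_into X (app f) y \<in> X" "app f (inv_into X (app f) y) = y" if "y \<in> Y" for y
    using that assms(2) by (auto simp: bij_betw_def f_inv_into_f inv_into_into)
  have g: "?g \<in> Hom set_cat Y X"
    using inv by (auto intro!: mk_fun_Hom)
  have "app (?g \<cdot>\<^bsub>set_cat\<^esub> f) x = app (Id set_cat X) x" if "x \<in> X" for x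
    using that assms by (simp add: app_Comp fst_set_arr app_mk_fun set_Id app_in bij_betw_def)
  moreover have "app (f \<cdot>\<^bsub>set_cat\<^esub> ?g) y = app (Id set_cat Y) y" if "y \<in> Y" for y
    using that inv by (simp add: app_Comp fst_set_arr[OF g] app_mk_fun set_Id)
  moreover have "Id set_cat A \<in> Hom set_cat A A" for A :: "'a set"
    by (rule Id_Hom) (simp add: set_cat_def)
  ultimately show ?thesis
    unfolding is_iso_def is_inverse_Hom[OF assms(1)]
    using g Comp_Hom[OF g assms(1)] Comp_Hom[OF assms(1) g] by (blast intro: set_arr_eqI)
qed

section \<open>Functor categories\<close>

lemma functor_Hom:
  "t \<in> Hom (functor_cat D E) F G \<longleftrightarrow> is_functor D E F \<and> is_functor D E G \<and>
    (\<exists>\<alpha>. t = (F, \<alpha>, G) \<and> nat_trans D E F G \<alpha> \<and> \<alpha> \<in> extensional (Obj D))"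
  by (auto simp: functor_cat_def Hom_def)

lemma functor_Comp: "(G', \<beta>, H) \<cdot>\<^bsub>functor_cat D E\<^esub> (F, \<alpha>, G) = (F, \<lambda>A \<in> Obj D. \<beta> A \<cdot>\<^bsub>E\<^esub> \<alpha> A, H)"
  by (simp add: functor_cat_def)

lemma functor_Id: "Id (functor_cat D E) F = (F, \<lambda>A \<in> Obj D. Id E (Fo F A), F)"
  by (simp add: functor_cat_def)

locale two_categories = D: category D + E: category E
  for D :: "('a, 'b, 'y) cat_scheme" and E :: "('c, 'd, 'z) cat_scheme"
begin

lemma nat_trans_Comp:
  assumes "nat_trans D E F G \<alpha>" "nat_trans D E G H \<beta>"
    "is_functor D E F" "is_functor D E G" "is_functor D E H"
  shows "nat_trans D E F H (\<lambda>A \<in> Obj D. \<beta> A \<cdot>\<^bsub>E\<^esub> \<alpha> A)"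
  unfolding nat_trans_def
proof (intro conjI ballI)
  fix A assume "A \<in> Obj D"
  then show "(\<lambda>A \<in> Obj D. \<beta> A \<cdot>\<^bsub>E\<^esub> \<alpha> A) A \<in> Hom E (Fo F A) (Fo H A)"
    using assms(1,2) E.Comp_Hom unfolding nat_trans_def by fastforce
next
  fix f assume f: "f \<in> Arr D"
  then have o: "Dom D f \<in> Obj D" "Cod D f \<in> Obj D"
    by (simp_all add: D.Dom_Obj D.Cod_Obj)
  have h: "\<alpha> A \<in> Hom E (Fo F A) (Fo G A)" "\<beta> A \<in> Hom E (Fo G A) (Fo H A)" if "A \<in> Obj D" for A
    using that assms(1,2) by (auto simp: nat_trans_def)
  have k: "Fa F f \<in> Hom E (Fo F (Dom D f)) (Fo F (Cod D f))" "Fa G f \<in> Hom E (Fo G (Dom D f)) (Fo G (Cod D f))"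
    "Fa H f \<in> Hom E (Fo H (Dom D f)) (Fo H (Cod D f))"
    using assms(3-5) f by (simp_all add: is_functor_def)
  have n: "Fa G f \<cdot>\<^bsub>E\<^esub> \<alpha> (Dom D f) = \<alpha> (Cod D f) \<cdot>\<^bsub>E\<^esub> Fa F f" "Fa H f \<cdot>\<^bsub>E\<^esub> \<beta> (Dom D f) = \<beta> (Cod D f) \<cdot>\<^bsub>E\<^esub> Fa G f"
    using assms(1,2) f by (simp_all add: nat_trans_def)
  have "Fa H f \<cdot>\<^bsub>E\<^esub> (\<beta> (Dom D f) \<cdot>\<^bsub>E\<^esub> \<alpha> (Dom D f)) = (\<beta> (Cod D f) \<cdot>\<^bsub>E\<^esub> Fa G f) \<cdot>\<^bsub>E\<^esub> \<alpha> (Dom D f)"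
    using E.Comp_assoc[OF h(1)[OF o(1)] h(2)[OF o(1)] k(3)] n by simp
  also have "\<dots> = (\<beta> (Cod D f) \<cdot>\<^bsub>E\<^esub> \<alpha> (Cod D f)) \<cdot>\<^bsub>E\<^esub> Fa F f"
    using E.Comp_assoc[OF h(1)[OF o(1)] k(2) h(2)[OF o(2)]] E.Comp_assoc[OF k(1) h(1)[OF o(2)] h(2)[OF o(2)]] n by simp
  finally show "Fa H f \<cdot>\<^bsub>E\<^esub> (\<lambda>A \<in> Obj D. \<beta> A \<cdot>\<^bsub>E\<^esub> \<alpha> A) (Dom D f) = (\<lambda>A \<in> Obj D. \<beta> A \<cdot>\<^bsub>E\<^esub> \<alpha> A) (Cod D f) \<cdot>\<^bsub>E\<^esub> Fa F f"
    using o by simp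
qed

lemma nat_trans_Id:
  assumes "is_functor D E F"
  shows "nat_trans D E F F (\<lambda>A \<in> Obj D. Id E (Fo F A))"
  using assms D.Dom_Obj D.Cod_Obj by (auto simp: nat_trans_def is_functor_def intro: E.Id_Hom simp: E.Comp_Id E.Id_Comp)

lemma functor_category: "category (functor_cat D E)"
proof
  fix t assume "t \<in> Arr (functor_cat D E)"
  then show "Dom (functor_cat D E) t \<in> Obj (functor_cat D E)" "Cod (functor_cat D E) t \<in> Obj (functor_cat D E)"
    by (auto simp: functor_cat_def)
next
  fix F assume "F \<in> Obj (functor_cat D E)"
  then have "is_functor D E F" by (simp add: functor_cat_def)
  then show "Id (functor_cat D E) F \<in> Hom (functor_cat D E) F F"
    by (simp add: functor_Id functor_Hom nat_trans_Id)
next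
  fix s t F G H assume "s \<in> Hom (functor_cat D E) F G" "t \<in> Hom (functor_cat D E) G H"
  then show "t \<cdot>\<^bsub>functor_cat D E\<^esub> s \<in> Hom (functor_cat D E) F H"
    by (auto simp: functor_Hom functor_Comp nat_trans_Comp)
next
  fix t F G assume "t \<in> Hom (functor_cat D E) F G"
  then obtain \<alpha> where t: "t = (F, \<alpha>, G)" "nat_trans D E F G \<alpha>" "\<alpha> \<in> extensional (Obj D)" "is_functor D E F" "is_functor D E G"
    by (auto simp: functor_Hom)
  then have h: "\<alpha> A \<in> Hom E (Fo F A) (Fo G A)" if "A \<in> Obj D" for A
    using that by (auto simp: nat_trans_def)
  show "t \<cdot>\<^bsub>functor_cat D E\<^esub> Id (functor_cat D E) F = t" "Id (functor_cat D E) G \<cdot>\<^bsub>functor_cat D E\<^esub> t = t"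
    using t(3) by (auto simp: t(1) functor_Id functor_Comp E.Comp_Id[OF h] E.Id_Comp[OF h] intro!: extensionalityI[where A = "Obj D"])
next
  fix s t u F G H K assume "s \<in> Hom (functor_cat D E) F G" "t \<in> Hom (functor_cat D E) G H" "u \<in> Hom (functor_cat D E) H K"
  then obtain \<alpha> \<beta> \<gamma> where stu: "s = (F, \<alpha>, G)" "t = (G, \<beta>, H)" "u = (H, \<gamma>, K)"
    "nat_trans D E F G \<alpha>" "nat_trans D E G H \<beta>" "nat_trans D E H K \<gamma>"
    by (auto simp: functor_Hom)
  then have "(\<gamma> A \<cdot>\<^bsub>E\<^esub> \<beta> A) \<cdot>\<^bsub>E\<^esub> \<alpha> A = \<gamma> A \<cdot>\<^bsub>E\<^esub> (\<beta> A \<cdot>\<^bsub>E\<^esub> \<alpha> A)" if "A \<in> Obj D" for A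
    using that by (intro E.Comp_assoc[of _ "Fo F A" "Fo G A" _ "Fo H A" _ "Fo K A"]) (simp_all add: nat_trans_def)
  then show "(u \<cdot>\<^bsub>functor_cat D E\<^esub> t) \<cdot>\<^bsub>functor_cat D E\<^esub> s = u \<cdot>\<^bsub>functor_cat D E\<^esub> t \<cdot>\<^bsub>functor_cat D E\<^esub> s"
    by (auto simp: stu functor_Comp intro!: restrict_ext)
qed

text \<open>Componentwise inverses are natural, as one sees by conjugating the naturality square of
  \<alpha> with them. This serves at two levels: for presheaves on \<open>C\<close> and for functors
  on C[J^v] with presheaves as values.\<close>

lemma functor_is_iso:
  assumes t: "(F, \<alpha>, G) \<in> Hom (functor_cat D E) F G" and iso: "\<And>A. A \<in> Obj D \<Longrightarrow> is_iso E (\<alpha> A)"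
  shows "is_iso (functor_cat D E) (F, \<alpha>, G)"
proof -
  have t': "nat_trans D E F G \<alpha>" "\<alpha> \<in> extensional (Obj D)" "is_functor D E F" "is_functor D E G"
    using t by (auto simp: functor_Hom)
  have h: "\<alpha> A \<in> Hom E (Fo F A) (Fo G A)" if "A \<in> Obj D" for A
    using that t' by (auto simp: nat_trans_def)
  have "\<forall>A \<in> Obj D. \<exists>g. is_inverse E (\<alpha> A) g"
    using iso unfolding is_iso_def by blast
  then obtain \<beta> where "\<forall>A \<in> Obj D. is_inverse E (\<alpha> A) (\<beta> A)"
    by (auto dest: bchoice)
  then have b: "\<beta> A \<in> Hom E (Fo G A) (Fo F A)" "\<beta> A \<cdot>\<^bsub>E\<^esub> \<alpha> A = Id E (Fo F A)" "\<alpha> A \<cdot>\<^bsub>E\<^esub> \<beta> A = Id E (Fo G A)" 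
    if "A \<in> Obj D" for A
    using that by (auto simp: E.is_inverse_Hom[OF h[OF that]])
  have "Fa F f \<cdot>\<^bsub>E\<^esub> \<beta> (Dom D f) = \<beta> (Cod D f) \<cdot>\<^bsub>E\<^esub> Fa G f" if f: "f \<in> Arr D" for f
  proof -
    have o: "Dom D f \<in> Obj D" "Cod D f \<in> Obj D"
      using f by (simp_all add: D.Dom_Obj D.Cod_Obj)
    have k: "Fa F f \<in> Hom E (Fo F (Dom D f)) (Fo F (Cod D f))" "Fa G f \<in> Hom E (Fo G (Dom D f)) (Fo G (Cod D f))"
      using t' f by (simp_all add: is_functor_def)
    have n: "Fa G f \<cdot>\<^bsub>E\<^esub> \<alpha> (Dom D f) = \<alpha> (Cod D f) \<cdot>\<^bsub>E\<^esub> Fa F f"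
      using t'(1) f by (simp add: nat_trans_def)
    have "\<beta> (Cod D f) \<cdot>\<^bsub>E\<^esub> Fa G f = (\<beta> (Cod D f) \<cdot>\<^bsub>E\<^esub> Fa G f) \<cdot>\<^bsub>E\<^esub> (\<alpha> (Dom D f) \<cdot>\<^bsub>E\<^esub> \<beta> (Dom D f))"
      using E.Comp_Id[OF E.Comp_Hom[OF k(2) b(1)[OF o(2)]]] b(3)[OF o(1)] by simp
    also have "\<dots> = \<beta> (Cod D f) \<cdot>\<^bsub>E\<^esub> ((\<alpha> (Cod D f) \<cdot>\<^bsub>E\<^esub> Fa F f) \<cdot>\<^bsub>E\<^esub> \<beta> (Dom D f))"
      using E.Comp_assoc4[OF b(1)[OF o(1)] h[OF o(1)] k(2) b(1)[OF o(2)]] n by simp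
    also have "\<dots> = (\<beta> (Cod D f) \<cdot>\<^bsub>E\<^esub> \<alpha> (Cod D f)) \<cdot>\<^bsub>E\<^esub> (Fa F f \<cdot>\<^bsub>E\<^esub> \<beta> (Dom D f))"
      using E.Comp_assoc4[OF b(1)[OF o(1)] k(1) h[OF o(2)] b(1)[OF o(2)]] by simp
    also have "\<dots> = Fa F f \<cdot>\<^bsub>E\<^esub> \<beta> (Dom D f)"
      using E.Id_Comp[OF E.Comp_Hom[OF b(1)[OF o(1)] k(1)]] b(2)[OF o(2)] by simp
    finally show ?thesis ..
  qed
  then have "nat_trans D E G F (restrict \<beta> (Obj D))"
    using b(1) D.Dom_Obj D.Cod_Obj by (simp add: nat_trans_def)
  then have "(G, restrict \<beta> (Obj D), F) \<in> Hom (functor_cat D E) G F"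
    using t' by (simp add: functor_Hom)
  moreover have "(G, restrict \<beta> (Obj D), F) \<cdot>\<^bsub>functor_cat D E\<^esub> (F, \<alpha>, G) = Id (functor_cat D E) F"
    "(F, \<alpha>, G) \<cdot>\<^bsub>functor_cat D E\<^esub> (G, restrict \<beta> (Obj D), F) = Id (functor_cat D E) G"
    by (auto simp: functor_Comp functor_Id b intro!: restrict_ext)
  ultimately show ?thesis
    unfolding is_iso_def category.is_inverse_Hom[OF functor_category t] by blast
qed

end

section \<open>Modules\<close>

context category
begin

abbreviation "bimodule M \<equiv> is_functor (bi_cat C) set_cat M"

lemma bi_category: "category (bi_cat C)"
  by (intro prod_category op_category category_axioms)

lemma bi_cat_sel:
  "Obj (bi_cat C) = Obj C \<times> Obj C" "Arr (bi_cat C) = Arr C \<times> Arr C"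
  "Dom (bi_cat C) (h, k) = (Cod C h, Dom C k)" "Cod (bi_cat C) (h, k) = (Dom C h, Cod C k)"
  "Id (bi_cat C) (X, A) = (Id C X, Id C A)" "(h', k') \<cdot>\<^bsub>bi_cat C\<^esub> (h, k) = (h \<cdot> h', k' \<cdot> k)"
  by (simp_all add: prod_cat_def op_cat_def)

lemma two_categories_Mod: "two_categories (bi_cat C) set_cat"
  by (intro two_categories.intro bi_category set_category)

lemma two_categories_psh: "two_categories (op_cat C) set_cat"
  by (intro two_categories.intro op_category set_category)

lemma Fa_Hom:
  assumes "bimodule M" "h \<in> Hom C X X'" "k \<in> Hom C A A'"
  shows "Fa M (h, k) \<in> Hom set_cat (Fo M (X', A)) (Fo M (X, A'))"
proof -
  have "(h, k) \<in> Arr (bi_cat C)" "Dom (bi_cat C) (h, k) = (X', A)" "Cod (bi_cat C) (h, k) = (X, A')"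
    using HomD[OF assms(2)] HomD[OF assms(3)] by (simp_all add: bi_cat_sel)
  then show ?thesis
    using assms(1) unfolding is_functor_def by metis
qed

lemma act_in:
  assumes "bimodule M" "h \<in> Hom C X X'" "k \<in> Hom C A A'" "m \<in> Fo M (X', A)"
  shows "act M h k m \<in> Fo M (X, A')"
  unfolding act_def by (rule app_in[OF Fa_Hom[OF assms(1-3)] assms(4)])

lemma act_Id:
  assumes "bimodule M" "X \<in> Obj C" "A \<in> Obj C" "m \<in> Fo M (X, A)"
  shows "act M (Id C X) (Id C A) m = m"
proof -
  have "(X, A) \<in> Obj (bi_cat C)"
    using assms by (simp add: bi_cat_sel)
  then have "Fa M (Id (bi_cat C) (X, A)) = Id set_cat (Fo M (X, A))"
    using assms(1) by (simp add: is_functor_def)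
  then show ?thesis
    using assms by (simp add: act_def bi_cat_sel set_Id app_mk_fun)
qed

lemma act_Comp:
  assumes "bimodule M" "h \<in> Hom C X X'" "h' \<in> Hom C X' X''" "k \<in> Hom C A A'" "k' \<in> Hom C A' A''" "m \<in> Fo M (X'', A)"
  shows "act M (h' \<cdot> h) (k' \<cdot> k) m = act M h k' (act M h' k m)"
proof -
  have "(h, k') \<in> Arr (bi_cat C)" "(h', k) \<in> Arr (bi_cat C)" "Dom (bi_cat C) (h, k') = Cod (bi_cat C) (h', k)"
    using HomD[OF assms(2)] HomD[OF assms(3)] HomD[OF assms(4)] HomD[OF assms(5)] by (simp_all add: bi_cat_sel)
  then have "Fa M ((h, k') \<cdot>\<^bsub>bi_cat C\<^esub> (h', k)) = Fa M (h, k') \<cdot>\<^bsub>set_cat\<^esub> Fa M (h', k)"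
    using assms(1) unfolding is_functor_def by blast
  then show ?thesis
    using assms(6) app_Comp[of m "Fa M (h', k)" "Fa M (h, k')"] fst_set_arr[OF Fa_Hom[OF assms(1,3,4)]]
    by (simp add: act_def bi_cat_sel)
qed

lemma act_left_right:
  assumes "bimodule M" "h \<in> Hom C X X'" "k \<in> Hom C A A'" "m \<in> Fo M (X', A)"
  shows "act M h (Id C A') (act M (Id C X') k m) = act M h k m"
    "act M (Id C X) k (act M h (Id C A) m) = act M h k m"
proof -
  have o: "X \<in> Obj C" "X' \<in> Obj C" "A \<in> Obj C" "A' \<in> Obj C"
    using HomD[OF assms(2)] HomD[OF assms(3)] by auto
  show "act M h (Id C A') (act M (Id C X') k m) = act M h k m"
    "act M (Id C X) k (act M h (Id C A) m) = act M h k m"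
    using act_Comp[OF assms(1,2) Id_Hom[OF o(2)] assms(3) Id_Hom[OF o(4)] assms(4)]
      act_Comp[OF assms(1) Id_Hom[OF o(1)] assms(2) Id_Hom[OF o(3)] assms(3,4)]
    by (simp_all add: Comp_Id[OF assms(2)] Id_Comp[OF assms(2)] Comp_Id[OF assms(3)] Id_Comp[OF assms(3)])
qed

section \<open>Modules given by explicit sets and actions\<close>

lemma Fo_mk_mod: "X \<in> Obj C \<Longrightarrow> A \<in> Obj C \<Longrightarrow> Fo (mk_mod C S a) (X, A) = S X A"
  by (simp add: mk_mod_def bi_cat_sel)

lemma act_mk_mod:
  "h \<in> Hom C X X' \<Longrightarrow> k \<in> Hom C A A' \<Longrightarrow> m \<in> S X' A \<Longrightarrow> act (mk_mod C S a) h k m = a h k m"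
  by (auto simp: act_def mk_mod_def bi_cat_sel Hom_def app_mk_fun)

lemma mk_mod_bimodule:
  assumes in_S: "\<And>X X' A A' h k m. h \<in> Hom C X X' \<Longrightarrow> k \<in> Hom C A A' \<Longrightarrow> m \<in> S X' A \<Longrightarrow> a h k m \<in> S X A'"
    and a_Id: "\<And>X A m. X \<in> Obj C \<Longrightarrow> A \<in> Obj C \<Longrightarrow> m \<in> S X A \<Longrightarrow> a (Id C X) (Id C A) m = m"
    and a_Comp: "\<And>X X' X'' A A' A'' h h' k k' m. h \<in> Hom C X X' \<Longrightarrow> h' \<in> Hom C X' X'' \<Longrightarrow> k \<in> Hom C A A' \<Longrightarrow>
      k' \<in> Hom C A' A'' \<Longrightarrow> m \<in> S X'' A \<Longrightarrow> a (h' \<cdot> h) (k' \<cdot> k) m = a h k' (a h' k m)"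
  shows "bimodule (mk_mod C S a)"
  unfolding is_functor_def
proof (intro conjI ballI impI)
  let ?M = "mk_mod C S a"
  show "Fo ?M \<in> extensional (Obj (bi_cat C))" "Fa ?M \<in> extensional (Arr (bi_cat C))"
    by (simp_all add: mk_mod_def)
  show "Fo ?M A \<in> Obj set_cat" for A
    by (simp add: set_cat_def)
  have Fa: "Fa ?M (h, k) = mk_fun (S X' A) (a h k) (S X A')" if "h \<in> Hom C X X'" "k \<in> Hom C A A'" for h k X X' A A'
    using that by (auto simp: mk_mod_def bi_cat_sel Hom_def)
  have FaH: "Fa ?M (h, k) \<in> Hom set_cat (S X' A) (S X A')" if "h \<in> Hom C X X'" "k \<in> Hom C A A'" for h k X X' A A'
    unfolding Fa[OF that] using in_S[OF that] by (auto intro!: mk_fun_Hom)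
  fix f assume f: "f \<in> Arr (bi_cat C)"
  obtain h k where hk: "f = (h, k)" "h \<in> Hom C (Dom C h) (Cod C h)" "k \<in> Hom C (Dom C k) (Cod C k)"
    using f Arr_Hom by (cases f) (auto simp: bi_cat_sel)
  show "Fa ?M f \<in> Hom set_cat (Fo ?M (Dom (bi_cat C) f)) (Fo ?M (Cod (bi_cat C) f))"
    using FaH[OF hk(2,3)] HomD[OF hk(2)] HomD[OF hk(3)] by (simp add: hk(1) bi_cat_sel Fo_mk_mod)
  fix g assume g: "g \<in> Arr (bi_cat C)" "Dom (bi_cat C) g = Cod (bi_cat C) f"
  obtain h' k' where g': "g = (h', k')" "h' \<in> Hom C (Dom C h') (Dom C h)" "k' \<in> Hom C (Cod C k) (Cod C k')"
    using g by (cases g) (auto simp: bi_cat_sel Hom_def hk(1))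
  note c = Comp_Hom[OF g'(2) hk(2)] Comp_Hom[OF hk(3) g'(3)]
  show "Fa ?M (g \<cdot>\<^bsub>bi_cat C\<^esub> f) = Fa ?M g \<cdot>\<^bsub>set_cat\<^esub> Fa ?M f"
    unfolding hk(1) g'(1) bi_cat_sel
  proof (rule set_arr_eqI[OF FaH[OF c] category.Comp_Hom[OF set_category FaH[OF hk(2,3)] FaH[OF g'(2,3)]]])
    fix m assume m: "m \<in> S (Cod C h) (Dom C k)"
    show "app (Fa ?M (h \<cdot> h', k' \<cdot> k)) m = app (Fa ?M (h', k') \<cdot>\<^bsub>set_cat\<^esub> Fa ?M (h, k)) m"
      using m in_S[OF hk(2,3) m] a_Comp[OF g'(2) hk(2,3) g'(3) m]
      by (simp add: app_Comp fst_set_arr[OF FaH[OF hk(2,3)]] Fa[OF c] Fa[OF hk(2,3)] Fa[OF g'(2,3)] app_mk_fun)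
  qed
next
  let ?M = "mk_mod C S a"
  fix P assume "P \<in> Obj (bi_cat C)"
  then obtain X A where P: "P = (X, A)" "X \<in> Obj C" "A \<in> Obj C"
    by (cases P) (auto simp: bi_cat_sel)
  have "Fa ?M (Id C X, Id C A) = mk_fun (S X A) (a (Id C X) (Id C A)) (S X A)"
    using HomD[OF Id_Hom[OF P(2)]] HomD[OF Id_Hom[OF P(3)]] by (simp add: mk_mod_def bi_cat_sel)
  also have "\<dots> = mk_fun (S X A) (\<lambda>x. x) (S X A)"
    unfolding mk_fun_def using a_Id[OF P(2,3)] by (auto intro: restrict_ext)
  finally show "Fa ?M (Id (bi_cat C) P) = Id set_cat (Fo ?M P)"
    by (simp add: P bi_cat_sel set_Id Fo_mk_mod)
qed

section \<open>Morphisms of modules, handled element by element\<close>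

definition ev :: "('o, 'm) mod_arr \<Rightarrow> 'o \<Rightarrow> 'o \<Rightarrow> ('o, 'm) elt \<Rightarrow> ('o, 'm) elt" where
  "ev t X A m = app (component t (X, A)) m"

lemma Mod_sel: "Obj (Mod C) = {M. bimodule M}" "Hom (Mod C) M N = Hom (functor_cat (bi_cat C) set_cat) M N"
  "Id (Mod C) M = Id (functor_cat (bi_cat C) set_cat) M"
  "s \<cdot>\<^bsub>Mod C\<^esub> t = s \<cdot>\<^bsub>functor_cat (bi_cat C) set_cat\<^esub> t"
  "N \<otimes>\<^bsub>Mod C\<^esub> M = mod_tensor C N M" "s \<star>\<^bsub>Mod C\<^esub> t = mod_tensor_arr C s t" "\<one>\<^bsub>Mod C\<^esub> = mod_hom C"
  "assoc (Mod C) = mod_assoc C" "lunit (Mod C) = mod_lunit C"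
  by (auto simp: Mod_def functor_cat_def Hom_def)

lemma Mod_category: "category (Mod C)"
proof -
  interpret F: category "functor_cat (bi_cat C) set_cat"
    by (rule two_categories.functor_category[OF two_categories_Mod])
  show ?thesis
  proof
    fix t assume "t \<in> Arr (Mod C)"
    then show "Dom (Mod C) t \<in> Obj (Mod C)" "Cod (Mod C) t \<in> Obj (Mod C)"
      by (auto simp: Mod_def functor_cat_def)
  next
    fix M assume "M \<in> Obj (Mod C)"
    then show "Id (Mod C) M \<in> Hom (Mod C) M M"
      using F.Id_Hom[of M] by (simp add: Mod_sel functor_cat_def)
  qed (simp_all only: Mod_sel F.Comp_Hom F.Comp_Id F.Id_Comp F.Comp_assoc)
qed

lemma Mod_HomD: "t \<in> Hom (Mod C) M N \<Longrightarrow> bimodule M \<and> bimodule N"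
  by (auto simp: Mod_sel functor_Hom)

lemma component_Hom:
  assumes "t \<in> Hom (Mod C) M N" "X \<in> Obj C" "A \<in> Obj C"
  shows "component t (X, A) \<in> Hom set_cat (Fo M (X, A)) (Fo N (X, A))"
proof -
  have "(X, A) \<in> Obj (bi_cat C)"
    using assms by (simp add: bi_cat_sel)
  then show ?thesis
    using assms(1) by (auto simp: Mod_sel functor_Hom component_def nat_trans_def)
qed

lemma ev_in:
  assumes "t \<in> Hom (Mod C) M N" "X \<in> Obj C" "A \<in> Obj C" "m \<in> Fo M (X, A)"
  shows "ev t X A m \<in> Fo N (X, A)"
  unfolding ev_def by (rule app_in[OF component_Hom[OF assms(1-3)] assms(4)])

lemma ev_nat:
  assumes "t \<in> Hom (Mod C) M N" "h \<in> Hom C X X'" "k \<in> Hom C A A'" "m \<in> Fo M (X', A)"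
  shows "ev t X A' (act M h k m) = act N h k (ev t X' A m)"
proof -
  have o: "X \<in> Obj C" "X' \<in> Obj C" "A \<in> Obj C" "A' \<in> Obj C"
    using HomD[OF assms(2)] HomD[OF assms(3)] by auto
  have "(h, k) \<in> Arr (bi_cat C)" "Dom (bi_cat C) (h, k) = (X', A)" "Cod (bi_cat C) (h, k) = (X, A')"
    using HomD[OF assms(2)] HomD[OF assms(3)] by (simp_all add: bi_cat_sel)
  then have "Fa N (h, k) \<cdot>\<^bsub>set_cat\<^esub> component t (X', A) = component t (X, A') \<cdot>\<^bsub>set_cat\<^esub> Fa M (h, k)"
    using assms(1) by (auto simp: Mod_sel functor_Hom nat_trans_def component_def)
  from arg_cong[OF this, of "\<lambda>s. app s m"] show ?thesis
    using assms(4) Mod_HomD[OF assms(1)]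
    by (simp add: app_Comp fst_set_arr[OF component_Hom[OF assms(1) o(2,3)]] fst_set_arr[OF Fa_Hom[OF _ assms(2,3)]] act_def ev_def)
qed

text \<open>The typed version \<open>ev_Comp\<close> asks for an arrow \<open>t\<close> of
  \<open>Mod C\<close>. This one lets composites with \<open>Ups_mult\<close>,
  \<open>Ups_coev\<close> and \<open>mod_assoc\<close> be evaluated from their explicit source sets,
  without a proof that these families are natural.\<close>

lemma ev_Comp':
  assumes "X \<in> Obj C" "A \<in> Obj C" "m \<in> fst (component t (X, A))"
  shows "ev (s \<cdot>\<^bsub>Mod C\<^esub> t) X A m = ev s X A (ev t X A m)"
  using assms app_Comp[of m "component t (X, A)" "component s (X, A)"]
  by (cases s; cases t) (auto simp: ev_def Mod_sel functor_Comp component_def bi_cat_sel)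

lemma ev_Comp:
  assumes "t \<in> Hom (Mod C) M N" "X \<in> Obj C" "A \<in> Obj C" "m \<in> Fo M (X, A)"
  shows "ev (s \<cdot>\<^bsub>Mod C\<^esub> t) X A m = ev s X A (ev t X A m)"
  using ev_Comp' assms fst_set_arr[OF component_Hom[OF assms(1-3)]] by simp

lemma ev_Id: "X \<in> Obj C \<Longrightarrow> A \<in> Obj C \<Longrightarrow> m \<in> Fo M (X, A) \<Longrightarrow> ev (Id (Mod C) M) X A m = m"
  by (simp add: ev_def Mod_sel functor_Id component_def bi_cat_sel set_Id app_mk_fun)

lemma mod_arr_eqI:
  assumes "s \<in> Hom (Mod C) M N" "t \<in> Hom (Mod C) M N"
    "\<And>X A m. X \<in> Obj C \<Longrightarrow> A \<in> Obj C \<Longrightarrow> m \<in> Fo M (X, A) \<Longrightarrow> ev s X A m = ev t X A m"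
  shows "s = t"
proof -
  obtain \<alpha> \<beta> where st: "s = (M, \<alpha>, N)" "t = (M, \<beta>, N)" "\<alpha> \<in> extensional (Obj (bi_cat C))" "\<beta> \<in> extensional (Obj (bi_cat C))"
    using assms(1,2) by (auto simp: Mod_sel functor_Hom)
  have "\<alpha> P = \<beta> P" if PO: "P \<in> Obj (bi_cat C)" for P
  proof -
    obtain X A where P: "P = (X, A)" "X \<in> Obj C" "A \<in> Obj C"
      using PO by (cases P) (auto simp: bi_cat_sel)
    have "component s (X, A) = component t (X, A)"
      by (rule set_arr_eqI[OF component_Hom[OF assms(1) P(2,3)] component_Hom[OF assms(2) P(2,3)]])
        (use assms(3)[OF P(2,3)] in \<open>simp add: ev_def\<close>)
    then show ?thesis by (simp add: st component_def P)
  qed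
  then have "\<alpha> = \<beta>"
    using st(3,4) by (intro extensionalityI)
  then show ?thesis by (simp add: st)
qed

lemma fst_component_mk_mod_arr: "X \<in> Obj C \<Longrightarrow> A \<in> Obj C \<Longrightarrow> fst (component (mk_mod_arr C M t N) (X, A)) = Fo M (X, A)"
  by (simp add: mk_mod_arr_def component_def bi_cat_sel mk_fun_def)

lemma ev_mk_mod_arr: "X \<in> Obj C \<Longrightarrow> A \<in> Obj C \<Longrightarrow> m \<in> Fo M (X, A) \<Longrightarrow> ev (mk_mod_arr C M t N) X A m = t X A m"
  by (simp add: ev_def mk_mod_arr_def component_def bi_cat_sel app_mk_fun)

lemma mk_mod_arr_Hom:
  assumes MN: "bimodule M" "bimodule N"
    and t_in: "\<And>X A m. X \<in> Obj C \<Longrightarrow> A \<in> Obj C \<Longrightarrow> m \<in> Fo M (X, A) \<Longrightarrow> t X A m \<in> Fo N (X, A)"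
    and t_nat: "\<And>X X' A A' h k m. h \<in> Hom C X X' \<Longrightarrow> k \<in> Hom C A A' \<Longrightarrow> m \<in> Fo M (X', A) \<Longrightarrow>
      t X A' (act M h k m) = act N h k (t X' A m)"
  shows "mk_mod_arr C M t N \<in> Hom (Mod C) M N"
proof -
  have H: "mk_fun (Fo M (X, A)) (t X A) (Fo N (X, A)) \<in> Hom set_cat (Fo M (X, A)) (Fo N (X, A))" if "X \<in> Obj C" "A \<in> Obj C" for X A
    using t_in[OF that] by (auto intro!: mk_fun_Hom)
  have "Fa N f \<cdot>\<^bsub>set_cat\<^esub> (\<lambda>(X, A) \<in> Obj (bi_cat C). mk_fun (Fo M (X, A)) (t X A) (Fo N (X, A))) (Dom (bi_cat C) f) =
      (\<lambda>(X, A) \<in> Obj (bi_cat C). mk_fun (Fo M (X, A)) (t X A) (Fo N (X, A))) (Cod (bi_cat C) f) \<cdot>\<^bsub>set_cat\<^esub> Fa M f"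
    if f: "f \<in> Arr (bi_cat C)" for f
  proof -
    obtain h k where hk: "f = (h, k)" "h \<in> Hom C (Dom C h) (Cod C h)" "k \<in> Hom C (Dom C k) (Cod C k)"
      using f Arr_Hom by (cases f) (auto simp: bi_cat_sel)
    then have o: "Dom C h \<in> Obj C" "Cod C h \<in> Obj C" "Dom C k \<in> Obj C" "Cod C k \<in> Obj C"
      using HomD by blast+
    note FM = Fa_Hom[OF MN(1) hk(2,3)] and FN = Fa_Hom[OF MN(2) hk(2,3)]
    note S = category.Comp_Hom[OF set_category]
    have "Fa N (h, k) \<cdot>\<^bsub>set_cat\<^esub> mk_fun (Fo M (Cod C h, Dom C k)) (t (Cod C h) (Dom C k)) (Fo N (Cod C h, Dom C k)) =
      mk_fun (Fo M (Dom C h, Cod C k)) (t (Dom C h) (Cod C k)) (Fo N (Dom C h, Cod C k)) \<cdot>\<^bsub>set_cat\<^esub> Fa M (h, k)"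
      apply (rule set_arr_eqI[OF S[OF H[OF o(2,3)] FN] S[OF FM H[OF o(1,4)]]])
      subgoal for m
        using t_nat[OF hk(2,3), of m] act_in[OF MN(1) hk(2,3), of m]
        by (simp add: app_Comp fst_set_arr[OF H[OF o(2,3)]] fst_set_arr[OF FM] app_mk_fun act_def)
      done
    then show ?thesis
      using o by (simp add: hk(1) bi_cat_sel)
  qed
  moreover have "(\<lambda>(X, A) \<in> Obj (bi_cat C). mk_fun (Fo M (X, A)) (t X A) (Fo N (X, A))) P \<in> Hom set_cat (Fo M P) (Fo N P)"
    if "P \<in> Obj (bi_cat C)" for P
    using that H by (cases P) (simp add: bi_cat_sel)
  ultimately have "nat_trans (bi_cat C) set_cat M N (\<lambda>(X, A) \<in> Obj (bi_cat C). mk_fun (Fo M (X, A)) (t X A) (Fo N (X, A)))"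
    unfolding nat_trans_def by blast
  then show ?thesis
    using MN by (simp add: Mod_sel functor_Hom mk_mod_arr_def)
qed

end

section \<open>The tensor product of modules\<close>

lemma equiv_equiv_closure: "equiv S (equiv_closure S R)"
proof (rule equivI)
  have "sym ((R \<union> R\<inverse>)\<^sup>*)"
    by (intro sym_rtrancl) (auto simp: sym_def)
  then show "sym (equiv_closure S R)"
    by (auto simp: equiv_closure_def sym_def)
qed (auto simp: equiv_closure_def refl_on_def trans_def)

lemma rep_in: "c \<noteq> {} \<Longrightarrow> rep c \<in> c"
  unfolding rep_def by (rule someI_ex) blast

context category
begin

text \<open>The class of the pair of \<open>m\<close> in \<open>M(B, A)\<close> and \<open>n\<close>
  in \<open>N(X, B)\<close>, in the order used by \<open>integrand\<close>. Its value is some pair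
  in the class, in general at another object than \<open>B\<close>.\<close>

definition tensor_elt where
  "tensor_elt N M X A B m n = coend_class C (integrand C N M X A) (At B (Pr m n))"

context
  fixes N M :: "('o, 'm) bimod" and X A :: 'o
  assumes N: "bimodule N" and M: "bimodule M" and X: "X \<in> Obj C" and A: "A \<in> Obj C"
begin

lemma coend_sum_integrand:
  "coend_sum C (integrand C N M X A) = {At B (Pr m n) | B m n. B \<in> Obj C \<and> m \<in> Fo M (B, A) \<and> n \<in> Fo N (X, B)}"
  unfolding coend_sum_def integrand_def by (auto simp: Fo_mk_mod)

text \<open>The general coend relation lets an arrow act on one variable and an identity on the
  other. In a tensor product the identity acts trivially on its factor, which leaves the usual
  balancing relation.\<close>

lemma coend_rel_integrand:
  "coend_rel C (integrand C N M X A) = equiv_closure (coend_sum C (integrand C N M X A))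
     {(At B (Pr (act M h (Id C A) m) n), At B' (Pr m (act N (Id C X) h n))) | B B' h m n.
        h \<in> Hom C B B' \<and> m \<in> Fo M (B', A) \<and> n \<in> Fo N (X, B)}"
proof -
  let ?P = "integrand C N M X A"
  have "app (Fa ?P (h, Id C B)) (Pr m n) = Pr (act M h (Id C A) m) n \<and>
      app (Fa ?P (Id C B', h)) (Pr m n) = Pr m (act N (Id C X) h n)"
    if h: "h \<in> Hom C B B'" and mn: "m \<in> Fo M (B', A)" "n \<in> Fo N (X, B)" for B B' h m n
  proof -
    have o: "B \<in> Obj C" "B' \<in> Obj C" using HomD[OF h] by auto
    show ?thesis
      using act_mk_mod[OF h Id_Hom[OF o(1)], of "Pr m n" "\<lambda>B' B. {Pr m n | m n. m \<in> Fo M (B', A) \<and> n \<in> Fo N (X, B)}"]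
       act_mk_mod[OF Id_Hom[OF o(2)] h, of "Pr m n" "\<lambda>B' B. {Pr m n | m n. m \<in> Fo M (B', A) \<and> n \<in> Fo N (X, B)}"]
       mn act_Id[OF N X o(1) mn(2)] act_Id[OF M o(2) A mn(1)]
      by (simp add: integrand_def act_def)
  qed
  note act = this[THEN conjunct1] this[THEN conjunct2]
  have Fo: "Fo ?P (B', B) = {Pr m n | m n. m \<in> Fo M (B', A) \<and> n \<in> Fo N (X, B)}" if "h \<in> Hom C B B'" for h B B'
    using HomD[OF that] by (simp add: integrand_def Fo_mk_mod)
  have "{(At B (app (Fa ?P (h, Id C B)) x), At B' (app (Fa ?P (Id C B', h)) x)) | B B' h x.
        h \<in> Hom C B B' \<and> x \<in> Fo ?P (B', B)} =
     {(At B (Pr (act M h (Id C A) m) n), At B' (Pr m (act N (Id C X) h n))) | B B' h m n.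
        h \<in> Hom C B B' \<and> m \<in> Fo M (B', A) \<and> n \<in> Fo N (X, B)}" (is "?L = ?R")
  proof (intro equalityI subsetI)
    fix p assume "p \<in> ?L"
    then obtain B B' h x where x: "p = (At B (app (Fa ?P (h, Id C B)) x), At B' (app (Fa ?P (Id C B', h)) x))"
      "h \<in> Hom C B B'" "x \<in> Fo ?P (B', B)" by blast
    then obtain m n where "x = Pr m n" "m \<in> Fo M (B', A)" "n \<in> Fo N (X, B)"
      using Fo[OF x(2)] by auto
    then show "p \<in> ?R"
      using x(1,2) act[OF x(2)] by auto
  next
    fix p assume "p \<in> ?R"
    then obtain B B' h m n where x: "p = (At B (Pr (act M h (Id C A) m) n), At B' (Pr m (act N (Id C X) h n)))"
      "h \<in> Hom C B B'" "m \<in> Fo M (B', A)" "n \<in> Fo N (X, B)" by blast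
    then have "Pr m n \<in> Fo ?P (B', B)"
      using Fo[OF x(2)] by auto
    moreover have "p = (At B (app (Fa ?P (h, Id C B)) (Pr m n)), At B' (app (Fa ?P (Id C B', h)) (Pr m n)))"
      using act[OF x(2-4)] x(1) by simp
    ultimately show "p \<in> ?L"
      using x(2) by blast
  qed
  then show ?thesis
    by (simp add: coend_rel_def)
qed

lemma coend_class_eq:
  "(x, y) \<in> coend_rel C (integrand C N M X A) \<Longrightarrow>
    coend_class C (integrand C N M X A) x = coend_class C (integrand C N M X A) y"
  unfolding coend_class_def coend_rel_def by (subst equiv_class_eq[OF equiv_equiv_closure]) auto

lemma coend_class_rel:
  assumes "x \<in> coend_sum C (integrand C N M X A)"
  shows "(x, coend_class C (integrand C N M X A) x) \<in> coend_rel C (integrand C N M X A)"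
proof -
  have "x \<in> coend_rel C (integrand C N M X A) `` {x}"
    using assms unfolding coend_rel_def by (intro equiv_class_self[OF equiv_equiv_closure])
  then have "coend_rel C (integrand C N M X A) `` {x} \<noteq> {}" by blast
  from rep_in[OF this] show ?thesis
    by (simp add: coend_class_def)
qed

lemma tensor_elt_slide:
  assumes h: "h \<in> Hom C B B'" and m: "m \<in> Fo M (B', A)" and n: "n \<in> Fo N (X, B)"
  shows "tensor_elt N M X A B (act M h (Id C A) m) n = tensor_elt N M X A B' m (act N (Id C X) h n)"
  unfolding tensor_elt_def
proof (rule coend_class_eq)
  have o: "B \<in> Obj C" "B' \<in> Obj C" using HomD[OF h] by auto
  have "act M h (Id C A) m \<in> Fo M (B, A)" "act N (Id C X) h n \<in> Fo N (X, B')"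
    using act_in[OF M h Id_Hom[OF A] m] act_in[OF N Id_Hom[OF X] h n] .
  then have "At B (Pr (act M h (Id C A) m) n) \<in> coend_sum C (integrand C N M X A)"
    "At B' (Pr m (act N (Id C X) h n)) \<in> coend_sum C (integrand C N M X A)"
    using m n o by (auto simp: coend_sum_integrand)
  then show "(At B (Pr (act M h (Id C A) m) n), At B' (Pr m (act N (Id C X) h n))) \<in> coend_rel C (integrand C N M X A)"
    unfolding coend_rel_integrand equiv_closure_def using h m n by blast
qed

lemma tensor_elt_in:
  assumes "B \<in> Obj C" "m \<in> Fo M (B, A)" "n \<in> Fo N (X, B)"
  shows "tensor_elt N M X A B m n \<in> Fo (mod_tensor C N M) (X, A)"
  using assms X A by (auto simp: tensor_elt_def mod_tensor_def Fo_mk_mod coend_def coend_sum_integrand)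

text \<open>A chosen representative lies in its own class. So an element is at once a literal pair,
  as the case distinctions read it, and the class of that pair, as the computation rules need
  it.\<close>

lemma tensorE:
  assumes "z \<in> Fo (mod_tensor C N M) (X, A)"
  obtains B m n where "z = At B (Pr m n)" "z = tensor_elt N M X A B m n" "B \<in> Obj C" "m \<in> Fo M (B, A)" "n \<in> Fo N (X, B)"
proof -
  obtain x where x: "x \<in> coend_sum C (integrand C N M X A)" "z = coend_class C (integrand C N M X A) x"
    using assms X A by (auto simp: mod_tensor_def Fo_mk_mod coend_def)
  note r = coend_class_rel[OF x(1), folded x(2)]
  then have "z \<in> coend_sum C (integrand C N M X A)" 
    by (simp add: coend_rel_def equiv_closure_def)
  then obtain B m n where z: "z = At B (Pr m n)" "B \<in> Obj C" "m \<in> Fo M (B, A)" "n \<in> Fo N (X, B)"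
    by (auto simp: coend_sum_integrand)
  moreover have "z = tensor_elt N M X A B m n"
    using coend_class_eq[OF r] x(2) by (simp add: tensor_elt_def z(1))
  ultimately show thesis using that by blast
qed

text \<open>Functions on a coend of modules are defined on chosen representatives, so that evaluating
  them requires invariance under the generating relation.\<close>

lemma tensor_elt_eval:
  assumes "\<And>B B' h m n. h \<in> Hom C B B' \<Longrightarrow> m \<in> Fo M (B', A) \<Longrightarrow> n \<in> Fo N (X, B) \<Longrightarrow>
      f (At B (Pr (act M h (Id C A) m) n)) = f (At B' (Pr m (act N (Id C X) h n)))"
    and "B \<in> Obj C" "m \<in> Fo M (B, A)" "n \<in> Fo N (X, B)"
  shows "f (tensor_elt N M X A B m n) = f (At B (Pr m n))"
proof -
  have "At B (Pr m n) \<in> coend_sum C (integrand C N M X A)"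
    using assms by (auto simp: coend_sum_integrand)
  from coend_class_rel[OF this] have "(At B (Pr m n), tensor_elt N M X A B m n) \<in> (
     {(At B (Pr (act M h (Id C A) m) n), At B' (Pr m (act N (Id C X) h n))) | B B' h m n.
        h \<in> Hom C B B' \<and> m \<in> Fo M (B', A) \<and> n \<in> Fo N (X, B)} \<union>
     {(At B (Pr (act M h (Id C A) m) n), At B' (Pr m (act N (Id C X) h n))) | B B' h m n.
        h \<in> Hom C B B' \<and> m \<in> Fo M (B', A) \<and> n \<in> Fo N (X, B)}\<inverse>)\<^sup>*"
    by (simp add: tensor_elt_def coend_rel_integrand equiv_closure_def)
  then have "f (At B (Pr m n)) = f (tensor_elt N M X A B m n)"
  proof (induction rule: rtrancl_induct)
    case (step y z)
    have "f u = f v" if "(u, v) \<in> {(At B (Pr (act M h (Id C A) m) n), At B' (Pr m (act N (Id C X) h n))) | B B' h m n.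
        h \<in> Hom C B B' \<and> m \<in> Fo M (B', A) \<and> n \<in> Fo N (X, B)}" for u v
      using that assms(1) by blast
    with step show ?case
      by (metis (no_types, lifting) Un_iff converseD)
  qed simp
  then show ?thesis ..
qed

end

text \<open>The definition acts on the chosen representative. The result does not depend on it
  because the actions of \<open>h\<close> and \<open>k\<close> on the outer variables commute with
  the balancing in the inner one.\<close>

lemma act_tensor_elt:
  assumes N: "bimodule N" and M: "bimodule M" and h: "h \<in> Hom C X X'" and k: "k \<in> Hom C A A'"
    and B: "B \<in> Obj C" and m: "m \<in> Fo M (B, A)" and n: "n \<in> Fo N (X', B)"
  shows "act (mod_tensor C N M) h k (tensor_elt N M X' A B m n) =
    tensor_elt N M X A' B (act M (Id C B) k m) (act N h (Id C B) n)"
proof -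
  have o: "X \<in> Obj C" "X' \<in> Obj C" "A \<in> Obj C" "A' \<in> Obj C" "Dom C h = X" "Cod C k = A'"
    using HomD[OF h] HomD[OF k] by auto
  have z: "tensor_elt N M X' A B m n \<in> coend C (integrand C N M X' A)"
    using tensor_elt_in[OF N M o(2,3) B m n] o by (simp add: mod_tensor_def Fo_mk_mod)
  let ?f = "\<lambda>z. case z of At B (Pr m n) \<Rightarrow>
        coend_class C (integrand C N M (Dom C h) (Cod C k)) (At B (Pr (act M (Id C B) k m) (act N h (Id C B) n)))"
  have "act (mod_tensor C N M) h k (tensor_elt N M X' A B m n) = ?f (tensor_elt N M X' A B m n)"
    unfolding mod_tensor_def using act_mk_mod[OF h k, of _ "\<lambda>X A. coend C (integrand C N M X A)"] z by blast
  also have "\<dots> = ?f (At B (Pr m n))"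
  proof (rule tensor_elt_eval[OF N M o(2,3) _ B m n])
    fix B B' g m n assume g: "g \<in> Hom C B B'" and mn: "m \<in> Fo M (B', A)" "n \<in> Fo N (X', B)"
    have b: "B \<in> Obj C" "B' \<in> Obj C" using HomD[OF g] by auto
    have "tensor_elt N M X A' B (act M (Id C B) k (act M g (Id C A) m)) (act N h (Id C B) n) =
      tensor_elt N M X A' B (act M g (Id C A') (act M (Id C B') k m)) (act N h (Id C B) n)"
      using act_left_right[OF M g k mn(1)] by simp
    also have "\<dots> = tensor_elt N M X A' B' (act M (Id C B') k m) (act N (Id C X) g (act N h (Id C B) n))"
      by (rule tensor_elt_slide[OF N M o(1,4) g act_in[OF M Id_Hom[OF b(2)] k mn(1)] act_in[OF N h Id_Hom[OF b(1)] mn(2)]])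
    also have "\<dots> = tensor_elt N M X A' B' (act M (Id C B') k m) (act N h (Id C B') (act N (Id C X') g n))"
      using act_left_right[OF N h g mn(2)] by simp
    finally show "?f (At B (Pr (act M g (Id C A) m) n)) = ?f (At B' (Pr m (act N (Id C X') g n)))"
      using o by (simp add: tensor_elt_def)
  qed
  finally show ?thesis
    using o by (simp add: tensor_elt_def)
qed

lemma tensor_bimodule:
  assumes N: "bimodule N" and M: "bimodule M"
  shows "bimodule (mod_tensor C N M)"
proof -
  let ?a = "\<lambda>h k z. case z of At B (Pr m n) \<Rightarrow>
        coend_class C (integrand C N M (Dom C h) (Cod C k)) (At B (Pr (act M (Id C B) k m) (act N h (Id C B) n)))"
  have T: "Fo (mod_tensor C N M) (X, A) = coend C (integrand C N M X A)" if "X \<in> Obj C" "A \<in> Obj C" for X A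
    using that by (simp add: mod_tensor_def Fo_mk_mod)
  \<comment> \<open>On the coend the case distinction equals the action computed by
    \<open>act_tensor_elt\<close>, so the module laws can be checked on classes.\<close>
  have a: "?a h k z = act (mod_tensor C N M) h k z" if "h \<in> Hom C X X'" "k \<in> Hom C A A'" "z \<in> coend C (integrand C N M X' A)" for h k z X X' A A'
    unfolding mod_tensor_def using act_mk_mod[OF that(1,2), of z "\<lambda>X A. coend C (integrand C N M X A)"] that(3) by simp
  have mem: "act (mod_tensor C N M) h k z \<in> coend C (integrand C N M X A')" 
    if h: "h \<in> Hom C X X'" and k: "k \<in> Hom C A A'" and z: "z \<in> coend C (integrand C N M X' A)" for h k z X X' A A'
  proof -
    have o: "X \<in> Obj C" "X' \<in> Obj C" "A \<in> Obj C" "A' \<in> Obj C"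
      using HomD[OF h] HomD[OF k] by auto
    obtain B m n where z: "z = tensor_elt N M X' A B m n" "B \<in> Obj C" "m \<in> Fo M (B, A)" "n \<in> Fo N (X', B)"
      using z tensorE[OF N M o(2,3)] by (metis T[OF o(2,3)])
    show ?thesis
      using tensor_elt_in[OF N M o(1,4) z(2) act_in[OF M Id_Hom[OF z(2)] k z(3)] act_in[OF N h Id_Hom[OF z(2)] z(4)]]
      by (simp add: z(1) act_tensor_elt[OF N M h k z(2-4)] T[OF o(1,4)])
  qed
  show ?thesis
    unfolding mod_tensor_def
  proof (rule mk_mod_bimodule, goal_cases)
    case (1 X X' A A' h k z)
    then show ?case
      using mem[OF 1] by (simp only: a[OF 1])
  next
    case (2 X A z)
    obtain B m n where z: "z = tensor_elt N M X A B m n" "B \<in> Obj C" "m \<in> Fo M (B, A)" "n \<in> Fo N (X, B)"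
      using 2 tensorE[OF N M 2(1,2)] by (metis T[OF 2(1,2)])
    have "act (mod_tensor C N M) (Id C X) (Id C A) z = z"
      unfolding z(1) act_tensor_elt[OF N M Id_Hom[OF 2(1)] Id_Hom[OF 2(2)] z(2-4)]
      using act_Id[OF M z(2) 2(2) z(3)] act_Id[OF N 2(1) z(2) z(4)] by simp
    then show ?case
      by (simp only: a[OF Id_Hom[OF 2(1)] Id_Hom[OF 2(2)] 2(3)])
  next
    case (3 X X' X'' A A' A'' h h' k k' z)
    have o: "X'' \<in> Obj C" "A \<in> Obj C"
      using HomD[OF 3(2)] HomD[OF 3(3)] by auto
    obtain B m n where z: "z = tensor_elt N M X'' A B m n" "B \<in> Obj C" "m \<in> Fo M (B, A)" "n \<in> Fo N (X'', B)"
      using 3 tensorE[OF N M o] by (metis T[OF o])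
    note B = Id_Hom[OF z(2)]
    have "act M (Id C B) (k' \<cdot> k) m = act M (Id C B) k' (act M (Id C B) k m)"
      using act_Comp[OF M B B 3(3,4) z(3)] by (simp add: Comp_Id[OF B])
    moreover have "act N (h' \<cdot> h) (Id C B) n = act N h (Id C B) (act N h' (Id C B) n)"
      using act_Comp[OF N 3(1,2) B B z(4)] by (simp add: Comp_Id[OF B])
    ultimately have "act (mod_tensor C N M) (h' \<cdot> h) (k' \<cdot> k) z = act (mod_tensor C N M) h k' (act (mod_tensor C N M) h' k z)"
      unfolding z(1) by (simp add: act_tensor_elt[OF N M Comp_Hom[OF 3(1,2)] Comp_Hom[OF 3(3,4)] z(2-4)] act_tensor_elt[OF N M 3(2,3) z(2-4)]
        act_tensor_elt[OF N M 3(1,4) z(2) act_in[OF M B 3(3) z(3)] act_in[OF N 3(2) B z(4)]])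
    then show ?case
      unfolding a[OF Comp_Hom[OF 3(1,2)] Comp_Hom[OF 3(3,4)] 3(5)] a[OF 3(2,3,5)] a[OF 3(1,4) mem[OF 3(2,3,5)]] .
  qed
qed

lemma Hom_triple:
  assumes "t \<in> Hom (Mod C) M N"
  shows "t = (M, fst (snd t), N)" "app (fst (snd t) (X, A)) = ev t X A"
  using assms by (auto simp: Mod_sel functor_Hom ev_def component_def)

text \<open>Naturality of \<alpha> and \<beta> carries the balancing relation of the source to that
  of the target, which is the invariance needed.\<close>

lemma ev_tensor_arr:
  assumes \<beta>: "\<beta> \<in> Hom (Mod C) N N'" and \<alpha>: "\<alpha> \<in> Hom (Mod C) M M'" and X: "X \<in> Obj C" and A: "A \<in> Obj C"
    and B: "B \<in> Obj C" and m: "m \<in> Fo M (B, A)" and n: "n \<in> Fo N (X, B)"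
  shows "ev (mod_tensor_arr C \<beta> \<alpha>) X A (tensor_elt N M X A B m n) = tensor_elt N' M' X A B (ev \<alpha> B A m) (ev \<beta> X B n)"
proof -
  have N: "bimodule N" "bimodule N'" and M: "bimodule M" "bimodule M'"
    using Mod_HomD[OF \<alpha>] Mod_HomD[OF \<beta>] by auto
  let ?f = "\<lambda>z. case z of At B (Pr m n) \<Rightarrow>
          coend_class C (integrand C N' M' X A) (At B (Pr (ev \<alpha> B A m) (ev \<beta> X B n)))"
  have "mod_tensor_arr C \<beta> \<alpha> = mk_mod_arr C (mod_tensor C N M) (\<lambda>X A z. case z of At B (Pr m n) \<Rightarrow>
          coend_class C (integrand C N' M' X A) (At B (Pr (ev \<alpha> B A m) (ev \<beta> X B n)))) (mod_tensor C N' M')"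
    using Hom_triple[OF \<alpha>] Hom_triple[OF \<beta>] by (cases \<alpha>; cases \<beta>) (simp add: mod_tensor_arr_def)
  then have "ev (mod_tensor_arr C \<beta> \<alpha>) X A (tensor_elt N M X A B m n) = ?f (tensor_elt N M X A B m n)"
    using ev_mk_mod_arr[OF X A tensor_elt_in[OF N(1) M(1) X A B m n]] by simp
  also have "\<dots> = ?f (At B (Pr m n))"
  proof (rule tensor_elt_eval[OF N(1) M(1) X A _ B m n])
    fix B B' g m n assume g: "g \<in> Hom C B B'" and mn: "m \<in> Fo M (B', A)" "n \<in> Fo N (X, B)"
    have b: "B \<in> Obj C" "B' \<in> Obj C" using HomD[OF g] by auto
    show "?f (At B (Pr (act M g (Id C A) m) n)) = ?f (At B' (Pr m (act N (Id C X) g n)))"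
      using tensor_elt_slide[OF N(2) M(2) X A g ev_in[OF \<alpha> b(2) A mn(1)] ev_in[OF \<beta> X b(1) mn(2)]]
      by (simp add: ev_nat[OF \<alpha> g Id_Hom[OF A] mn(1)] ev_nat[OF \<beta> Id_Hom[OF X] g mn(2)] tensor_elt_def)
  qed
  finally show ?thesis by (simp add: tensor_elt_def)
qed

lemma tensor_arr_Hom:
  assumes \<beta>: "\<beta> \<in> Hom (Mod C) N N'" and \<alpha>: "\<alpha> \<in> Hom (Mod C) M M'"
  shows "mod_tensor_arr C \<beta> \<alpha> \<in> Hom (Mod C) (mod_tensor C N M) (mod_tensor C N' M')"
proof -
  have N: "bimodule N" "bimodule N'" and M: "bimodule M" "bimodule M'"
    using Mod_HomD[OF \<alpha>] Mod_HomD[OF \<beta>] by auto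
  let ?t = "\<lambda>X A z. case z of At B (Pr m n) \<Rightarrow>
          coend_class C (integrand C N' M' X A) (At B (Pr (ev \<alpha> B A m) (ev \<beta> X B n)))"
  have eq: "mod_tensor_arr C \<beta> \<alpha> = mk_mod_arr C (mod_tensor C N M) ?t (mod_tensor C N' M')"
    using Hom_triple[OF \<alpha>] Hom_triple[OF \<beta>] by (cases \<alpha>; cases \<beta>) (simp add: mod_tensor_arr_def)
  have t: "?t X A z = ev (mod_tensor_arr C \<beta> \<alpha>) X A z" if "X \<in> Obj C" "A \<in> Obj C" "z \<in> Fo (mod_tensor C N M) (X, A)" for X A z
    unfolding eq using ev_mk_mod_arr[OF that, of ?t] by simp
  have "mk_mod_arr C (mod_tensor C N M) ?t (mod_tensor C N' M') \<in> Hom (Mod C) (mod_tensor C N M) (mod_tensor C N' M')"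
  proof (rule mk_mod_arr_Hom[OF tensor_bimodule[OF N(1) M(1)] tensor_bimodule[OF N(2) M(2)]], goal_cases)
    case (1 X A z)
    from 1(3) obtain B m n where z: "z = tensor_elt N M X A B m n" "B \<in> Obj C" "m \<in> Fo M (B, A)" "n \<in> Fo N (X, B)"
      by (rule tensorE[OF N(1) M(1) 1(1,2)])
    have "ev (mod_tensor_arr C \<beta> \<alpha>) X A z \<in> Fo (mod_tensor C N' M') (X, A)"
      unfolding z(1) ev_tensor_arr[OF \<beta> \<alpha> 1(1,2) z(2-4)]
      by (rule tensor_elt_in[OF N(2) M(2) 1(1,2) z(2) ev_in[OF \<alpha> z(2) 1(2) z(3)] ev_in[OF \<beta> 1(1) z(2,4)]])
    then show ?case
      by (simp only: t[OF 1])
  next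
    case (2 X X' A A' h k z)
    have o: "X \<in> Obj C" "X' \<in> Obj C" "A \<in> Obj C" "A' \<in> Obj C"
      using HomD[OF 2(1)] HomD[OF 2(2)] by auto
    from 2(3) obtain B m n where z: "z = tensor_elt N M X' A B m n" "B \<in> Obj C" "m \<in> Fo M (B, A)" "n \<in> Fo N (X', B)"
      by (rule tensorE[OF N(1) M(1) o(2,3)])
    note B = Id_Hom[OF z(2)]
    have "ev (mod_tensor_arr C \<beta> \<alpha>) X A' (act (mod_tensor C N M) h k z) = 
        act (mod_tensor C N' M') h k (ev (mod_tensor_arr C \<beta> \<alpha>) X' A z)"
      unfolding z(1) act_tensor_elt[OF N(1) M(1) 2(1,2) z(2-4)] ev_tensor_arr[OF \<beta> \<alpha> o(2,3) z(2-4)]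
      by (simp add: ev_tensor_arr[OF \<beta> \<alpha> o(1,4) z(2) act_in[OF M(1) B 2(2) z(3)] act_in[OF N(1) 2(1) B z(4)]]
        act_tensor_elt[OF N(2) M(2) 2(1,2) z(2) ev_in[OF \<alpha> z(2) o(3) z(3)] ev_in[OF \<beta> o(2) z(2,4)]]
        ev_nat[OF \<alpha> B 2(2) z(3)] ev_nat[OF \<beta> 2(1) B z(4)])
    then show ?case
      using t[OF o(1,4) act_in[OF tensor_bimodule[OF N(1) M(1)] 2]] t[OF o(2,3) 2(3)] by simp
  qed
  then show ?thesis
    by (simp only: eq)
qed

lemma tensor_arr_Comp:
  assumes \<beta>: "\<beta> \<in> Hom (Mod C) N N'" "\<beta>' \<in> Hom (Mod C) N' N''" and \<alpha>: "\<alpha> \<in> Hom (Mod C) M M'" "\<alpha>' \<in> Hom (Mod C) M' M''"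
  shows "mod_tensor_arr C (\<beta>' \<cdot>\<^bsub>Mod C\<^esub> \<beta>) (\<alpha>' \<cdot>\<^bsub>Mod C\<^esub> \<alpha>) = mod_tensor_arr C \<beta>' \<alpha>' \<cdot>\<^bsub>Mod C\<^esub> mod_tensor_arr C \<beta> \<alpha>"
proof (rule mod_arr_eqI)
  note c = category.Comp_Hom[OF Mod_category]
  show "mod_tensor_arr C (\<beta>' \<cdot>\<^bsub>Mod C\<^esub> \<beta>) (\<alpha>' \<cdot>\<^bsub>Mod C\<^esub> \<alpha>) \<in> Hom (Mod C) (mod_tensor C N M) (mod_tensor C N'' M'')"
    by (rule tensor_arr_Hom[OF c[OF \<beta>] c[OF \<alpha>]])
  show "mod_tensor_arr C \<beta>' \<alpha>' \<cdot>\<^bsub>Mod C\<^esub> mod_tensor_arr C \<beta> \<alpha> \<in> Hom (Mod C) (mod_tensor C N M) (mod_tensor C N'' M'')"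
    by (rule c[OF tensor_arr_Hom[OF \<beta>(1) \<alpha>(1)] tensor_arr_Hom[OF \<beta>(2) \<alpha>(2)]])
  have N: "bimodule N" and M: "bimodule M" 
    using Mod_HomD[OF \<alpha>(1)] Mod_HomD[OF \<beta>(1)] by auto
  fix X A z assume o: "X \<in> Obj C" "A \<in> Obj C" and z: "z \<in> Fo (mod_tensor C N M) (X, A)"
  from z obtain B m n where z': "z = tensor_elt N M X A B m n" "B \<in> Obj C" "m \<in> Fo M (B, A)" "n \<in> Fo N (X, B)"
    by (rule tensorE[OF N M o])
  show "ev (mod_tensor_arr C (\<beta>' \<cdot>\<^bsub>Mod C\<^esub> \<beta>) (\<alpha>' \<cdot>\<^bsub>Mod C\<^esub> \<alpha>)) X A z = ev (mod_tensor_arr C \<beta>' \<alpha>' \<cdot>\<^bsub>Mod C\<^esub> mod_tensor_arr C \<beta> \<alpha>) X A z"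
    unfolding ev_Comp[OF tensor_arr_Hom[OF \<beta>(1) \<alpha>(1)] o z]
    unfolding z'(1) ev_tensor_arr[OF \<beta>(1) \<alpha>(1) o z'(2-4)] ev_tensor_arr[OF c[OF \<beta>] c[OF \<alpha>] o z'(2-4)]
      ev_tensor_arr[OF \<beta>(2) \<alpha>(2) o z'(2) ev_in[OF \<alpha>(1) z'(2) o(2) z'(3)] ev_in[OF \<beta>(1) o(1) z'(2,4)]]
      ev_Comp[OF \<alpha>(1) z'(2) o(2) z'(3)] ev_Comp[OF \<beta>(1) o(1) z'(2,4)] ..
qed

lemma Mod_Id_Hom: "bimodule M \<Longrightarrow> Id (Mod C) M \<in> Hom (Mod C) M M"
  by (rule category.Id_Hom[OF Mod_category]) (simp add: Mod_sel)

lemma tensor_arr_Id: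
  assumes N: "bimodule N" and M: "bimodule M"
  shows "mod_tensor_arr C (Id (Mod C) N) (Id (Mod C) M) = Id (Mod C) (mod_tensor C N M)"
proof (rule mod_arr_eqI[OF tensor_arr_Hom[OF Mod_Id_Hom[OF N] Mod_Id_Hom[OF M]] Mod_Id_Hom[OF tensor_bimodule[OF N M]]])
  fix X A z assume o: "X \<in> Obj C" "A \<in> Obj C" and z: "z \<in> Fo (mod_tensor C N M) (X, A)"
  from z obtain B m n where z': "z = tensor_elt N M X A B m n" "B \<in> Obj C" "m \<in> Fo M (B, A)" "n \<in> Fo N (X, B)"
    by (rule tensorE[OF N M o])
  show "ev (mod_tensor_arr C (Id (Mod C) N) (Id (Mod C) M)) X A z = ev (Id (Mod C) (mod_tensor C N M)) X A z"
    using ev_Id[OF o z] 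
    by (simp add: z'(1) ev_tensor_arr[OF Mod_Id_Hom[OF N] Mod_Id_Hom[OF M] o z'(2-4)] ev_Id[OF z'(2) o(2) z'(3)] ev_Id[OF o(1) z'(2,4)])
qed

lemma tensor_arr_is_iso:
  assumes \<beta>: "\<beta> \<in> Hom (Mod C) N N'" "is_iso (Mod C) \<beta>" and \<alpha>: "\<alpha> \<in> Hom (Mod C) M M'" "is_iso (Mod C) \<alpha>"
  shows "is_iso (Mod C) (mod_tensor_arr C \<beta> \<alpha>)"
proof -
  interpret V: category "Mod C" by (rule Mod_category)
  obtain \<beta>' \<alpha>' where "is_inverse (Mod C) \<beta> \<beta>'" "is_inverse (Mod C) \<alpha> \<alpha>'"
    using assms by (auto simp: is_iso_def)
  then have i: "\<beta>' \<in> Hom (Mod C) N' N" "\<beta>' \<cdot>\<^bsub>Mod C\<^esub> \<beta> = Id (Mod C) N" "\<beta> \<cdot>\<^bsub>Mod C\<^esub> \<beta>' = Id (Mod C) N'"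
    "\<alpha>' \<in> Hom (Mod C) M' M" "\<alpha>' \<cdot>\<^bsub>Mod C\<^esub> \<alpha> = Id (Mod C) M" "\<alpha> \<cdot>\<^bsub>Mod C\<^esub> \<alpha>' = Id (Mod C) M'"
    by (simp_all add: V.is_inverse_Hom[OF \<beta>(1)] V.is_inverse_Hom[OF \<alpha>(1)])
  have "mod_tensor_arr C \<beta>' \<alpha>' \<cdot>\<^bsub>Mod C\<^esub> mod_tensor_arr C \<beta> \<alpha> = Id (Mod C) (mod_tensor C N M)"
    "mod_tensor_arr C \<beta> \<alpha> \<cdot>\<^bsub>Mod C\<^esub> mod_tensor_arr C \<beta>' \<alpha>' = Id (Mod C) (mod_tensor C N' M')"
    using i Mod_HomD[OF \<beta>(1)] Mod_HomD[OF \<alpha>(1)]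
    by (simp_all add: tensor_arr_Id flip: tensor_arr_Comp[OF \<beta>(1) i(1) \<alpha>(1) i(4)] tensor_arr_Comp[OF i(1) \<beta>(1) i(4) \<alpha>(1)])
  then show ?thesis
    using V.is_inverse_Hom[OF tensor_arr_Hom[OF \<beta>(1) \<alpha>(1)]] tensor_arr_Hom[OF i(1,4)] unfolding is_iso_def by blast
qed

text \<open>The case distinction looks at a representative inside a representative, so invariance is
  needed twice: \<open>inner\<close> treats the coend over \<open>D\<close> with \<open>B\<close>
  and \<open>m\<close> fixed, and the coend over \<open>B\<close> is treated afterwards with the
  help of \<open>inner\<close>.\<close>

lemma ev_assoc:
  assumes L: "bimodule L" and N: "bimodule N" and M: "bimodule M" and X: "X \<in> Obj C" and A: "A \<in> Obj C"
    and B: "B \<in> Obj C" and D: "D \<in> Obj C" and m: "m \<in> Fo M (B, A)" and n: "n \<in> Fo N (D, B)" and l: "l \<in> Fo L (X, D)"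
  shows "ev (mod_assoc C L N M) X A (tensor_elt (mod_tensor C L N) M X A B m (tensor_elt L N X B D n l)) =
    tensor_elt L (mod_tensor C N M) X A D (tensor_elt N M D A B m n) l"
proof -
  note LN = tensor_bimodule[OF L N] and NM = tensor_bimodule[OF N M]
  let ?f = "\<lambda>z. case z of At B (Pr m (At D (Pr n l))) \<Rightarrow>
          coend_class C (integrand C L (mod_tensor C N M) X A)
            (At D (Pr (coend_class C (integrand C N M D A) (At B (Pr m n))) l))"
  have f: "?f (At B (Pr m (At D (Pr n l)))) = tensor_elt L (mod_tensor C N M) X A D (tensor_elt N M D A B m n) l" for B m D n l
    by (simp add: tensor_elt_def)
  have inner: "?f (At B (Pr m (tensor_elt L N X B D n l))) = ?f (At B (Pr m (At D (Pr n l))))"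
    if B: "B \<in> Obj C" and D: "D \<in> Obj C" and m: "m \<in> Fo M (B, A)" and n: "n \<in> Fo N (D, B)" and l: "l \<in> Fo L (X, D)" for B D m n l
  proof (rule tensor_elt_eval[where f = "\<lambda>q. ?f (At B (Pr m q))", OF L N X B _ D n l])
    fix D D' h n l assume h: "h \<in> Hom C D D'" and nl: "n \<in> Fo N (D', B)" "l \<in> Fo L (X, D)"
    have d: "D \<in> Obj C" "D' \<in> Obj C" using HomD[OF h] by auto
    have "act (mod_tensor C N M) h (Id C A) (tensor_elt N M D' A B m n) = tensor_elt N M D A B m (act N h (Id C B) n)"
      using act_tensor_elt[OF N M h Id_Hom[OF A] B m nl(1)] act_Id[OF M B A m] by simp
    then show "?f (At B (Pr m (At D (Pr (act N h (Id C B) n) l)))) = ?f (At B (Pr m (At D' (Pr n (act L (Id C X) h l)))))"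
      using tensor_elt_slide[OF L NM X A h tensor_elt_in[OF N M d(2) A B m nl(1)] nl(2)] unfolding f by simp
  qed
  have "ev (mod_assoc C L N M) X A (tensor_elt (mod_tensor C L N) M X A B m (tensor_elt L N X B D n l)) =
     ?f (tensor_elt (mod_tensor C L N) M X A B m (tensor_elt L N X B D n l))"
    unfolding mod_assoc_def by (rule ev_mk_mod_arr[OF X A tensor_elt_in[OF LN M X A B m tensor_elt_in[OF L N X B D n l]]])
  also have "\<dots> = ?f (At B (Pr m (tensor_elt L N X B D n l)))"
  proof (rule tensor_elt_eval[OF LN M X A _ B m tensor_elt_in[OF L N X B D n l]])
    fix B B' h m q assume h: "h \<in> Hom C B B'" and m: "m \<in> Fo M (B', A)" and q: "q \<in> Fo (mod_tensor C L N) (X, B)"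
    have b: "B \<in> Obj C" "B' \<in> Obj C" using HomD[OF h] by auto
    from q obtain D n l where q: "q = At D (Pr n l)" "q = tensor_elt L N X B D n l" "D \<in> Obj C" "n \<in> Fo N (D, B)" "l \<in> Fo L (X, D)"
      by (rule tensorE[OF L N X b(1)])
    \<comment> \<open>The action on \<open>q\<close> produces a class with an unknown
      representative; \<open>inner\<close> evaluates the case distinction on it all the
      same.\<close>
    have "act (mod_tensor C L N) (Id C X) h q = tensor_elt L N X B' D (act N (Id C D) h n) l"
      using act_tensor_elt[OF L N Id_Hom[OF X] h q(3-5)] act_Id[OF L X q(3,5)] q(2) by simp
    then have "?f (At B' (Pr m (act (mod_tensor C L N) (Id C X) h q))) = ?f (At B' (Pr m (At D (Pr (act N (Id C D) h n) l))))"
      using inner[OF b(2) q(3) m act_in[OF N Id_Hom[OF q(3)] h q(4)] q(5)] by simp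
    also have "\<dots> = ?f (At B (Pr (act M h (Id C A) m) (At D (Pr n l))))"
      unfolding f using tensor_elt_slide[OF N M q(3) A h m q(4)] by simp
    finally show "?f (At B (Pr (act M h (Id C A) m) q)) = ?f (At B' (Pr m (act (mod_tensor C L N) (Id C X) h q)))"
      unfolding q(1) ..
  qed
  also have "\<dots> = tensor_elt L (mod_tensor C N M) X A D (tensor_elt N M D A B m n) l"
    unfolding inner[OF B D m n l] f ..
  finally show ?thesis .
qed

lemma fst_assoc: "X \<in> Obj C \<Longrightarrow> A \<in> Obj C \<Longrightarrow>
    fst (component (mod_assoc C L N M) (X, A)) = Fo (mod_tensor C (mod_tensor C L N) M) (X, A)"
  unfolding mod_assoc_def by (rule fst_component_mk_mod_arr)

lemma Fo_mod_hom: "X \<in> Obj C \<Longrightarrow> A \<in> Obj C \<Longrightarrow> Fo (mod_hom C) (X, A) = Mor ` Hom C X A"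
  by (simp add: mod_hom_def Fo_mk_mod)

lemma act_mod_hom: "h \<in> Hom C X X' \<Longrightarrow> k \<in> Hom C A A' \<Longrightarrow> f \<in> Hom C X' A \<Longrightarrow> act (mod_hom C) h k (Mor f) = Mor (k \<cdot> f \<cdot> h)"
  unfolding mod_hom_def by (subst act_mk_mod) auto

text \<open>Balancing over \<open>B\<close> holds because the action of a composite is the composite
  of the actions. That \<open>mod_hom C\<close> is a bimodule is an assumption here and is supplied
  by \<open>hom_bimodule\<close>.\<close>

lemma ev_lunit:
  assumes H: "bimodule (mod_hom C)" and M: "bimodule M" and X: "X \<in> Obj C" and A: "A \<in> Obj C"
    and m: "m \<in> Fo M (B, A)" and f: "f \<in> Hom C X B"
  shows "ev (mod_lunit C M) X A (tensor_elt (mod_hom C) M X A B m (Mor f)) = act M f (Id C A) m"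
proof -
  have B: "B \<in> Obj C" using HomD[OF f] by simp
  have Mf: "Mor f \<in> Fo (mod_hom C) (X, B)" using f by (simp add: Fo_mod_hom X B)
  let ?f = "\<lambda>z. case z of At B (Pr m (Mor f)) \<Rightarrow> act M f (Id C A) m"
  have "ev (mod_lunit C M) X A (tensor_elt (mod_hom C) M X A B m (Mor f)) = ?f (tensor_elt (mod_hom C) M X A B m (Mor f))"
    unfolding mod_lunit_def by (rule ev_mk_mod_arr[OF X A tensor_elt_in[OF H M X A B m Mf]])
  also have "\<dots> = ?f (At B (Pr m (Mor f)))"
  proof (rule tensor_elt_eval[OF H M X A _ B m Mf])
    fix B B' h m q assume h: "h \<in> Hom C B B'" and m: "m \<in> Fo M (B', A)" and q: "q \<in> Fo (mod_hom C) (X, B)"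
    obtain g where g: "q = Mor g" "g \<in> Hom C X B"
      using q HomD[OF h] by (auto simp: Fo_mod_hom X)
    have "act (mod_hom C) (Id C X) h q = Mor (h \<cdot> g)"
      using act_mod_hom[OF Id_Hom[OF X] h g(2)] Comp_Id[OF g(2)] by (simp add: g(1))
    then show "?f (At B (Pr (act M h (Id C A) m) q)) = ?f (At B' (Pr m (act (mod_hom C) (Id C X) h q)))"
      using act_Comp[OF M g(2) h Id_Hom[OF A] Id_Hom[OF A] m] Comp_Id[OF Id_Hom[OF A]] by (simp add: g(1))
  qed
  finally show ?thesis by simp
qed

end

section \<open>The modules of the embedding and their duals\<close>

context strict_monoidal_category
begin

lemma Fo_Ups_ob: "Z \<in> Obj C \<Longrightarrow> Y \<in> Obj C \<Longrightarrow> Fo (Ups_ob C X) (Z, Y) = Mor ` Hom C Z (X \<otimes> Y)"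
  by (simp add: Ups_ob_def Fo_mk_mod)

lemma act_Ups_ob:
  "h \<in> Hom C Z Z' \<Longrightarrow> k \<in> Hom C Y Y' \<Longrightarrow> f \<in> Hom C Z' (X \<otimes> Y) \<Longrightarrow>
    act (Ups_ob C X) h k (Mor f) = Mor ((Id C X \<star> k) \<cdot> f \<cdot> h)"
  unfolding Ups_ob_def by (subst act_mk_mod) auto

lemma act_Ups_ob_left:
  assumes "h \<in> Hom C Z Z'" "Y \<in> Obj C" "X \<in> Obj C" "f \<in> Hom C Z' (X \<otimes> Y)"
  shows "act (Ups_ob C X) h (Id C Y) (Mor f) = Mor (f \<cdot> h)"
  using act_Ups_ob[OF assms(1) Id_Hom[OF assms(2)] assms(4)] Id_Comp[OF Comp_Hom[OF assms(1,4)]] assms(2,3)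
  by (simp add: tar_Id)

lemma act_Ups_ob_right:
  assumes "k \<in> Hom C Y Y'" "Z \<in> Obj C" "f \<in> Hom C Z (X \<otimes> Y)"
  shows "act (Ups_ob C X) (Id C Z) k (Mor f) = Mor ((Id C X \<star> k) \<cdot> f)"
  using act_Ups_ob[OF Id_Hom[OF assms(2)] assms(1,3)] Comp_Id[OF assms(3)] by simp

lemma Fo_Ups_dual: "Z \<in> Obj C \<Longrightarrow> Y \<in> Obj C \<Longrightarrow> Fo (Ups_dual C X) (Z, Y) = Mor ` Hom C (X \<otimes> Z) Y"
  by (simp add: Ups_dual_def Fo_mk_mod)

lemma act_Ups_dual:
  "h \<in> Hom C Z Z' \<Longrightarrow> k \<in> Hom C Y Y' \<Longrightarrow> f \<in> Hom C (X \<otimes> Z') Y \<Longrightarrow>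
    act (Ups_dual C X) h k (Mor f) = Mor (k \<cdot> f \<cdot> (Id C X \<star> h))"
  unfolding Ups_dual_def by (subst act_mk_mod) auto

lemma act_Ups_dual_left:
  assumes "h \<in> Hom C Z Z'" "Y \<in> Obj C" "X \<in> Obj C" "f \<in> Hom C (X \<otimes> Z') Y"
  shows "act (Ups_dual C X) h (Id C Y) (Mor f) = Mor (f \<cdot> (Id C X \<star> h))"
  using act_Ups_dual[OF assms(1) Id_Hom[OF assms(2)] assms(4)] 
    Id_Comp[OF Comp_Hom[OF tar_Hom[OF Id_Hom[OF assms(3)] assms(1)] assms(4)]]
  by simp

lemma act_Ups_dual_right:
  assumes "k \<in> Hom C Y Y'" "Z \<in> Obj C" "X \<in> Obj C" "f \<in> Hom C (X \<otimes> Z) Y"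
  shows "act (Ups_dual C X) (Id C Z) k (Mor f) = Mor (k \<cdot> f)"
  using act_Ups_dual[OF Id_Hom[OF assms(2)] assms(1,4)] Comp_Id[OF assms(4)] assms(2,3) by (simp add: tar_Id)

text \<open>The value is a composite through \<open>X \<otimes> B\<close>, and moving
  \<open>h\<close> across the coend is functoriality of \<open>X \<otimes> -\<close> with
  associativity.\<close>

lemma ev_Ups_mult:
  assumes U: "bimodule (Ups_ob C X)" "bimodule (Ups_ob C Y)" and o: "X \<in> Obj C" "Y \<in> Obj C" "Z \<in> Obj C" "A \<in> Obj C" "B \<in> Obj C"
    and g: "g \<in> Hom C B (Y \<otimes> A)" and f: "f \<in> Hom C Z (X \<otimes> B)"
  shows "ev (Ups_mult C X Y) Z A (tensor_elt (Ups_ob C X) (Ups_ob C Y) Z A B (Mor g) (Mor f)) = Mor ((Id C X \<star> g) \<cdot> f)"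
proof -
  let ?f = "\<lambda>z. case z of At B (Pr (Mor g) (Mor f)) \<Rightarrow> Mor ((Id C X \<star> g) \<cdot> f)"
  have m: "Mor g \<in> Fo (Ups_ob C Y) (B, A)" "Mor f \<in> Fo (Ups_ob C X) (Z, B)"
    using g f o by (simp_all add: Fo_Ups_ob)
  have "ev (Ups_mult C X Y) Z A (tensor_elt (Ups_ob C X) (Ups_ob C Y) Z A B (Mor g) (Mor f)) =
    ?f (tensor_elt (Ups_ob C X) (Ups_ob C Y) Z A B (Mor g) (Mor f))"
    unfolding Ups_mult_def by (rule ev_mk_mod_arr[OF o(3,4) tensor_elt_in[OF U o(3-5) m]])
  also have "\<dots> = ?f (At B (Pr (Mor g) (Mor f)))"
  proof (rule tensor_elt_eval[OF U o(3,4) _ o(5) m])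
    fix B B' h m n assume h: "h \<in> Hom C B B'" and m: "m \<in> Fo (Ups_ob C Y) (B', A)" and n: "n \<in> Fo (Ups_ob C X) (Z, B)"
    have b: "B \<in> Obj C" "B' \<in> Obj C" using HomD[OF h] by auto
    obtain g f where gf: "m = Mor g" "g \<in> Hom C B' (Y \<otimes> A)" "n = Mor f" "f \<in> Hom C Z (X \<otimes> B)"
      using m n b o by (auto simp: Fo_Ups_ob)
    have "(Id C X \<star> (g \<cdot> h)) \<cdot> f = (Id C X \<star> g) \<cdot> ((Id C X \<star> h) \<cdot> f)"
      using left_Comp[OF o(1) h gf(2)] Comp_assoc[OF gf(4) tar_Hom[OF Id_Hom[OF o(1)] h] tar_Hom[OF Id_Hom[OF o(1)] gf(2)]]
      by simp
    then show "?f (At B (Pr (act (Ups_ob C Y) h (Id C A) m) n)) = ?f (At B' (Pr m (act (Ups_ob C X) (Id C Z) h n)))"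
      by (simp add: gf(1,3) act_Ups_ob_left[OF h o(4,2) gf(2)] act_Ups_ob_right[OF h o(3) gf(4)])
  qed
  finally show ?thesis by simp
qed

lemma fst_Ups_mult: "Z \<in> Obj C \<Longrightarrow> A \<in> Obj C \<Longrightarrow> fst (component (Ups_mult C X Y) (Z, A)) = Fo (mod_tensor C (Ups_ob C X) (Ups_ob C Y)) (Z, A)"
  unfolding Ups_mult_def by (rule fst_component_mk_mod_arr)

lemma ev_Ups_coev:
  assumes "Z \<in> Obj C" "A \<in> Obj C" "f \<in> Hom C Z A"
  shows "ev (Ups_coev C X) Z A (Mor f) =
    tensor_elt (Ups_dual C X) (Ups_ob C X) Z A (X \<otimes> Z) (Mor (Id C X \<star> f)) (Mor (Id C (X \<otimes> Z)))"
proof -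
  have "Mor f \<in> Fo (mod_hom C) (Z, A)"
    using assms by (simp add: Fo_mod_hom)
  then show ?thesis
    unfolding Ups_coev_def by (simp add: ev_mk_mod_arr[OF assms(1,2)] tensor_elt_def)
qed

lemma fst_Ups_coev: "Z \<in> Obj C \<Longrightarrow> A \<in> Obj C \<Longrightarrow> fst (component (Ups_coev C X) (Z, A)) = Fo (mod_hom C) (Z, A)"
  unfolding Ups_coev_def by (rule fst_component_mk_mod_arr)

lemma ev_Ups_arr:
  assumes "u \<in> Hom C X X'" "Z \<in> Obj C" "Y \<in> Obj C" "f \<in> Hom C Z (X \<otimes> Y)"
  shows "ev (Fa (Ups C) u) Z Y (Mor f) = Mor ((u \<star> Id C Y) \<cdot> f)"
    and "fst (component (Fa (Ups C) u) (Z, Y)) = Fo (Ups_ob C X) (Z, Y)"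
  using assms HomD[OF assms(1)] ev_mk_mod_arr[OF assms(2,3), of "Mor f" "Ups_ob C X"]
    fst_component_mk_mod_arr[OF assms(2,3)]
  by (simp_all add: Ups_def Fo_Ups_ob)

end

section \<open>The inverse of the transformation\<close>

locale Gamma_data = adjoined_dual C J
  for C :: "('o, 'm, 'z) smcat_scheme" (structure) and J +
  fixes \<Gamma> :: "('o, 'm) Gamma_functor" and \<phi> \<phi>0 \<theta>
  assumes Gamma: "is_Gamma C J \<Gamma> \<phi> \<phi>0 \<theta>"
begin

section \<open>The monoidal data of \<Gamma>, extracted from its defining property\<close>

abbreviation "V \<equiv> Mod C"
abbreviation "Go \<equiv> Fo \<Gamma>"
abbreviation "Ga \<equiv> Fa \<Gamma>"
abbreviation "Jd \<equiv> Jdual C"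

sublocale V: category V
  by (rule Mod_category)

lemma strong: "strong_monoidal_functor Q V \<Gamma> \<phi> \<phi>0"
  using Gamma by (simp add: is_Gamma_def)

lemma functor_Gamma: "is_functor Q V \<Gamma>"
  using strong by (simp add: strong_monoidal_functor_def)

lemma Go_Jd: "Go Jd = Ups_dual C J"
  using Gamma by (simp add: is_Gamma_def)

lemma Go_bimodule: "U \<in> words C \<Longrightarrow> bimodule (Go U)"
  using functor_Gamma by (simp add: is_functor_def Mod_sel)

lemma Ga_Hom: "w \<in> Hom Q U W \<Longrightarrow> Ga w \<in> Hom V (Go U) (Go W)"
  using functor_Gamma Q_HomD[of w U W] unfolding is_functor_def by metis

lemma Ga_Id: "U \<in> words C \<Longrightarrow> Ga (Id Q U) = Id V (Go U)"
  using functor_Gamma by (simp add: is_functor_def)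

lemma Ga_Comp: "v \<in> Hom Q U W \<Longrightarrow> w \<in> Hom Q W X \<Longrightarrow> Ga (w \<bullet> v) = Ga w \<cdot>\<^bsub>V\<^esub> Ga v"
  using functor_Gamma Q_HomD[of v U W] Q_HomD[of w W X] unfolding is_functor_def by metis

lemma phi_Hom: "U \<in> words C \<Longrightarrow> W \<in> words C \<Longrightarrow> \<phi> U W \<in> Hom V (mod_tensor C (Go U) (Go W)) (Go (wtensor C U W))"
  and phi_iso: "U \<in> words C \<Longrightarrow> W \<in> words C \<Longrightarrow> is_iso V (\<phi> U W)"
  using strong by (simp_all add: strong_monoidal_functor_def Mod_sel)

lemma phi0_Hom: "\<phi>0 \<in> Hom V (mod_hom C) (Go (wunit C))"
  using strong by (simp add: strong_monoidal_functor_def Mod_sel)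

lemma phi_nat:
  assumes "v \<in> Hom Q U W" "v' \<in> Hom Q U' W'"
  shows "Ga (v \<diamondop> v') \<cdot>\<^bsub>V\<^esub> \<phi> U U' = \<phi> W W' \<cdot>\<^bsub>V\<^esub> mod_tensor_arr C (Ga v) (Ga v')"
  using strong Q_HomD[OF assms(1)] Q_HomD[OF assms(2)] unfolding strong_monoidal_functor_def Mod_sel by blast

lemma phi_assoc:
  assumes "T \<in> words C" "U \<in> words C" "W \<in> words C"
  shows "\<phi> (wtensor C T U) W \<cdot>\<^bsub>V\<^esub> mod_tensor_arr C (\<phi> T U) (Id V (Go W)) =
    \<phi> T (wtensor C U W) \<cdot>\<^bsub>V\<^esub> (mod_tensor_arr C (Id V (Go T)) (\<phi> U W) \<cdot>\<^bsub>V\<^esub> mod_assoc C (Go T) (Go U) (Go W))"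
  using strong assms by (simp add: strong_monoidal_functor_def Mod_sel(5-))

lemma phi_unit: "U \<in> words C \<Longrightarrow> \<phi> (wunit C) U \<cdot>\<^bsub>V\<^esub> mod_tensor_arr C \<phi>0 (Id V (Go U)) = mod_lunit C (Go U)"
  using strong by (simp add: strong_monoidal_functor_def Mod_sel(5-))

lemma theta: "monoidal_nat_iso C V (Ups C) (Ups_mult C) (Ups_unit C)
       (comp_functor C \<Gamma> (Omega C J)) (\<lambda>X Y. \<phi> [X] [Y]) \<phi>0 \<theta>"
  using Gamma by (simp add: is_Gamma_def)

lemma theta_Hom: "A \<in> Obj C \<Longrightarrow> \<theta> A \<in> Hom V (Ups_ob C A) (Go [A])"
  and theta_iso: "A \<in> Obj C \<Longrightarrow> is_iso V (\<theta> A)"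
  using theta by (simp_all add: monoidal_nat_iso_def nat_trans_def Ups_def comp_functor_def Fo_Omega)

lemma theta_nat: "u \<in> Hom C A B \<Longrightarrow> Ga (emb u) \<cdot>\<^bsub>V\<^esub> \<theta> A = \<theta> B \<cdot>\<^bsub>V\<^esub> Fa (Ups C) u"
  using theta HomD[of u A B] by (auto simp: monoidal_nat_iso_def nat_trans_def comp_functor_def Fa_Omega)

lemma theta_mult: "X \<in> Obj C \<Longrightarrow> Y \<in> Obj C \<Longrightarrow>
    \<theta> (X \<otimes> Y) \<cdot>\<^bsub>V\<^esub> Ups_mult C X Y = \<phi> [X] [Y] \<cdot>\<^bsub>V\<^esub> mod_tensor_arr C (\<theta> X) (\<theta> Y)"
  using theta by (simp add: monoidal_nat_iso_def Mod_sel(5-))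

lemma Gamma_eta: "Ga (edge_class C J Eta) \<cdot>\<^bsub>V\<^esub> \<phi>0 =
    \<phi> Jd [J] \<cdot>\<^bsub>V\<^esub> (mod_tensor_arr C (Id V (Ups_dual C J)) (\<theta> J) \<cdot>\<^bsub>V\<^esub> Ups_coev C J)"
  using Gamma by (simp add: is_Gamma_def Mod_sel(5-))

text \<open>An arrow of \<open>Mod C\<close> has functors as source and target, so the module laws
  are contained in the typing of \<open>\<theta>\<close>. In the same way
  \<open>dual_bimodule\<close> comes from the value of \<open>\<Gamma>\<close> at \<open>Jd\<close>
  and \<open>hom_bimodule\<close> from the source of \<open>\<phi>0\<close>.\<close>

lemma Ups_bimodule: "A \<in> Obj C \<Longrightarrow> bimodule (Ups_ob C A)"
  using Mod_HomD[OF theta_Hom] by blast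

lemma dual_bimodule: "bimodule (Ups_dual C J)"
  using Go_bimodule[OF Jdual_words] by (simp add: Go_Jd)

lemma hom_bimodule: "bimodule (mod_hom C)"
  using Mod_HomD[OF phi0_Hom] by blast

text \<open>The identity of \<open>A\<close> is an element of \<open>Ups_ob C A\<close> at
  \<open>(A, \<one>)\<close> because \<open>A \<otimes> \<one> = A\<close> strictly. Its image is
  the Yoneda element from which \<open>transport\<close> is built.\<close>

definition base_point :: "'o \<Rightarrow> ('o, 'm) elt" where
  "base_point A = ev (\<theta> A) A \<one> (Mor (Id C A))"

definition transport :: "'o \<Rightarrow> ('o, 'm) path set \<Rightarrow> ('o, 'm) elt" where
  "transport A w = ev (Ga w) A \<one> (base_point A)"

lemma Mor_Ups_unit: "f \<in> Hom C A X \<Longrightarrow> Mor f \<in> Fo (Ups_ob C X) (A, \<one>)"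
  using HomD[of f A X] by (simp add: Fo_Ups_ob unit_Obj tob_unit)

lemma base_point_in: "A \<in> Obj C \<Longrightarrow> base_point A \<in> Fo (Go [A]) (A, \<one>)"
  unfolding base_point_def by (intro ev_in[OF theta_Hom] unit_Obj Mor_Ups_unit Id_Hom)

lemma transport_in:
  assumes "w \<in> Hom Q [A] W"
  shows "transport A w \<in> Fo (Go W) (A, \<one>)"
proof -
  have "A \<in> Obj C"
    using Q_HomD[OF assms] by (simp add: words_def)
  then show ?thesis
    unfolding transport_def by (intro ev_in[OF Ga_Hom[OF assms]] unit_Obj base_point_in)
qed

lemma transport_post:
  assumes "w \<in> Hom Q [A] W" "v \<in> Hom Q W X"
  shows "transport A (v \<bullet> w) = ev (Ga v) A \<one> (transport A w)"
proof -
  have "A \<in> Obj C"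
    using Q_HomD[OF assms(1)] by (simp add: words_def)
  then show ?thesis
    unfolding transport_def Ga_Comp[OF assms] by (intro ev_Comp[OF Ga_Hom[OF assms(1)]] unit_Obj base_point_in)
qed

lemma theta_base_point:
  assumes "f \<in> Hom C A B"
  shows "act (Go [B]) f (Id C \<one>) (base_point B) = ev (\<theta> B) A \<one> (Mor f)"
proof -
  have B: "B \<in> Obj C" using HomD[OF assms] by simp
  have "act (Ups_ob C B) f (Id C \<one>) (Mor (Id C B)) = Mor f"
    using act_Ups_ob_left[OF assms unit_Obj B, of "Id C B"] Id_Hom[OF B] Id_Comp[OF assms] B by (simp add: tob_unit)
  then show ?thesis
    unfolding base_point_def using ev_nat[OF theta_Hom[OF B] assms Id_Hom[OF unit_Obj] Mor_Ups_unit[OF Id_Hom[OF B]]] by simp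
qed

lemma transport_om:
  assumes "f \<in> Hom C A B"
  shows "transport A (emb f) = ev (\<theta> B) A \<one> (Mor f)"
proof -
  have o: "A \<in> Obj C" "B \<in> Obj C" using HomD[OF assms] by auto
  note m = Mor_Ups_unit[OF Id_Hom[OF o(1)]]
  have i: "Id C A \<in> Hom C A (A \<otimes> \<one>)" using Id_Hom[OF o(1)] o by (simp add: tob_unit)
  have "transport A (emb f) = ev (Ga (emb f) \<cdot>\<^bsub>V\<^esub> \<theta> A) A \<one> (Mor (Id C A))"
    unfolding transport_def base_point_def by (rule ev_Comp[OF theta_Hom[OF o(1)] o(1) unit_Obj m, symmetric])
  also have "\<dots> = ev (\<theta> B) A \<one> (ev (Fa (Ups C) f) A \<one> (Mor (Id C A)))"
    unfolding theta_nat[OF assms] using m 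
    by (intro ev_Comp' o unit_Obj) (simp add: ev_Ups_arr(2)[OF assms o(1) unit_Obj i])
  also have "ev (Fa (Ups C) f) A \<one> (Mor (Id C A)) = Mor f"
    using ev_Ups_arr(1)[OF assms o(1) unit_Obj i] Comp_Id[OF assms] HomD[OF assms] by (simp add: tar_unit)
  finally show ?thesis .
qed

text \<open>Naturality in the source: pushing the base point of \<open>A'\<close> forward along
  \<open>h\<close> and pulling the base point of \<open>A\<close> back along \<open>h\<close> both
  give the image of \<open>h\<close> under \<open>\<theta> A\<close>.\<close>

lemma transport_pre:
  assumes "w \<in> Hom Q [A] W" "h \<in> Hom C A' A"
  shows "transport A' (w \<bullet> emb h) = act (Go W) h (Id C \<one>) (transport A w)"
proof -
  have A: "A \<in> Obj C" using HomD[OF assms(2)] by simp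
  show ?thesis
    unfolding transport_post[OF emb_Hom[OF assms(2)] assms(1)] transport_om[OF assms(2)] theta_base_point[OF assms(2), symmetric]
    unfolding transport_def by (rule ev_nat[OF Ga_Hom[OF assms(1)] assms(2) Id_Hom[OF unit_Obj] base_point_in[OF A]])
qed

text \<open>Monoidality of \<theta>, evaluated at the pair of the identity of \<open>B\<close> and
  \<open>f\<close>, which \<open>Ups_mult\<close> composes to \<open>f\<close>.\<close>

lemma phi_theta:
  assumes f: "f \<in> Hom C A (X \<otimes> B)" and X: "X \<in> Obj C" and B: "B \<in> Obj C"
  shows "ev (\<phi> [X] [B]) A \<one> (tensor_elt (Go [X]) (Go [B]) A \<one> B (base_point B) (ev (\<theta> X) A B (Mor f))) = ev (\<theta> (X \<otimes> B)) A \<one> (Mor f)"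
proof -
  have A: "A \<in> Obj C" using HomD[OF f] by simp
  note UX = Ups_bimodule[OF X] and UB = Ups_bimodule[OF B]
  note mB = Mor_Ups_unit[OF Id_Hom[OF B]]
  have mf: "Mor f \<in> Fo (Ups_ob C X) (A, B)"
    using f by (simp add: Fo_Ups_ob A B)
  let ?t = "tensor_elt (Ups_ob C X) (Ups_ob C B) A \<one> B (Mor (Id C B)) (Mor f)"
  have t: "?t \<in> Fo (mod_tensor C (Ups_ob C X) (Ups_ob C B)) (A, \<one>)"
    by (rule tensor_elt_in[OF UX UB A unit_Obj B mB mf])
  have "ev (\<phi> [X] [B]) A \<one> (tensor_elt (Go [X]) (Go [B]) A \<one> B (base_point B) (ev (\<theta> X) A B (Mor f))) =
    ev (\<phi> [X] [B]) A \<one> (ev (mod_tensor_arr C (\<theta> X) (\<theta> B)) A \<one> ?t)"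
    unfolding ev_tensor_arr[OF theta_Hom[OF X] theta_Hom[OF B] A unit_Obj B mB mf] base_point_def ..
  also have "\<dots> = ev (\<theta> (X \<otimes> B) \<cdot>\<^bsub>V\<^esub> Ups_mult C X B) A \<one> ?t"
    unfolding theta_mult[OF X B] 
    by (rule ev_Comp[OF tensor_arr_Hom[OF theta_Hom[OF X] theta_Hom[OF B]] A unit_Obj t, symmetric])
  also have "\<dots> = ev (\<theta> (X \<otimes> B)) A \<one> (ev (Ups_mult C X B) A \<one> ?t)"
    using t by (intro ev_Comp' A unit_Obj) (simp add: fst_Ups_mult[OF A unit_Obj])
  also have "ev (Ups_mult C X B) A \<one> ?t = Mor f"
    using ev_Ups_mult[OF UX UB X B A unit_Obj B _ f, of "Id C B"] Id_Hom[OF B] Id_Comp[OF f] X B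
    by (simp add: tob_unit tar_Id)
  finally show ?thesis .
qed

text \<open>Naturality of \<phi> carries \<open>d\<close> into the tensor class, where it acts on
  the base point of \<open>B\<close>; what precedes this is \<open>phi_theta\<close>.\<close>

lemma transport_tensor:
  assumes d: "d \<in> Hom Q [B] W" and f: "f \<in> Hom C A (X \<otimes> B)" and X: "X \<in> Obj C"
  shows "transport A ((Id Q [X] \<diamondop> d) \<bullet> emb f) =
    ev (\<phi> [X] W) A \<one> (tensor_elt (Go [X]) (Go W) A \<one> B (transport B d) (ev (\<theta> X) A B (Mor f)))"
proof -
  have o: "A \<in> Obj C" "B \<in> Obj C" "W \<in> words C" "[X] \<in> words C" "[B] \<in> words C"
    using HomD[OF f] Q_HomD[OF d] X by (auto simp: words_def)
  note i = Q.Id_Hom[of "[X]", unfolded Q_simps, OF o(4)]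
  note id = Q.tar_Hom[OF i d, unfolded Q_simps single_wtensor_single]
  have mf: "Mor f \<in> Fo (Ups_ob C X) (A, B)"
    using f by (simp add: Fo_Ups_ob o)
  note tf = ev_in[OF theta_Hom[OF X] o(1,2) mf]
  let ?t = "tensor_elt (Go [X]) (Go [B]) A \<one> B (base_point B) (ev (\<theta> X) A B (Mor f))"
  have t: "?t \<in> Fo (mod_tensor C (Go [X]) (Go [B])) (A, \<one>)"
    by (rule tensor_elt_in[OF Go_bimodule[OF o(4)] Go_bimodule[OF o(5)] o(1) unit_Obj o(2) base_point_in[OF o(2)] tf])
  have "transport A ((Id Q [X] \<diamondop> d) \<bullet> emb f) = ev (Ga (Id Q [X] \<diamondop> d)) A \<one> (ev (\<phi> [X] [B]) A \<one> ?t)"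
    unfolding transport_post[OF emb_Hom[OF f] id] transport_om[OF f] phi_theta[OF f X o(2)] ..
  also have "\<dots> = ev (\<phi> [X] W \<cdot>\<^bsub>V\<^esub> mod_tensor_arr C (Ga (Id Q [X])) (Ga d)) A \<one> ?t"
    unfolding phi_nat[OF i d, symmetric] by (rule ev_Comp[OF phi_Hom[OF o(4,5)] o(1) unit_Obj t, symmetric])
  also have "\<dots> = ev (\<phi> [X] W) A \<one> (ev (mod_tensor_arr C (Ga (Id Q [X])) (Ga d)) A \<one> ?t)"
    by (rule ev_Comp[OF tensor_arr_Hom[OF Ga_Hom[OF i] Ga_Hom[OF d]] o(1) unit_Obj t])
  also have "ev (mod_tensor_arr C (Ga (Id Q [X])) (Ga d)) A \<one> ?t = tensor_elt (Go [X]) (Go W) A \<one> B (transport B d) (ev (\<theta> X) A B (Mor f))"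
    unfolding ev_tensor_arr[OF Ga_Hom[OF i] Ga_Hom[OF d] o(1) unit_Obj o(2) base_point_in[OF o(2)] tf]
    by (simp add: transport_def Ga_Id[OF o(4)] ev_Id[OF o(1,2) tf])
  finally show ?thesis .
qed

text \<open>This is where \<open>\<Gamma>\<eta>\<close>, the coherence of \<open>\<phi>\<close> and the monoidality of \<open>\<theta>\<close> enter.\<close>

lemma transport_eta:
  assumes B: "B \<in> Obj C"
  shows "transport B (edge_class C J Eta \<diamondop> Id Q [B]) =
    ev (\<phi> Jd [J \<otimes> B]) B \<one> (tensor_elt (Go Jd) (Go [J \<otimes> B]) B \<one> (J \<otimes> B) (base_point (J \<otimes> B)) (Mor (Id C (J \<otimes> B))))"
proof -
  have JB: "J \<otimes> B \<in> Obj C" using B by (simp add: tob_Obj J_Obj)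
  note w = single_words[OF B] single_words[OF J_Obj] single_words[OF JB] wunit_words Jdual_words
    wtensor_words[OF Jdual_words single_words[OF J_Obj]]
  note g = Go_bimodule[OF w(1)] Go_bimodule[OF w(2)] Go_bimodule[OF w(3)] Go_bimodule[OF w(4)] Go_bimodule[OF w(5)] Go_bimodule[OF w(6)]
  note e = edge_class_Hom[of Eta, simplified]
  note iB = Q.Id_Hom[of "[B]", unfolded Q_simps, OF w(1)]
  note p = base_point_in[OF B]
  have mI: "Mor (Id C B) \<in> Fo (mod_hom C) (B, B)"
    using Id_Hom[OF B] by (simp add: Fo_mod_hom B)
  note u0 = ev_in[OF phi0_Hom B B mI]
  note VB = Mod_Id_Hom[OF g(1)]
  let ?t0 = "tensor_elt (Go (wunit C)) (Go [B]) B \<one> B (base_point B) (ev \<phi>0 B B (Mor (Id C B)))"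
  let ?q = "tensor_elt (Go Jd) (Go [J]) B B (J \<otimes> B) (ev (\<theta> J) (J \<otimes> B) B (Mor (Id C (J \<otimes> B)))) (Mor (Id C (J \<otimes> B)))"
  have t0: "?t0 \<in> Fo (mod_tensor C (Go (wunit C)) (Go [B])) (B, \<one>)"
    by (rule tensor_elt_in[OF g(4,1) B unit_Obj B p u0])
  \<comment> \<open>Left unit coherence of \<phi> inserts a unit factor into the base point, so that
    naturality of \<phi> can be applied to \<open>\<eta>\<close> tensored with an identity.\<close>
  have s1: "base_point B = ev (\<phi> (wunit C) [B]) B \<one> ?t0"
  proof -
    let ?s = "tensor_elt (mod_hom C) (Go [B]) B \<one> B (base_point B) (Mor (Id C B))"
    have s: "?s \<in> Fo (mod_tensor C (mod_hom C) (Go [B])) (B, \<one>)"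
      by (rule tensor_elt_in[OF hom_bimodule g(1) B unit_Obj B p mI])
    have "base_point B = ev (mod_lunit C (Go [B])) B \<one> ?s"
      unfolding ev_lunit[OF hom_bimodule g(1) B unit_Obj p Id_Hom[OF B]] by (rule act_Id[OF g(1) B unit_Obj p, symmetric])
    also have "\<dots> = ev (\<phi> (wunit C) [B]) B \<one> (ev (mod_tensor_arr C \<phi>0 (Id V (Go [B]))) B \<one> ?s)"
      unfolding phi_unit[OF w(1), symmetric] by (rule ev_Comp[OF tensor_arr_Hom[OF phi0_Hom VB] B unit_Obj s])
    also have "ev (mod_tensor_arr C \<phi>0 (Id V (Go [B]))) B \<one> ?s = ?t0"
      unfolding ev_tensor_arr[OF phi0_Hom VB B unit_Obj B p mI] by (simp add: ev_Id[OF B unit_Obj p])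
    finally show ?thesis .
  qed
  have mJ: "Mor (Id C (J \<otimes> B)) \<in> Fo (Ups_ob C J) (J \<otimes> B, B)" "Mor (Id C (J \<otimes> B)) \<in> Fo (Ups_dual C J) (B, J \<otimes> B)"
    using Id_Hom[OF JB] by (simp_all add: Fo_Ups_ob Fo_Ups_dual JB B)
  note tJ = ev_in[OF theta_Hom[OF J_Obj] JB B mJ(1)]
  have q: "?q \<in> Fo (mod_tensor C (Go Jd) (Go [J])) (B, B)"
    by (rule tensor_elt_in[OF g(5,2) B B JB tJ]) (simp add: Go_Jd mJ)
  \<comment> \<open>The value of \<open>\<Gamma>\<eta>\<close> at the identity of \<open>B\<close>:
    the coevaluation gives two identities of \<open>J \<otimes> B\<close>, of which the one in
    \<open>Ups_ob C J\<close> is sent through \<open>\<theta> J\<close>.\<close>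
  have s3: "ev (Ga (edge_class C J Eta)) B B (ev \<phi>0 B B (Mor (Id C B))) = ev (\<phi> Jd [J]) B B ?q"
  proof -
    note H = tensor_arr_Hom[OF Mod_Id_Hom[OF dual_bimodule] theta_Hom[OF J_Obj]]
    let ?s = "tensor_elt (Ups_dual C J) (Ups_ob C J) B B (J \<otimes> B) (Mor (Id C (J \<otimes> B))) (Mor (Id C (J \<otimes> B)))"
    have c: "ev (Ups_coev C J) B B (Mor (Id C B)) = ?s"
      using ev_Ups_coev[OF B B Id_Hom[OF B], of J] by (simp add: tar_Id J_Obj B)
    have s: "?s \<in> Fo (mod_tensor C (Ups_dual C J) (Ups_ob C J)) (B, B)"
      by (rule tensor_elt_in[OF dual_bimodule Ups_bimodule[OF J_Obj] B B JB mJ])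
    have a: "ev (mod_tensor_arr C (Id V (Ups_dual C J)) (\<theta> J)) B B ?s = ?q"
      unfolding ev_tensor_arr[OF Mod_Id_Hom[OF dual_bimodule] theta_Hom[OF J_Obj] B B JB mJ] Go_Jd
      by (simp add: ev_Id[OF B JB mJ(2)])
    have "ev (Ga (edge_class C J Eta)) B B (ev \<phi>0 B B (Mor (Id C B))) = ev (Ga (edge_class C J Eta) \<cdot>\<^bsub>V\<^esub> \<phi>0) B B (Mor (Id C B))"
      by (rule ev_Comp[OF phi0_Hom B B mI, symmetric])
    also have "\<dots> = ev (\<phi> Jd [J]) B B (ev (mod_tensor_arr C (Id V (Ups_dual C J)) (\<theta> J) \<cdot>\<^bsub>V\<^esub> Ups_coev C J) B B (Mor (Id C B)))"
    proof -
      \<comment> \<open>The composite is evaluated by \<open>ev_Comp'\<close>, so its source set is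
        read off by unfolding both arrows.\<close>
      have "fst (component (mod_tensor_arr C (Id V (Ups_dual C J)) (\<theta> J) \<cdot>\<^bsub>V\<^esub> Ups_coev C J) (B, B)) = Fo (mod_hom C) (B, B)"
        using fst_Ups_coev[OF B B, of J] B 
        by (cases "mod_tensor_arr C (Id V (Ups_dual C J)) (\<theta> J)"; cases "Ups_coev C J";
            cases "fst (snd (mod_tensor_arr C (Id V (Ups_dual C J)) (\<theta> J))) (B, B)"; cases "fst (snd (Ups_coev C J)) (B, B)")
          (auto simp: Mod_sel functor_Comp component_def bi_cat_sel set_cat_Comp)
      then show ?thesis
        unfolding Gamma_eta using mI by (intro ev_Comp' B) simp
    qed
    also have "ev (mod_tensor_arr C (Id V (Ups_dual C J)) (\<theta> J) \<cdot>\<^bsub>V\<^esub> Ups_coev C J) B B (Mor (Id C B)) = ?q"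
      unfolding a[symmetric] c[symmetric] using mI by (intro ev_Comp' B) (simp add: fst_Ups_coev[OF B B])
    finally show ?thesis .
  qed
  note e' = Q.tar_Hom[OF e iB, unfolded Q_simps wunit_wtensor[OF w(1)]]
  have "transport B (edge_class C J Eta \<diamondop> Id Q [B]) = ev (Ga (edge_class C J Eta \<diamondop> Id Q [B]) \<cdot>\<^bsub>V\<^esub> \<phi> (wunit C) [B]) B \<one> ?t0"
    unfolding transport_def s1[THEN arg_cong[of _ _ "ev (Ga (edge_class C J Eta \<diamondop> Id Q [B])) B \<one>"]]
    by (rule ev_Comp[OF phi_Hom[OF w(4,1)] B unit_Obj t0, symmetric])
  also have "\<dots> = ev (\<phi> (wtensor C Jd [J]) [B]) B \<one> (ev (mod_tensor_arr C (Ga (edge_class C J Eta)) (Ga (Id Q [B]))) B \<one> ?t0)"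
    unfolding phi_nat[OF e iB] by (rule ev_Comp[OF tensor_arr_Hom[OF Ga_Hom[OF e] Ga_Hom[OF iB]] B unit_Obj t0])
  also have "ev (mod_tensor_arr C (Ga (edge_class C J Eta)) (Ga (Id Q [B]))) B \<one> ?t0 =
      tensor_elt (Go (wtensor C Jd [J])) (Go [B]) B \<one> B (base_point B) (ev (\<phi> Jd [J]) B B ?q)"
    unfolding ev_tensor_arr[OF Ga_Hom[OF e] Ga_Hom[OF iB] B unit_Obj B p u0] s3
    by (simp add: Ga_Id[OF w(1)] ev_Id[OF B unit_Obj p])
  also have "\<dots> = ev (mod_tensor_arr C (\<phi> Jd [J]) (Id V (Go [B]))) B \<one> (tensor_elt (mod_tensor C (Go Jd) (Go [J])) (Go [B]) B \<one> B (base_point B) ?q)"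
    unfolding ev_tensor_arr[OF phi_Hom[OF w(5,2)] VB B unit_Obj B p q] by (simp add: ev_Id[OF B unit_Obj p])
  \<comment> \<open>Associativity coherence of \<phi> moves the bracket from \<open>Jd\<close> and
    \<open>J\<close> to \<open>J\<close> and \<open>B\<close>, which brings the \<theta>-part next
    to the base point of \<open>B\<close>.\<close>
  also have "ev (\<phi> (wtensor C Jd [J]) [B]) B \<one> \<dots> =
      ev (\<phi> Jd [J \<otimes> B] \<cdot>\<^bsub>V\<^esub> (mod_tensor_arr C (Id V (Go Jd)) (\<phi> [J] [B]) \<cdot>\<^bsub>V\<^esub> mod_assoc C (Go Jd) (Go [J]) (Go [B]))) B \<one>
        (tensor_elt (mod_tensor C (Go Jd) (Go [J])) (Go [B]) B \<one> B (base_point B) ?q)"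
    unfolding phi_assoc[OF w(5,2,1), symmetric, unfolded single_wtensor_single]
    by (rule ev_Comp[OF tensor_arr_Hom[OF phi_Hom[OF w(5,2)] VB] B unit_Obj 
          tensor_elt_in[OF tensor_bimodule[OF g(5,2)] g(1) B unit_Obj B p q], symmetric])
  also have "\<dots> = ev (\<phi> Jd [J \<otimes> B]) B \<one> (ev (mod_tensor_arr C (Id V (Go Jd)) (\<phi> [J] [B])) B \<one>
      (ev (mod_assoc C (Go Jd) (Go [J]) (Go [B])) B \<one> (tensor_elt (mod_tensor C (Go Jd) (Go [J])) (Go [B]) B \<one> B (base_point B) ?q)))"
  proof -
    let ?s = "tensor_elt (mod_tensor C (Go Jd) (Go [J])) (Go [B]) B \<one> B (base_point B) ?q"
      and ?l = "mod_tensor_arr C (Id V (Go Jd)) (\<phi> [J] [B])" and ?a = "mod_assoc C (Go Jd) (Go [J]) (Go [B])"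
    have s: "?s \<in> fst (component ?a (B, \<one>))"
      unfolding fst_assoc[OF B unit_Obj] by (rule tensor_elt_in[OF tensor_bimodule[OF g(5,2)] g(1) B unit_Obj B p q])
    have "fst (component (?l \<cdot>\<^bsub>V\<^esub> ?a) (B, \<one>)) = fst (component ?a (B, \<one>))"
      using B unit_Obj
      by (cases ?l; cases ?a; cases "fst (snd ?l) (B, \<one>)"; cases "fst (snd ?a) (B, \<one>)")
          (auto simp: Mod_sel functor_Comp component_def bi_cat_sel set_cat_Comp)
    then show ?thesis
      using s by (simp add: ev_Comp'[OF B unit_Obj])
  qed
  also have "ev (mod_assoc C (Go Jd) (Go [J]) (Go [B])) B \<one> (tensor_elt (mod_tensor C (Go Jd) (Go [J])) (Go [B]) B \<one> B (base_point B) ?q) =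
      tensor_elt (Go Jd) (mod_tensor C (Go [J]) (Go [B])) B \<one> (J \<otimes> B)
        (tensor_elt (Go [J]) (Go [B]) (J \<otimes> B) \<one> B (base_point B) (ev (\<theta> J) (J \<otimes> B) B (Mor (Id C (J \<otimes> B))))) (Mor (Id C (J \<otimes> B)))"
    by (rule ev_assoc[OF g(5,2,1) B unit_Obj B JB p tJ]) (simp add: Go_Jd mJ)
  \<comment> \<open>\<open>phi_theta\<close> at the identity of \<open>J \<otimes> B\<close> fuses
    these two into the base point of \<open>J \<otimes> B\<close>.\<close>
  also have "ev (mod_tensor_arr C (Id V (Go Jd)) (\<phi> [J] [B])) B \<one> \<dots> =
      tensor_elt (Go Jd) (Go [J \<otimes> B]) B \<one> (J \<otimes> B) (base_point (J \<otimes> B)) (Mor (Id C (J \<otimes> B)))"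
  proof -
    have m: "Mor (Id C (J \<otimes> B)) \<in> Fo (Go Jd) (B, J \<otimes> B)" by (simp add: Go_Jd mJ)
    show ?thesis
      using ev_tensor_arr[OF Mod_Id_Hom[OF g(5)] phi_Hom[OF w(2,1)] B unit_Obj JB tensor_elt_in[OF g(2,1) JB unit_Obj B p tJ] m]
        phi_theta[OF Id_Hom[OF JB] J_Obj B]
      by (simp add: ev_Id[OF B JB m] base_point_def single_wtensor_single)
  qed
  finally show ?thesis .
qed

text \<open>A transpose is \<open>\<eta>\<close> followed by the whiskering of \<open>c\<close> with
  \<open>Jd\<close>; naturality of \<phi> carries \<open>c\<close> to the base point in the formula
  for \<open>\<eta>\<close>.\<close>

lemma transport_mate:
  assumes c: "c \<in> Hom Q [J \<otimes> B] W" and B: "B \<in> Obj C"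
  shows "transport B (Q.mate [B] c) = ev (\<phi> Jd W) B \<one> (tensor_elt (Go Jd) (Go W) B \<one> (J \<otimes> B) (transport (J \<otimes> B) c) (Mor (Id C (J \<otimes> B))))"
proof -
  have JB: "J \<otimes> B \<in> Obj C" using B by (simp add: tob_Obj J_Obj)
  have W: "W \<in> words C" using Q_HomD[OF c] by simp
  note i = Q.Id_Hom[of Jd, unfolded Q_simps, OF Jdual_words]
  note ic = Q.tar_Hom[OF i c, unfolded Q_simps]
  have e: "edge_class C J Eta \<diamondop> Id Q [B] \<in> Hom Q [B] (wtensor C Jd [J \<otimes> B])"
    using Q.unit_right_Hom[of "[B]"] B by (simp add: words_def single_wtensor_single)
  have m: "Mor (Id C (J \<otimes> B)) \<in> Fo (Go Jd) (B, J \<otimes> B)"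
    using Id_Hom[OF JB] by (simp add: Go_Jd Fo_Ups_dual JB B)
  note g = Go_bimodule[OF Jdual_words] Go_bimodule[OF single_words[OF JB]]
  let ?t = "tensor_elt (Go Jd) (Go [J \<otimes> B]) B \<one> (J \<otimes> B) (base_point (J \<otimes> B)) (Mor (Id C (J \<otimes> B)))"
  note t = tensor_elt_in[OF g B unit_Obj JB base_point_in[OF JB] m]
  have "transport B (Q.mate [B] c) = ev (Ga (Id Q Jd \<diamondop> c) \<cdot>\<^bsub>V\<^esub> \<phi> Jd [J \<otimes> B]) B \<one> ?t"
    unfolding Q.mate_def transport_post[OF e ic] transport_eta[OF B]
    by (rule ev_Comp[OF phi_Hom[OF Jdual_words single_words[OF JB]] B unit_Obj t, symmetric])
  also have "\<dots> = ev (\<phi> Jd W) B \<one> (ev (mod_tensor_arr C (Ga (Id Q Jd)) (Ga c)) B \<one> ?t)"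
    unfolding phi_nat[OF i c] by (rule ev_Comp[OF tensor_arr_Hom[OF Ga_Hom[OF i] Ga_Hom[OF c]] B unit_Obj t])
  also have "ev (mod_tensor_arr C (Ga (Id Q Jd)) (Ga c)) B \<one> ?t = tensor_elt (Go Jd) (Go W) B \<one> (J \<otimes> B) (transport (J \<otimes> B) c) (Mor (Id C (J \<otimes> B)))"
    unfolding ev_tensor_arr[OF Ga_Hom[OF i] Ga_Hom[OF c] B unit_Obj JB base_point_in[OF JB] m]
    by (simp add: transport_def Ga_Id[OF Jdual_words] ev_Id[OF B JB m])
  finally show ?thesis .
qed

end

section \<open>The transformation on iterated tensor products\<close>

context Gamma_data
begin

text \<open>The source of \<open>Gamma_iso\<close>, bracketed to the right like the recursion there.
  The value at the empty list is a default, since words are nonempty.\<close>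

fun iterated :: "'o list \<Rightarrow> ('o, 'm) bimod" where
  "iterated [] = mod_hom C"
| "iterated [X] = Ups_ob C X"
| "iterated (X # X' # Ws) = mod_tensor C (Ups_ob C X) (mod_tensor C (Ups_dual C J) (iterated (X' # Ws)))"

lemma iterated_Cons: "W \<noteq> [] \<Longrightarrow> iterated (X # W) = mod_tensor C (Ups_ob C X) (mod_tensor C (Ups_dual C J) (iterated W))"
  by (cases W) auto

lemma iterated_bimodule: "W \<in> words C \<Longrightarrow> bimodule (iterated W)"
  by (induction W rule: words_induct)
    (auto simp: iterated_Cons intro!: Ups_bimodule tensor_bimodule dual_bimodule)

lemma Gamma_iso_Cons: "W \<noteq> [] \<Longrightarrow> Gamma_iso C J \<phi> \<theta> (X # W) =
    \<phi> [X] (wtensor C Jd W) \<cdot>\<^bsub>V\<^esub> mod_tensor_arr C (\<theta> X)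
       (\<phi> Jd W \<cdot>\<^bsub>V\<^esub> mod_tensor_arr C (Id V (Ups_dual C J)) (Gamma_iso C J \<phi> \<theta> W))"
  by (cases W) (auto simp: Mod_sel(6))

lemma Gamma_iso_Hom: "W \<in> words C \<Longrightarrow> Gamma_iso C J \<phi> \<theta> W \<in> Hom V (iterated W) (Go W) \<and> is_iso V (Gamma_iso C J \<phi> \<theta> W)"
proof (induction W rule: words_induct)
  case (single X)
  then show ?case by (simp add: theta_Hom theta_iso)
next
  case (Cons X W)
  note IH = Cons.IH[THEN conjunct1] Cons.IH[THEN conjunct2]
  note I = Mod_Id_Hom[OF dual_bimodule]
  have iI: "is_iso V (Id V (Ups_dual C J))"
    by (rule V.is_iso_Id) (simp add: Mod_sel dual_bimodule)
  note a = tensor_arr_Hom[OF I IH(1)] tensor_arr_is_iso[OF I iI IH]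
  note p = phi_Hom[OF Jdual_words Cons.hyps(2), unfolded Go_Jd] phi_iso[OF Jdual_words Cons.hyps(2)]
  note b = V.Comp_Hom[OF a(1) p(1)] V.is_iso_Comp[OF a(1) p(1) a(2) p(2)]
  note t = theta_Hom[OF Cons.hyps(1)] theta_iso[OF Cons.hyps(1)]
  note c = tensor_arr_Hom[OF t(1) b(1)] tensor_arr_is_iso[OF t b]
  note w = single_words[OF Cons.hyps(1)] wtensor_words[OF Jdual_words Cons.hyps(2)]
  note q = phi_Hom[OF w, unfolded single_wtensor_Jdual[OF Cons.hyps(2,1)]] phi_iso[OF w]
  show ?case
    unfolding Gamma_iso_Cons[OF Cons.hyps(3)] iterated_Cons[OF Cons.hyps(3)]
    using V.Comp_Hom[OF c(1) q(1)] V.is_iso_Comp[OF c(1) q(1) c(2) q(2)] by blast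
qed

text \<open>By \<open>zeta_fun_ev\<close> this is zeta preceded by \<open>Gamma_iso\<close>. It is
  read off the representatives inside \<open>t\<close>, so its values on tensor classes need
  invariance.\<close>

definition tensor_arrow :: "'o list \<Rightarrow> ('o, 'm) elt \<Rightarrow> ('o, 'm) path set" where
  "tensor_arrow W t = chain_arrow W (chain_of C W t)"

text \<open>The intermediate stage: an element of
  \<open>\<Upsilon>\<^sup>\<or>J \<otimes> iterated W\<close> at \<open>(B, \<one>)\<close> gives an
  arrow from \<open>J \<otimes> B\<close> to \<open>W\<close>. It separates the coend over
  \<open>Y\<close> from the coend over \<open>B\<close>.\<close>

definition tail_arrow :: "'o list \<Rightarrow> ('o, 'm) elt \<Rightarrow> ('o, 'm) path set" where
  "tail_arrow W q = (case q of At Y (Pr n (Mor g)) \<Rightarrow> tensor_arrow W n \<bullet> emb g)"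

text \<open>The Yoneda reduction in \<open>chain_of\<close> composes \<open>g\<close> into the first
  arrow of the tail, and by \<open>chains_pre\<close> this precomposes the arrow of the tail with
  \<open>emb g\<close>.\<close>

lemma chain_of_Cons:
  assumes W: "W \<in> words C" and X: "X \<in> Obj C"
    and n: "chain_of C W n \<in> chains C J W Y" and g: "g \<in> Hom C (J \<otimes> B) Y" and f: "f \<in> Hom C A (X \<otimes> B)" and B: "B \<in> Obj C"
  shows "chain_of C (X # W) (At B (Pr (At Y (Pr n (Mor g))) (Mor f))) \<in> chains C J (X # W) A"
    "tensor_arrow (X # W) (At B (Pr (At Y (Pr n (Mor g))) (Mor f))) = (Id Q [X] \<diamondop> Q.mate [B] (tensor_arrow W n \<bullet> emb g)) \<bullet> emb f"
proof -
  have ne: "W \<noteq> []" using W by (simp add: words_def)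
  obtain Ys f' fs where c: "chain_of C W n = (Ys, f' # fs)"
    using n by (rule chains_hdE)
  note p = chains_pre[OF W n[unfolded c] g]
  have "chain_of C (X # W) (At B (Pr (At Y (Pr n (Mor g))) (Mor f))) = (B # Ys, f # (f' \<cdot> g) # fs)"
    using ne c by (cases W) auto
  then show "chain_of C (X # W) (At B (Pr (At Y (Pr n (Mor g))) (Mor f))) \<in> chains C J (X # W) A"
    "tensor_arrow (X # W) (At B (Pr (At Y (Pr n (Mor g))) (Mor f))) = (Id Q [X] \<diamondop> Q.mate [B] (tensor_arrow W n \<bullet> emb g)) \<bullet> emb f"
    using p f B by (simp_all add: tensor_arrow_def chains_Cons[OF ne] chain_arrow_Cons[OF ne] c)
qed

text \<open>The four properties are bundled because invariance on the coends for \<open>X # W\<close> uses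
  naturality in the source for \<open>W\<close>.\<close>

definition tensor_arrow_good :: "'o list \<Rightarrow> bool" where
  "tensor_arrow_good W \<longleftrightarrow>
    (\<forall>A n. A \<in> Obj C \<longrightarrow> n \<in> Fo (iterated W) (A, \<one>) \<longrightarrow> chain_of C W n \<in> chains C J W A) \<and>
    (\<forall>A A' h n. h \<in> Hom C A' A \<longrightarrow> n \<in> Fo (iterated W) (A, \<one>) \<longrightarrow>
      tensor_arrow W (act (iterated W) h (Id C \<one>) n) = tensor_arrow W n \<bullet> emb h) \<and>
    (\<forall>A n. A \<in> Obj C \<longrightarrow> n \<in> Fo (iterated W) (A, \<one>) \<longrightarrow> transport A (tensor_arrow W n) = ev (Gamma_iso C J \<phi> \<theta> W) A \<one> n) \<and>
    (\<forall>A w. A \<in> Obj C \<longrightarrow> w \<in> composites W A \<longrightarrow> (\<exists>n \<in> Fo (iterated W) (A, \<one>). tensor_arrow W n = w))"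

lemma tensor_arrow_good_single:
  assumes X: "X \<in> Obj C"
  shows "tensor_arrow_good [X]"
proof -
  have e: "n \<in> Fo (iterated [X]) (A, \<one>) \<longleftrightarrow> (\<exists>f \<in> Hom C A X. n = Mor f)" if "A \<in> Obj C" for n A
    using that X by (auto simp: Fo_Ups_ob unit_Obj tob_unit)
  have k: "tensor_arrow [X] (Mor f) = emb f" for f
    by (simp add: tensor_arrow_def)
  have a: "act (iterated [X]) h (Id C \<one>) (Mor f) = Mor (f \<cdot> h)" if "h \<in> Hom C A' A" "f \<in> Hom C A X" for h f A A'
    using act_Ups_ob_left[OF that(1) unit_Obj X, of f] that(2) X by (simp add: tob_unit)
  show ?thesis
    unfolding tensor_arrow_good_def
  proof (intro conjI allI impI, goal_cases)
    case (1 A n)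
    then show ?case using e by (auto simp: chains_single)
  next
    case (2 A A' h n)
    then obtain f where f: "n = Mor f" "f \<in> Hom C A X"
      using e[of A n] HomD[of h A' A] by auto
    show ?case
      unfolding f(1) a[OF 2(1) f(2)] k by (rule emb_Comp[OF 2(1) f(2)])
  next
    case (3 A n)
    then show ?case using e by (auto simp: k transport_om)
  next
    case (4 A w)
    then obtain f where "f \<in> Hom C A X" "w = emb f" by auto
    then have "Mor f \<in> Fo (iterated [X]) (A, \<one>)" "tensor_arrow [X] (Mor f) = w"
      using e[OF 4(1)] by (auto simp: k)
    then show ?case by blast
  qed
qed

text \<open>The coend over \<open>Y\<close> is treated first, with \<open>tail_arrow\<close> as the
  map out of it, and then the coend over \<open>B\<close>. Once both maps are known on classes, the
  four properties follow from the formulas for \<open>transport\<close> and from the shape of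
  \<open>composites\<close>.\<close>

lemma tensor_arrow_good_Cons:
  assumes X: "X \<in> Obj C" and W: "W \<in> words C" and good: "tensor_arrow_good W"
  shows "tensor_arrow_good (X # W)"
proof -
  have ne: "W \<noteq> []" using W by (simp add: words_def)
  let ?T = "iterated W" and ?D = "mod_tensor C (Ups_dual C J) (iterated W)"
  have chain: "chain_of C W n \<in> chains C J W A" if "A \<in> Obj C" "n \<in> Fo ?T (A, \<one>)" for A n
    using that good by (auto simp: tensor_arrow_good_def)
  have kact: "tensor_arrow W (act ?T h (Id C \<one>) n) = tensor_arrow W n \<bullet> emb h" if "h \<in> Hom C A' A" "n \<in> Fo ?T (A, \<one>)" for h A A' n
    using that good by (auto simp: tensor_arrow_good_def)
  have kxi: "transport A (tensor_arrow W n) = ev (Gamma_iso C J \<phi> \<theta> W) A \<one> n" if "A \<in> Obj C" "n \<in> Fo ?T (A, \<one>)" for A n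
    using that good by (auto simp: tensor_arrow_good_def)
  have ksurj: "\<exists>n \<in> Fo ?T (A, \<one>). tensor_arrow W n = w" if "A \<in> Obj C" "w \<in> composites W A" for A w
    using that good by (auto simp: tensor_arrow_good_def)
  have kHom: "tensor_arrow W n \<in> Hom Q [A] W" if "A \<in> Obj C" "n \<in> Fo ?T (A, \<one>)" for A n
    unfolding tensor_arrow_def by (rule chain_arrow_Hom[OF W chain[OF that]])
  note T = iterated_bimodule[OF W] and U = Ups_bimodule[OF X]
  note D = tensor_bimodule[OF dual_bimodule T]
  have dE: "\<exists>Y n g. q = At Y (Pr n (Mor g)) \<and> q = tensor_elt (Ups_dual C J) ?T B \<one> Y n (Mor g) \<and> Y \<in> Obj C \<and> n \<in> Fo ?T (Y, \<one>) \<and> g \<in> Hom C (J \<otimes> B) Y"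
    if q: "q \<in> Fo ?D (B, \<one>)" and B: "B \<in> Obj C" for q B
  proof -
    from q obtain Y n m where y: "q = At Y (Pr n m)" "q = tensor_elt (Ups_dual C J) ?T B \<one> Y n m" "Y \<in> Obj C"
      "n \<in> Fo ?T (Y, \<one>)" "m \<in> Fo (Ups_dual C J) (B, Y)"
      by (rule tensorE[OF dual_bimodule T B unit_Obj])
    then obtain g where "m = Mor g" "g \<in> Hom C (J \<otimes> B) Y"
      using B by (auto simp: Fo_Ups_dual)
    with y show ?thesis by blast
  qed
  have dM: "Mor g \<in> Fo (Ups_dual C J) (B, Y)" if "g \<in> Hom C (J \<otimes> B) Y" "B \<in> Obj C" for g B Y
    using that HomD[OF that(1)] by (simp add: Fo_Ups_dual)
  \<comment> \<open>Invariance over \<open>Y\<close>: naturality in the source, assumed for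
    \<open>W\<close>, matches composition of \<open>g\<close> with \<open>h\<close>.\<close>
  have k'_tensor_elt: "tail_arrow W (tensor_elt (Ups_dual C J) ?T B \<one> Y n (Mor g)) = tensor_arrow W n \<bullet> emb g"
    if g: "g \<in> Hom C (J \<otimes> B) Y" and B: "B \<in> Obj C" and n: "n \<in> Fo ?T (Y, \<one>)" for B Y n g
  proof -
    have Y: "Y \<in> Obj C" using HomD[OF g] by simp
    have "tail_arrow W (tensor_elt (Ups_dual C J) ?T B \<one> Y n (Mor g)) = tail_arrow W (At Y (Pr n (Mor g)))"
    proof (rule tensor_elt_eval[OF dual_bimodule T B unit_Obj _ Y n dM[OF g B]])
      fix Y Y' h n q assume h: "h \<in> Hom C Y Y'" and n: "n \<in> Fo ?T (Y', \<one>)" and q: "q \<in> Fo (Ups_dual C J) (B, Y)"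
      have y: "Y \<in> Obj C" "Y' \<in> Obj C" using HomD[OF h] by auto
      obtain g where g: "q = Mor g" "g \<in> Hom C (J \<otimes> B) Y" using q y B by (auto simp: Fo_Ups_dual)
      have "(tensor_arrow W n \<bullet> emb h) \<bullet> emb g = tensor_arrow W n \<bullet> emb (h \<cdot> g)"
        unfolding emb_Comp[OF g(2) h] by (rule Q.Comp_assoc[OF emb_Hom[OF g(2)] emb_Hom[OF h] kHom[OF y(2) n]])
      then show "tail_arrow W (At Y (Pr (act ?T h (Id C \<one>) n) q)) = tail_arrow W (At Y' (Pr n (act (Ups_dual C J) (Id C B) h q)))"
        by (simp add: tail_arrow_def g(1) act_Ups_dual_right[OF h B J_Obj g(2)] kact[OF h n])
    qed
    then show ?thesis by (simp add: tail_arrow_def)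
  qed
  have k'_Hom: "tail_arrow W q \<in> Hom Q [J \<otimes> B] W" if q: "q \<in> Fo ?D (B, \<one>)" and B: "B \<in> Obj C" for q B
  proof -
    obtain Y n g where "q = At Y (Pr n (Mor g))" "Y \<in> Obj C" "n \<in> Fo ?T (Y, \<one>)" "g \<in> Hom C (J \<otimes> B) Y"
      using dE[OF q B] by blast
    then show ?thesis
      by (auto simp: tail_arrow_def intro: Q.Comp_Hom[OF emb_Hom kHom])
  qed
  \<comment> \<open>Naturality of the tail in \<open>B\<close>, needed for the invariance over
    \<open>B\<close> below.\<close>
  have k'_act: "tail_arrow W (act ?D h (Id C \<one>) q) = tail_arrow W q \<bullet> emb (Id C J \<star> h)" if h: "h \<in> Hom C B B'" and q: "q \<in> Fo ?D (B', \<one>)" for B B' h q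
  proof -
    have B: "B \<in> Obj C" "B' \<in> Obj C" using HomD[OF h] by auto
    obtain Y n g where y: "q = tensor_elt (Ups_dual C J) ?T B' \<one> Y n (Mor g)" "Y \<in> Obj C" "n \<in> Fo ?T (Y, \<one>)" "g \<in> Hom C (J \<otimes> B') Y"
      using dE[OF q B(2)] by blast
    note Jh = tar_Hom[OF Id_Hom[OF J_Obj] h]
    have "act ?D h (Id C \<one>) q = tensor_elt (Ups_dual C J) ?T B \<one> Y n (Mor (g \<cdot> (Id C J \<star> h)))"
      unfolding y(1) using act_tensor_elt[OF dual_bimodule T h Id_Hom[OF unit_Obj] y(2,3) dM[OF y(4) B(2)]]
      by (simp add: act_Ups_dual_left[OF h y(2) J_Obj y(4)] act_Id[OF T y(2) unit_Obj y(3)])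
    then have "tail_arrow W (act ?D h (Id C \<one>) q) = tensor_arrow W n \<bullet> emb (g \<cdot> (Id C J \<star> h))"
      using k'_tensor_elt[OF Comp_Hom[OF Jh y(4)] B(1) y(3)] by simp
    also have "\<dots> = (tensor_arrow W n \<bullet> emb g) \<bullet> emb (Id C J \<star> h)"
      unfolding emb_Comp[OF Jh y(4)] by (rule Q.Comp_assoc[OF emb_Hom[OF Jh] emb_Hom[OF y(4)] kHom[OF y(2,3)], symmetric])
    finally show ?thesis
      by (simp add: y(1) k'_tensor_elt[OF y(4) B(2) y(3)])
  qed
  have k_At: "tensor_arrow (X # W) (At B (Pr q (Mor f))) = (Id Q [X] \<diamondop> Q.mate [B] (tail_arrow W q)) \<bullet> emb f \<and>
      chain_of C (X # W) (At B (Pr q (Mor f))) \<in> chains C J (X # W) A"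
    if q: "q \<in> Fo ?D (B, \<one>)" and f: "f \<in> Hom C A (X \<otimes> B)" and B: "B \<in> Obj C" for B q f A
  proof -
    obtain Y n g where y: "q = At Y (Pr n (Mor g))" "Y \<in> Obj C" "n \<in> Fo ?T (Y, \<one>)" "g \<in> Hom C (J \<otimes> B) Y"
      using dE[OF q B] by blast
    show ?thesis
      using chain_of_Cons[OF W X chain[OF y(2,3)] y(4) f B] by (simp add: y(1) tail_arrow_def)
  qed
  have uM: "Mor f \<in> Fo (Ups_ob C X) (A, B)" if "f \<in> Hom C A (X \<otimes> B)" "B \<in> Obj C" for f A B
    using that HomD[OF that(1)] by (simp add: Fo_Ups_ob)
  have tE: "\<exists>B q f. t = At B (Pr q (Mor f)) \<and> t = tensor_elt (Ups_ob C X) ?D A \<one> B q (Mor f) \<and> B \<in> Obj C \<and> q \<in> Fo ?D (B, \<one>) \<and> f \<in> Hom C A (X \<otimes> B)"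
    if t: "t \<in> Fo (iterated (X # W)) (A, \<one>)" and A: "A \<in> Obj C" for t A
  proof -
    from t[unfolded iterated_Cons[OF ne]] obtain B q m where b: "t = At B (Pr q m)" "t = tensor_elt (Ups_ob C X) ?D A \<one> B q m" "B \<in> Obj C"
      "q \<in> Fo ?D (B, \<one>)" "m \<in> Fo (Ups_ob C X) (A, B)"
      by (rule tensorE[OF U D A unit_Obj])
    then obtain f where "m = Mor f" "f \<in> Hom C A (X \<otimes> B)"
      using A by (auto simp: Fo_Ups_ob)
    with b show ?thesis by blast
  qed
  \<comment> \<open>Invariance over \<open>B\<close> is \<open>step_slide\<close>, with the tail
    arrow as \<open>c\<close>.\<close>
  have k_tensor_elt: "tensor_arrow (X # W) (tensor_elt (Ups_ob C X) ?D A \<one> B q (Mor f)) = (Id Q [X] \<diamondop> Q.mate [B] (tail_arrow W q)) \<bullet> emb f"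
    if q: "q \<in> Fo ?D (B, \<one>)" and f: "f \<in> Hom C A (X \<otimes> B)" and B: "B \<in> Obj C" for B q f A
  proof -
    have A: "A \<in> Obj C" using HomD[OF f] by simp
    have "tensor_arrow (X # W) (tensor_elt (Ups_ob C X) ?D A \<one> B q (Mor f)) = tensor_arrow (X # W) (At B (Pr q (Mor f)))"
    proof (rule tensor_elt_eval[OF U D A unit_Obj _ B q uM[OF f B]])
      fix B B' h q m assume h: "h \<in> Hom C B B'" and q: "q \<in> Fo ?D (B', \<one>)" and m: "m \<in> Fo (Ups_ob C X) (A, B)"
      have b: "B \<in> Obj C" "B' \<in> Obj C" using HomD[OF h] by auto
      obtain f where f: "m = Mor f" "f \<in> Hom C A (X \<otimes> B)" using m b A by (auto simp: Fo_Ups_ob)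
      have Xh: "(Id C X \<star> h) \<cdot> f \<in> Hom C A (X \<otimes> B')"
        by (rule Comp_Hom[OF f(2) tar_Hom[OF Id_Hom[OF X] h]])
      show "tensor_arrow (X # W) (At B (Pr (act ?D h (Id C \<one>) q) m)) = tensor_arrow (X # W) (At B' (Pr q (act (Ups_ob C X) (Id C A) h m)))"
        using k_At[OF act_in[OF D h Id_Hom[OF unit_Obj] q] f(2) b(1)] k_At[OF q Xh b(2)]
          step_slide[OF k'_Hom[OF q b(2)] X h f(2)]
        by (simp add: f(1) act_Ups_ob_right[OF h A f(2)] k'_act[OF h q])
    qed
    with k_At[OF q f B] show ?thesis by simp
  qed
  show ?thesis
    unfolding tensor_arrow_good_def
  proof (intro conjI allI impI, goal_cases)
    case (1 A t)
    then obtain B q f where "t = At B (Pr q (Mor f))" "B \<in> Obj C" "q \<in> Fo ?D (B, \<one>)" "f \<in> Hom C A (X \<otimes> B)"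
      using tE by blast
    then show ?case using k_At by blast
  next
    case (2 A A' h t)
    have A: "A \<in> Obj C" using HomD[OF 2(1)] by simp
    obtain B q f where t: "t = tensor_elt (Ups_ob C X) ?D A \<one> B q (Mor f)" "B \<in> Obj C" "q \<in> Fo ?D (B, \<one>)" "f \<in> Hom C A (X \<otimes> B)"
      using tE[OF 2(2) A] by blast
    have "act (iterated (X # W)) h (Id C \<one>) t = tensor_elt (Ups_ob C X) ?D A' \<one> B q (Mor (f \<cdot> h))"
      unfolding t(1) iterated_Cons[OF ne] using act_tensor_elt[OF U D 2(1) Id_Hom[OF unit_Obj] t(2,3) uM[OF t(4,2)]]
      by (simp add: act_Id[OF D t(2) unit_Obj t(3)] act_Ups_ob_left[OF 2(1) t(2) X t(4)])
    then show ?case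
      using step_pre[OF k'_Hom[OF t(3,2)] t(2) X t(4) 2(1)]
      by (simp add: t(1) k_tensor_elt[OF t(3,4,2)] k_tensor_elt[OF t(3) Comp_Hom[OF 2(1) t(4)] t(2)])
  next
    case (3 A t)
    obtain B q f where t: "t = tensor_elt (Ups_ob C X) ?D A \<one> B q (Mor f)" "B \<in> Obj C" "q \<in> Fo ?D (B, \<one>)" "f \<in> Hom C A (X \<otimes> B)"
      using tE[OF 3(2,1)] by blast
    obtain Y n g where y: "q = tensor_elt (Ups_dual C J) ?T B \<one> Y n (Mor g)" "Y \<in> Obj C" "n \<in> Fo ?T (Y, \<one>)" "g \<in> Hom C (J \<otimes> B) Y"
      using dE[OF t(3,2)] by blast
    have JB: "J \<otimes> B \<in> Obj C" using t(2) by (simp add: tob_Obj J_Obj)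
    note w = single_words[OF X] wtensor_words[OF Jdual_words W]
    note c = k'_Hom[OF t(3,2)]
    have mate: "Q.mate [B] (tail_arrow W q) \<in> Hom Q [B] (wtensor C Jd W)"
      using Q.mate_Hom[of _ "[B]" W] c t(2) by (simp add: single_wtensor_single words_def)
    have GI: "Gamma_iso C J \<phi> \<theta> W \<in> Hom V (iterated W) (Go W)" using Gamma_iso_Hom[OF W] by simp
    note I = Mod_Id_Hom[OF dual_bimodule]
    note a = tensor_arr_Hom[OF I GI]
    note p = phi_Hom[OF Jdual_words W, unfolded Go_Jd]
    note b = V.Comp_Hom[OF a p]
    have "transport (J \<otimes> B) (tail_arrow W q) = act (Go W) g (Id C \<one>) (ev (Gamma_iso C J \<phi> \<theta> W) Y \<one> n)"
      unfolding y(1) k'_tensor_elt[OF y(4) t(2) y(3)] transport_pre[OF kHom[OF y(2,3)] y(4)] kxi[OF y(2,3)] ..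
    moreover have i: "Mor (Id C (J \<otimes> B)) \<in> Fo (Ups_dual C J) (B, J \<otimes> B)"
      by (rule dM[OF Id_Hom[OF JB] t(2)])
    \<comment> \<open>\<open>transport_mate\<close> gives a class at \<open>J \<otimes> B\<close> in
      which \<open>g\<close> acts on the module element and the dual part is an identity. Sliding
      \<open>g\<close> across the coend moves the class to \<open>Y\<close> and turns the identity
      into \<open>g\<close>.\<close>
    ultimately have "transport B (Q.mate [B] (tail_arrow W q)) =
      ev (\<phi> Jd W) B \<one> (tensor_elt (Ups_dual C J) (Go W) B \<one> Y (ev (Gamma_iso C J \<phi> \<theta> W) Y \<one> n) (Mor g))"
      using transport_mate[OF c t(2)] tensor_elt_slide[OF dual_bimodule Go_bimodule[OF W] t(2) unit_Obj y(4) ev_in[OF GI y(2) unit_Obj y(3)] i]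
      by (simp add: Go_Jd act_Ups_dual_right[OF y(4) t(2) J_Obj Id_Hom[OF JB]] Comp_Id[OF y(4)])
    also have "\<dots> = ev (\<phi> Jd W) B \<one> (ev (mod_tensor_arr C (Id V (Ups_dual C J)) (Gamma_iso C J \<phi> \<theta> W)) B \<one> q)"
      unfolding y(1) ev_tensor_arr[OF I GI t(2) unit_Obj y(2,3) dM[OF y(4) t(2)]] 
      by (simp add: ev_Id[OF t(2) y(2) dM[OF y(4) t(2)]])
    also have "\<dots> = ev (\<phi> Jd W \<cdot>\<^bsub>V\<^esub> mod_tensor_arr C (Id V (Ups_dual C J)) (Gamma_iso C J \<phi> \<theta> W)) B \<one> q"
      by (rule ev_Comp[OF a t(2) unit_Obj t(3), symmetric])
    finally have x: "transport B (Q.mate [B] (tail_arrow W q)) = \<dots>" .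
    have "transport A (tensor_arrow (X # W) t) = ev (\<phi> [X] (wtensor C Jd W)) A \<one>
        (tensor_elt (Go [X]) (Go (wtensor C Jd W)) A \<one> B (transport B (Q.mate [B] (tail_arrow W q))) (ev (\<theta> X) A B (Mor f)))"
      unfolding t(1) k_tensor_elt[OF t(3,4,2)] by (rule transport_tensor[OF mate t(4) X])
    also have "\<dots> = ev (\<phi> [X] (wtensor C Jd W)) A \<one> (ev (mod_tensor_arr C (\<theta> X)
       (\<phi> Jd W \<cdot>\<^bsub>V\<^esub> mod_tensor_arr C (Id V (Ups_dual C J)) (Gamma_iso C J \<phi> \<theta> W))) A \<one> t)"
      unfolding t(1) ev_tensor_arr[OF theta_Hom[OF X] b 3(1) unit_Obj t(2,3) uM[OF t(4,2)]] x ..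
    also have "\<dots> = ev (Gamma_iso C J \<phi> \<theta> (X # W)) A \<one> t"
      unfolding Gamma_iso_Cons[OF ne]
      by (rule ev_Comp[OF tensor_arr_Hom[OF theta_Hom[OF X] b] 3(1) unit_Obj 3(2)[unfolded iterated_Cons[OF ne]], symmetric])
    finally show ?case .
  next
    case (4 A w)
    then obtain B c f where c: "B \<in> Obj C" "f \<in> Hom C A (X \<otimes> B)" "c \<in> composites W (J \<otimes> B)" "w = (Id Q [X] \<diamondop> Q.mate [B] c) \<bullet> emb f"
      by (auto simp: composites_Cons[OF ne])
    have JB: "J \<otimes> B \<in> Obj C" using c(1) by (simp add: tob_Obj J_Obj)
    obtain n where n: "n \<in> Fo ?T (J \<otimes> B, \<one>)" "tensor_arrow W n = c"
      using ksurj[OF JB c(3)] by blast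
    \<comment> \<open>The witness sits at \<open>Y = J \<otimes> B\<close> with an identity as dual
      part, so the tail arrow is \<open>c\<close> itself.\<close>
    let ?q = "tensor_elt (Ups_dual C J) ?T B \<one> (J \<otimes> B) n (Mor (Id C (J \<otimes> B)))"
    have q: "?q \<in> Fo ?D (B, \<one>)"
      by (rule tensor_elt_in[OF dual_bimodule T c(1) unit_Obj JB n(1) dM[OF Id_Hom[OF JB] c(1)]])
    have "tail_arrow W ?q = c"
      using k'_tensor_elt[OF Id_Hom[OF JB] c(1) n(1)] Q.Comp_Id[OF composites_Hom[OF W c(3)]] by (simp add: n(2) emb_Id[OF JB])
    then have "tensor_arrow (X # W) (tensor_elt (Ups_ob C X) ?D A \<one> B ?q (Mor f)) = w"
      using k_tensor_elt[OF q c(2,1)] c(4) by simp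
    moreover have "tensor_elt (Ups_ob C X) ?D A \<one> B ?q (Mor f) \<in> Fo (iterated (X # W)) (A, \<one>)"
      unfolding iterated_Cons[OF ne] by (rule tensor_elt_in[OF U D 4(1) unit_Obj c(1) q uM[OF c(2,1)]])
    ultimately show ?case by blast
  qed
qed

lemma tensor_arrow_good: "W \<in> words C \<Longrightarrow> tensor_arrow_good W"
  by (induction W rule: words_induct) (simp_all add: tensor_arrow_good_single tensor_arrow_good_Cons)

text \<open>\<open>canonical_iso\<close> starts with the inverse of \<open>Gamma_iso\<close>, which
  cancels; the composite on the remaining class of chains is given by
  \<open>chain_comp_class\<close>.\<close>

lemma zeta_fun_ev:
  assumes W: "W \<in> words C" and A: "A \<in> Obj C" and t: "t \<in> Fo (iterated W) (A, \<one>)"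
  shows "zeta_fun C J \<phi> \<theta> W A (ev (Gamma_iso C J \<phi> \<theta> W) A \<one> t) = DMor (tensor_arrow W t)"
proof -
  let ?G = "Gamma_iso C J \<phi> \<theta> W"
  have G: "?G \<in> Hom V (iterated W) (Go W)" "is_iso V ?G"
    using Gamma_iso_Hom[OF W] by auto
  have i: "inv_arr V ?G \<cdot>\<^bsub>V\<^esub> ?G = Id V (iterated W)"
    using V.inv_arr[OF G(2)] V.is_inverse_Hom[OF G(1)] by blast
  have "ev (inv_arr V ?G) A \<one> (ev ?G A \<one> t) = t"
    using ev_Comp[OF G(1) A unit_Obj t, of "inv_arr V ?G"] ev_Id[OF A unit_Obj t] by (simp add: i)
  then have "canonical_iso C J \<phi> \<theta> W A (ev ?G A \<one> t) = chain_rel C J W A `` {chain_of C W t}"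
    by (simp add: canonical_iso_def ev_def)
  moreover have "chain_of C W t \<in> chains C J W A"
    using tensor_arrow_good[OF W] A t by (simp add: tensor_arrow_good_def)
  ultimately show ?thesis
    by (simp add: zeta_fun_def chain_comp_class[OF W] tensor_arrow_def)
qed

text \<open>\<open>transport\<close> undoes zeta. Every \<open>x\<close> is the
  \<open>Gamma_iso\<close>-image of some element, and on such images both maps are known. The arrow
  \<open>w\<close> is returned as well, since naturality is proved by replacing \<open>x\<close>
  with its transport.\<close>

lemma transport_zeta:
  assumes W: "W \<in> words C" and A: "A \<in> Obj C" and x: "x \<in> Fo (Go W) (A, \<one>)"
  obtains w where "w \<in> Hom Q [A] W" "zeta_fun C J \<phi> \<theta> W A x = DMor w" "transport A w = x"
proof -
  let ?G = "Gamma_iso C J \<phi> \<theta> W"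
  have G: "?G \<in> Hom V (iterated W) (Go W)" "is_iso V ?G"
    using Gamma_iso_Hom[OF W] by auto
  have i: "?G \<cdot>\<^bsub>V\<^esub> inv_arr V ?G = Id V (Go W)" "inv_arr V ?G \<in> Hom V (Go W) (iterated W)"
    using V.inv_arr[OF G(2)] V.is_inverse_Hom[OF G(1)] by blast+
  let ?t = "ev (inv_arr V ?G) A \<one> x"
  have t: "?t \<in> Fo (iterated W) (A, \<one>)" "ev ?G A \<one> ?t = x"
    using ev_in[OF i(2) A unit_Obj x] ev_Comp[OF i(2) A unit_Obj x, of ?G] ev_Id[OF A unit_Obj x] by (simp_all add: i(1))
  have "chain_of C W ?t \<in> chains C J W A" "transport A (tensor_arrow W ?t) = x"
    using tensor_arrow_good[OF W] A t by (simp_all add: tensor_arrow_good_def)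
  then show thesis
    using that[of "tensor_arrow W ?t"] zeta_fun_ev[OF W A t(1)] chain_arrow_Hom[OF W] t(2) by (simp add: tensor_arrow_def)
qed

text \<open>The other composite. By \<open>arrow_from_base\<close> the arrow \<open>w\<close> has
  the special form, hence it is \<open>tensor_arrow W t\<close> for some \<open>t\<close>.\<close>

lemma zeta_transport:
  assumes w: "w \<in> Hom Q [A] W"
  shows "zeta_fun C J \<phi> \<theta> W A (transport A w) = DMor w"
proof -
  have o: "W \<in> words C" "A \<in> Obj C"
    using Q_HomD[OF w] by (auto simp: words_def)
  obtain t where "t \<in> Fo (iterated W) (A, \<one>)" "tensor_arrow W t = w"
    using tensor_arrow_good[OF o(1)] arrow_from_base[OF w] o(2) unfolding tensor_arrow_good_def by blast
  moreover from this have "transport A (tensor_arrow W t) = ev (Gamma_iso C J \<phi> \<theta> W) A \<one> t"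
    using tensor_arrow_good[OF o(1)] o(2) unfolding tensor_arrow_good_def by blast
  ultimately show ?thesis
    using zeta_fun_ev[OF o, of t] by simp
qed

section \<open>Naturality and invertibility\<close>

abbreviation "EG \<equiv> comp_functor Q (Ev_unit C) \<Gamma>"
abbreviation "OT \<equiv> Omega_tilde C J"
abbreviation "PC \<equiv> psh_cat C"

text \<open>This and \<open>hom_psh\<close> name the presheaves that are bound by \<open>let\<close>
  inside \<open>Ev_unit\<close> and \<open>Omega_tilde\<close>, the second with \<open>Omega\<close>
  already unfolded.\<close>

definition eval_psh :: "('o, 'm) bimod \<Rightarrow> ('o, 'm) psh" where
  "eval_psh M = \<lparr>Fo = (\<lambda>A \<in> Obj C. Fo M (A, \<one>)), Fa = (\<lambda>h \<in> Arr C. Fa M (h, Id C \<one>))\<rparr>"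

definition hom_psh :: "'o list \<Rightarrow> ('o, 'm) psh" where
  "hom_psh W = \<lparr>Fo = (\<lambda>A \<in> Obj C. DMor ` Hom Q [A] W),
     Fa = (\<lambda>h \<in> Arr C. mk_fun (DMor ` Hom Q [Cod C h] W) (\<lambda>z. case z of DMor x \<Rightarrow> DMor (x \<bullet> emb h)) (DMor ` Hom Q [Dom C h] W))\<rparr>"

section \<open>The two functors with presheaves as values\<close>

lemma op_sel: "Obj (op_cat C) = Obj C" "Arr (op_cat C) = Arr C" "Dom (op_cat C) h = Cod C h" "Cod (op_cat C) h = Dom C h"
  "Id (op_cat C) A = Id C A" "g \<cdot>\<^bsub>op_cat C\<^esub> f = f \<cdot> g"
  by (simp_all add: op_cat_def)

lemma EG_sel:
  "W \<in> words C \<Longrightarrow> Fo EG W = eval_psh (Go W)"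
  "w \<in> Hom Q U W \<Longrightarrow> Fa EG w = (eval_psh (Go U), \<lambda>A \<in> Obj C. component (Ga w) (A, \<one>), eval_psh (Go W))"
proof -
  show "Fo EG W = eval_psh (Go W)" if "W \<in> words C"
    using that Go_bimodule[OF that] by (simp add: comp_functor_def Ev_unit_def eval_psh_def Let_def Mod_sel)
  assume w: "w \<in> Hom Q U W"
  then have "Ga w \<in> Arr V" "Dom V (Ga w) = Go U" "Cod V (Ga w) = Go W" "w \<in> Arr Q"
    using V.HomD[OF Ga_Hom[OF w]] Q_HomD[OF w] by auto
  then show "Fa EG w = (eval_psh (Go U), \<lambda>A \<in> Obj C. component (Ga w) (A, \<one>), eval_psh (Go W))"
    by (simp add: comp_functor_def Ev_unit_def eval_psh_def Let_def)
qed

lemma OT_sel: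
  "W \<in> words C \<Longrightarrow> Fo OT W = hom_psh W"
  "w \<in> Hom Q U W \<Longrightarrow> Fa OT w = (hom_psh U, \<lambda>A \<in> Obj C. mk_fun (DMor ` Hom Q [A] U) (\<lambda>z. case z of DMor x \<Rightarrow> DMor (w \<bullet> x)) (DMor ` Hom Q [A] W), hom_psh W)"
proof -
  \<comment> \<open>\<open>Omega\<close> is restricted to \<open>C\<close>, so it can be unfolded
    only where membership is known; the congruence rules supply it under the binders.\<close>
  have *: "\<lparr>Fo = (\<lambda>A \<in> Obj C. DMor ` Hom Q (Fo (Omega C J) A) W),
       Fa = (\<lambda>h \<in> Arr C. mk_fun (DMor ` Hom Q (Fo (Omega C J) (Cod C h)) W)
         (\<lambda>z. case z of DMor x \<Rightarrow> DMor (x \<bullet> Fa (Omega C J) h)) (DMor ` Hom Q (Fo (Omega C J) (Dom C h)) W))\<rparr> = hom_psh W" for W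
    by (simp add: hom_psh_def Fo_Omega Fa_Omega Dom_Obj Cod_Obj cong: restrict_cong elt.case_cong)
  show "Fo OT W = hom_psh W" if "W \<in> words C"
    using that by (simp add: Omega_tilde_def Let_def *)
  assume "w \<in> Hom Q U W"
  then show "Fa OT w = (hom_psh U, \<lambda>A \<in> Obj C. mk_fun (DMor ` Hom Q [A] U) (\<lambda>z. case z of DMor x \<Rightarrow> DMor (w \<bullet> x)) (DMor ` Hom Q [A] W), hom_psh W)"
    using Q_HomD[of w U W] by (auto simp: Omega_tilde_def Let_def * Fo_Omega intro!: restrict_ext)
qed

lemma eval_psh_functor:
  assumes M: "bimodule M"
  shows "is_functor (op_cat C) set_cat (eval_psh M)"
proof -
  note I = Id_Hom[OF unit_Obj]
  have H: "Fa M (h, Id C \<one>) \<in> Hom set_cat (Fo M (Cod C h, \<one>)) (Fo M (Dom C h, \<one>))" if "h \<in> Arr C" for h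
    by (rule Fa_Hom[OF M Arr_Hom[OF that] I])
  have i: "Fa M (Id C A, Id C \<one>) = Id set_cat (Fo M (A, \<one>))" if A: "A \<in> Obj C" for A
    using M A unit_Obj unfolding is_functor_def by (metis SigmaI bi_cat_sel(1,5))
  have c: "Fa M (f \<cdot> g, Id C \<one>) = Fa M (g, Id C \<one>) \<cdot>\<^bsub>set_cat\<^esub> Fa M (f, Id C \<one>)" 
    if "f \<in> Arr C" "g \<in> Arr C" "Dom C f = Cod C g" for f g
  proof -
    have "(f, Id C \<one>) \<in> Arr (bi_cat C)" "(g, Id C \<one>) \<in> Arr (bi_cat C)" "Dom (bi_cat C) (g, Id C \<one>) = Cod (bi_cat C) (f, Id C \<one>)"
      using that HomD[OF I] by (simp_all add: bi_cat_sel)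
    then have "Fa M ((g, Id C \<one>) \<cdot>\<^bsub>bi_cat C\<^esub> (f, Id C \<one>)) = Fa M (g, Id C \<one>) \<cdot>\<^bsub>set_cat\<^esub> Fa M (f, Id C \<one>)"
      using M unfolding is_functor_def by blast
    then show ?thesis
      by (simp add: bi_cat_sel Comp_Id[OF I])
  qed
  have a: "f \<cdot> g \<in> Arr C" if "f \<in> Arr C" "g \<in> Arr C" "Dom C f = Cod C g" for f g
    using HomD[OF Comp_Hom[of g "Dom C g" "Cod C g" f "Cod C f"]] that by (simp add: Hom_def)
  show ?thesis
    unfolding is_functor_def
    using H i c a HomD[OF Id_Hom] by (auto simp: op_sel eval_psh_def set_cat_def[THEN arg_cong[of _ _ Obj]] Dom_Obj Cod_Obj)
qed

lemma hom_psh_functor: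
  assumes W: "W \<in> words C"
  shows "is_functor (op_cat C) set_cat (hom_psh W)"
proof -
  let ?a = "\<lambda>h z. case z of DMor x \<Rightarrow> DMor (x \<bullet> emb h)"
  let ?S = "\<lambda>A. DMor ` Hom Q [A] W :: ('o, 'm) elt set"
  have in_S: "?a h z \<in> ?S A" if "h \<in> Hom C A B" "z \<in> ?S B" for h A B z
    using that Q.Comp_Hom[OF emb_Hom[OF that(1)]] by auto
  have H: "mk_fun (?S (Cod C h)) (?a h) (?S (Dom C h)) \<in> Hom set_cat (?S (Cod C h)) (?S (Dom C h))" if "h \<in> Arr C" for h
    using in_S[OF Arr_Hom[OF that]] by (auto intro!: mk_fun_Hom)
  have i: "mk_fun (?S A) (?a (Id C A)) (?S A) = Id set_cat (?S A)" if A: "A \<in> Obj C" for A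
    unfolding set_Id mk_fun_def by (auto simp: emb_Id[OF A] Q.Comp_Id intro!: restrict_ext)
  have c: "mk_fun (?S (Cod C f)) (?a (f \<cdot> g)) (?S (Dom C g)) =
      mk_fun (?S (Cod C g)) (?a g) (?S (Dom C g)) \<cdot>\<^bsub>set_cat\<^esub> mk_fun (?S (Cod C f)) (?a f) (?S (Dom C f))"
    if "f \<in> Arr C" "g \<in> Arr C" "Dom C f = Cod C g" for f g
  proof -
    have fg: "f \<in> Hom C (Cod C g) (Cod C f)" "g \<in> Hom C (Dom C g) (Cod C g)"
      using that by (simp_all add: Hom_def)
    have "?a (f \<cdot> g) z = restrict (?a g) (?S (Cod C g)) (restrict (?a f) (?S (Cod C f)) z)" if z: "z \<in> ?S (Cod C f)" for z
      using z in_S[OF fg(1) z] Q.Comp_assoc[OF emb_Hom[OF fg(2)] emb_Hom[OF fg(1)], of _ W] by (auto simp: emb_Comp[OF fg(2,1)])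
    then have "restrict (?a (f \<cdot> g)) (?S (Cod C f)) =
        restrict (\<lambda>z. restrict (?a g) (?S (Cod C g)) (restrict (?a f) (?S (Cod C f)) z)) (?S (Cod C f))"
      by (rule restrict_ext)
    then show ?thesis
      by (simp only: mk_fun_def set_cat_Comp)
  qed
  have a: "f \<cdot> g \<in> Arr C" "Dom C (f \<cdot> g) = Dom C g" "Cod C (f \<cdot> g) = Cod C f" if "f \<in> Arr C" "g \<in> Arr C" "Dom C f = Cod C g" for f g
    using HomD[OF Comp_Hom[of g "Dom C g" "Cod C g" f "Cod C f"]] that by (simp_all add: Hom_def)
  show ?thesis
    unfolding is_functor_def
  proof (intro conjI ballI impI)
    show "Fo (hom_psh W) \<in> extensional (Obj (op_cat C))" "Fa (hom_psh W) \<in> extensional (Arr (op_cat C))"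
      by (simp_all add: hom_psh_def op_sel)
    show "Fo (hom_psh W) A \<in> Obj set_cat" for A
      by (simp add: set_cat_def)
    show "Fa (hom_psh W) f \<in> Hom set_cat (Fo (hom_psh W) (Dom (op_cat C) f)) (Fo (hom_psh W) (Cod (op_cat C) f))" if "f \<in> Arr (op_cat C)" for f
      using H that by (simp add: hom_psh_def op_sel Dom_Obj Cod_Obj)
    show "Fa (hom_psh W) (Id (op_cat C) A) = Id set_cat (Fo (hom_psh W) A)" if "A \<in> Obj (op_cat C)" for A
      using i that HomD[OF Id_Hom[of A]] by (simp add: hom_psh_def op_sel)
    show "Fa (hom_psh W) (g \<cdot>\<^bsub>op_cat C\<^esub> f) = Fa (hom_psh W) g \<cdot>\<^bsub>set_cat\<^esub> Fa (hom_psh W) f"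
      if "f \<in> Arr (op_cat C)" "g \<in> Arr (op_cat C)" "Dom (op_cat C) g = Cod (op_cat C) f" for f g
      using that c[of f g] a[of f g] by (simp add: hom_psh_def op_sel)
  qed
qed

lemma psh_Hom: "t \<in> Hom PC P R \<longleftrightarrow> is_functor (op_cat C) set_cat P \<and> is_functor (op_cat C) set_cat R \<and>
    (\<exists>\<alpha>. t = (P, \<alpha>, R) \<and> nat_trans (op_cat C) set_cat P R \<alpha> \<and> \<alpha> \<in> extensional (Obj C))"
  by (simp add: psh_cat_def functor_Hom op_sel)

lemma PC_category: "category PC"
  unfolding psh_cat_def by (rule two_categories.functor_category[OF two_categories_psh])

lemma psh_arrI:
  assumes P: "is_functor (op_cat C) set_cat P" "is_functor (op_cat C) set_cat R"
    and H: "\<And>A. A \<in> Obj C \<Longrightarrow> \<alpha> A \<in> Hom set_cat (Fo P A) (Fo R A)"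
    and n: "\<And>A B h x. h \<in> Hom C A B \<Longrightarrow> x \<in> Fo P B \<Longrightarrow> app (\<alpha> A) (app (Fa P h) x) = app (Fa R h) (app (\<alpha> B) x)"
  shows "(P, \<lambda>A \<in> Obj C. \<alpha> A, R) \<in> Hom PC P R"
proof -
  have "Fa R h \<cdot>\<^bsub>set_cat\<^esub> \<alpha> (Cod C h) = \<alpha> (Dom C h) \<cdot>\<^bsub>set_cat\<^esub> Fa P h" if h: "h \<in> Arr C" for h
  proof -
    have F: "Fa P h \<in> Hom set_cat (Fo P (Cod C h)) (Fo P (Dom C h))" "Fa R h \<in> Hom set_cat (Fo R (Cod C h)) (Fo R (Dom C h))"
      using P h unfolding is_functor_def op_sel by blast+
    note o = H[OF Dom_Obj[OF h]] H[OF Cod_Obj[OF h]]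
    note c = category.Comp_Hom[OF set_category]
    show ?thesis
      by (rule set_arr_eqI[OF c[OF o(2) F(2)] c[OF F(1) o(1)]])
        (simp add: app_Comp fst_set_arr[OF o(2)] fst_set_arr[OF F(1)] n[OF Arr_Hom[OF h]])
  qed
  then show ?thesis
    using P H by (simp add: psh_Hom nat_trans_def op_sel Dom_Obj Cod_Obj)
qed

lemma psh_arr_eqI:
  assumes "(P, \<alpha>, R) \<in> Hom PC P R" "(P, \<beta>, R) \<in> Hom PC P R"
    and "\<And>A x. A \<in> Obj C \<Longrightarrow> x \<in> Fo P A \<Longrightarrow> app (\<alpha> A) x = app (\<beta> A) x"
  shows "(P, \<alpha>, R) = (P, \<beta>, R)"
proof -
  have "\<alpha> \<in> extensional (Obj C)" "\<beta> \<in> extensional (Obj C)"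
    "\<And>A. A \<in> Obj C \<Longrightarrow> \<alpha> A \<in> Hom set_cat (Fo P A) (Fo R A)" "\<And>A. A \<in> Obj C \<Longrightarrow> \<beta> A \<in> Hom set_cat (Fo P A) (Fo R A)"
    using assms(1,2) by (auto simp: psh_Hom nat_trans_def op_sel)
  then have "\<alpha> = \<beta>"
    using assms(3) by (intro extensionalityI[where A = "Obj C"] set_arr_eqI) simp_all
  then show ?thesis by simp
qed

lemma psh_Comp: "(P', \<beta>, R) \<cdot>\<^bsub>PC\<^esub> (P, \<alpha>, P'') = (P, \<lambda>A \<in> Obj C. \<beta> A \<cdot>\<^bsub>set_cat\<^esub> \<alpha> A, R)"
  by (simp add: psh_cat_def functor_Comp op_sel)

lemma psh_Id: "Id PC P = (P, \<lambda>A \<in> Obj C. Id set_cat (Fo P A), P)"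
  by (simp add: psh_cat_def functor_Id op_sel)

lemma EG_Hom:
  assumes w: "w \<in> Hom Q U W"
  shows "Fa EG w \<in> Hom PC (eval_psh (Go U)) (eval_psh (Go W))"
proof -
  have o: "U \<in> words C" "W \<in> words C" using Q_HomD[OF w] by auto
  note F = eval_psh_functor[OF Go_bimodule[OF o(1)]] eval_psh_functor[OF Go_bimodule[OF o(2)]]
  have n: "app (component (Ga w) (A, \<one>)) (app (Fa (eval_psh (Go U)) h) x) = app (Fa (eval_psh (Go W)) h) (app (component (Ga w) (B, \<one>)) x)"
    if h: "h \<in> Hom C A B" and x: "x \<in> Fo (eval_psh (Go U)) B" for A B h x
    using ev_nat[OF Ga_Hom[OF w] h Id_Hom[OF unit_Obj], of x] x HomD[OF h] by (simp add: eval_psh_def ev_def act_def)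
  show ?thesis
    unfolding EG_sel(2)[OF w]
    by (rule psh_arrI[OF F _ n]) (use component_Hom[OF Ga_Hom[OF w] _ unit_Obj] in \<open>auto simp: eval_psh_def\<close>)
qed

lemma EG_functor: "is_functor Q PC EG"
  unfolding is_functor_def
proof (intro conjI ballI impI)
  show "Fo EG \<in> extensional (Obj Q)" "Fa EG \<in> extensional (Arr Q)"
    by (simp_all add: comp_functor_def)
next
  fix U assume "U \<in> Obj Q"
  then have U: "U \<in> words C" by simp
  show "Fo EG U \<in> Obj PC"
    using eval_psh_functor[OF Go_bimodule[OF U]] by (simp add: EG_sel(1)[OF U] psh_cat_def functor_cat_def)
  have I: "Id Q U \<in> Hom Q U U" using Q.Id_Hom[of U] U by simp
  have "Fa EG (Id Q U) = (eval_psh (Go U), \<lambda>A \<in> Obj C. component (Ga (Id Q U)) (A, \<one>), eval_psh (Go U))"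
    by (rule EG_sel(2)[OF I])
  also have "\<dots> = Id PC (eval_psh (Go U))"
    unfolding psh_Id Ga_Id[OF U] by (auto simp: Mod_sel functor_Id component_def bi_cat_sel eval_psh_def unit_Obj intro!: restrict_ext)
  finally show "Fa EG (Id Q U) = Id PC (Fo EG U)"
    by (simp add: EG_sel(1)[OF U])
next
  fix f assume "f \<in> Arr Q"
  then have f: "f \<in> Hom Q (Dom Q f) (Cod Q f)" by (rule Q.Arr_Hom)
  show "Fa EG f \<in> Hom PC (Fo EG (Dom Q f)) (Fo EG (Cod Q f))"
    using EG_Hom[OF f] Q_HomD[OF f] by (simp add: EG_sel(1))
  fix g assume "g \<in> Arr Q" "Dom Q g = Cod Q f"
  then have g: "g \<in> Hom Q (Cod Q f) (Cod Q g)" by (simp add: Hom_def)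
  have "component (Ga g \<cdot>\<^bsub>V\<^esub> Ga f) (A, \<one>) = component (Ga g) (A, \<one>) \<cdot>\<^bsub>set_cat\<^esub> component (Ga f) (A, \<one>)" if "A \<in> Obj C" for A
    using that by (cases "Ga g"; cases "Ga f") (simp add: Mod_sel functor_Comp component_def bi_cat_sel unit_Obj)
  then show "Fa EG (g \<bullet> f) = Fa EG g \<cdot>\<^bsub>PC\<^esub> Fa EG f"
    unfolding EG_sel(2)[OF f] EG_sel(2)[OF g] EG_sel(2)[OF Q.Comp_Hom[OF f g]] psh_Comp Ga_Comp[OF f g]
    by (auto intro!: restrict_ext)
qed

lemma Fo_hom_psh: "A \<in> Obj C \<Longrightarrow> Fo (hom_psh W) A = DMor ` Hom Q [A] W"
  by (simp add: hom_psh_def)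

lemma app_Fa_hom_psh: "h \<in> Hom C A B \<Longrightarrow> x \<in> Hom Q [B] W \<Longrightarrow> app (Fa (hom_psh W) h) (DMor x) = DMor (x \<bullet> emb h)"
  by (auto simp: hom_psh_def Hom_def app_mk_fun)

lemma OT_Hom:
  assumes w: "w \<in> Hom Q U W"
  shows "Fa OT w \<in> Hom PC (hom_psh U) (hom_psh W)"
proof -
  have o: "U \<in> words C" "W \<in> words C" using Q_HomD[OF w] by auto
  let ?m = "\<lambda>A. mk_fun (DMor ` Hom Q [A] U) (\<lambda>z. case z of DMor x \<Rightarrow> DMor (w \<bullet> x)) (DMor ` Hom Q [A] W) :: ('o, 'm) sarr"
  have n: "app (?m A) (app (Fa (hom_psh U) h) z) = app (Fa (hom_psh W) h) (app (?m B) z)"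
    if h: "h \<in> Hom C A B" and z: "z \<in> Fo (hom_psh U) B" for A B h z
  proof -
    obtain x where x: "z = DMor x" "x \<in> Hom Q [B] U"
      using z HomD[OF h] by (auto simp: Fo_hom_psh)
    have "x \<bullet> emb h \<in> Hom Q [A] U" "w \<bullet> x \<in> Hom Q [B] W"
      by (rule Q.Comp_Hom[OF emb_Hom[OF h] x(2)], rule Q.Comp_Hom[OF x(2) w])
    then show ?thesis
      using x(2) by (simp add: x(1) app_Fa_hom_psh[OF h] app_mk_fun Q.Comp_assoc[OF emb_Hom[OF h] x(2) w])
  qed
  show ?thesis
    unfolding OT_sel(2)[OF w]
    by (rule psh_arrI[OF hom_psh_functor[OF o(1)] hom_psh_functor[OF o(2)] _ n])
      (auto simp: Fo_hom_psh intro!: mk_fun_Hom Q.Comp_Hom[OF _ w])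
qed

lemma OT_functor: "is_functor Q PC OT"
  unfolding is_functor_def
proof (intro conjI ballI impI)
  show "Fo OT \<in> extensional (Obj Q)" "Fa OT \<in> extensional (Arr Q)"
    by (simp_all add: Omega_tilde_def Let_def)
next
  fix U assume "U \<in> Obj Q"
  then have U: "U \<in> words C" by simp
  show "Fo OT U \<in> Obj PC"
    using hom_psh_functor[OF U] by (simp add: OT_sel(1)[OF U] psh_cat_def functor_cat_def)
  have I: "Id Q U \<in> Hom Q U U" using Q.Id_Hom[of U] U by simp
  have "mk_fun (DMor ` Hom Q [A] U) (\<lambda>z. case z of DMor x \<Rightarrow> DMor (Id Q U \<bullet> x)) (DMor ` Hom Q [A] U) =
      (Id set_cat (DMor ` Hom Q [A] U) :: ('o, 'm) sarr)" for A
    unfolding set_Id mk_fun_def by (auto simp: Q.Id_Comp intro!: restrict_ext)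
  then show "Fa OT (Id Q U) = Id PC (Fo OT U)"
    unfolding OT_sel(1)[OF U] OT_sel(2)[OF I] psh_Id by (auto simp: Fo_hom_psh intro!: restrict_ext)
next
  fix f assume "f \<in> Arr Q"
  then have f: "f \<in> Hom Q (Dom Q f) (Cod Q f)" by (rule Q.Arr_Hom)
  show "Fa OT f \<in> Hom PC (Fo OT (Dom Q f)) (Fo OT (Cod Q f))"
    using OT_Hom[OF f] Q_HomD[OF f] by (simp add: OT_sel(1))
  fix g assume "g \<in> Arr Q" "Dom Q g = Cod Q f"
  then have g: "g \<in> Hom Q (Cod Q f) (Cod Q g)" by (simp add: Hom_def)
  have "mk_fun (DMor ` Hom Q [A] (Dom Q f)) (\<lambda>z. case z of DMor x \<Rightarrow> DMor ((g \<bullet> f) \<bullet> x)) (DMor ` Hom Q [A] (Cod Q g)) =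
     (mk_fun (DMor ` Hom Q [A] (Cod Q f)) (\<lambda>z. case z of DMor x \<Rightarrow> DMor (g \<bullet> x)) (DMor ` Hom Q [A] (Cod Q g)) \<cdot>\<^bsub>set_cat\<^esub>
     mk_fun (DMor ` Hom Q [A] (Dom Q f)) (\<lambda>z. case z of DMor x \<Rightarrow> DMor (f \<bullet> x)) (DMor ` Hom Q [A] (Cod Q f)) :: ('o, 'm) sarr)" for A
    unfolding mk_fun_def set_cat_Comp
    using Q.Comp_Hom[OF _ f] by (auto simp: Q.Comp_assoc[OF _ f g] intro!: restrict_ext)
  then show "Fa OT (g \<bullet> f) = Fa OT g \<cdot>\<^bsub>PC\<^esub> Fa OT f"
    unfolding OT_sel(2)[OF f] OT_sel(2)[OF g] OT_sel(2)[OF Q.Comp_Hom[OF f g]] psh_Comp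
    by (auto intro!: restrict_ext)
qed

abbreviation "zeta_comp W A \<equiv> mk_fun (Fo (Fo EG W) A) (zeta_fun C J \<phi> \<theta> W A) (Fo (Fo OT W) A)"

section \<open>The components of zeta\<close>

lemma zeta_comp_eq:
  assumes "W \<in> words C" "A \<in> Obj C"
  shows "zeta_comp W A = mk_fun (Fo (Go W) (A, \<one>)) (zeta_fun C J \<phi> \<theta> W A) (DMor ` Hom Q [A] W)"
  using assms by (simp add: EG_sel OT_sel eval_psh_def Fo_hom_psh)

lemma zeta_comp_Hom:
  assumes "W \<in> words C" "A \<in> Obj C"
  shows "zeta_comp W A \<in> Hom set_cat (Fo (Fo EG W) A) (Fo (Fo OT W) A)"
proof (rule mk_fun_Hom, rule funcsetI)
  fix x assume "x \<in> Fo (Fo EG W) A"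
  then have "x \<in> Fo (Go W) (A, \<one>)"
    using assms by (simp add: EG_sel eval_psh_def)
  then show "zeta_fun C J \<phi> \<theta> W A x \<in> Fo (Fo OT W) A"
    using assms by (auto simp: OT_sel Fo_hom_psh elim!: transport_zeta[OF assms])
qed

lemma zeta_comp_is_iso:
  assumes W: "W \<in> words C" and A: "A \<in> Obj C"
  shows "is_iso set_cat (zeta_comp W A)"
proof (rule set_is_iso[OF zeta_comp_Hom[OF W A]])
  let ?z = "zeta_fun C J \<phi> \<theta> W A"
  have S: "Fo (Fo EG W) A = Fo (Go W) (A, \<one>)" "Fo (Fo OT W) A = DMor ` Hom Q [A] W"
    using W A by (simp_all add: EG_sel OT_sel eval_psh_def Fo_hom_psh)
  have "inj_on ?z (Fo (Go W) (A, \<one>))"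
    by (rule inj_onI) (metis transport_zeta[OF W A] elt.inject(2))
  moreover have "?z ` Fo (Go W) (A, \<one>) = DMor ` Hom Q [A] W"
    by (auto elim!: transport_zeta[OF W A]) (metis imageI transport_in zeta_transport)
  ultimately have "bij_betw ?z (Fo (Fo EG W) A) (Fo (Fo OT W) A)"
    by (simp add: bij_betw_def S)
  then show "bij_betw (app (zeta_comp W A)) (Fo (Fo EG W) A) (Fo (Fo OT W) A)"
    by (rule bij_betw_cong[THEN iffD1, rotated]) (simp add: app_mk_fun)
qed

text \<open>Naturality in \<open>A\<close>, transferred from the inverse: with \<open>x\<close>
  written as a transport, restriction along \<open>h\<close> is composition with
  \<open>emb h\<close> by \<open>transport_pre\<close>, and zeta recovers the arrow.\<close>

lemma zeta_component_Hom:
  assumes W: "W \<in> words C"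
  shows "(Fo EG W, \<lambda>A \<in> Obj C. zeta_comp W A, Fo OT W) \<in> Hom PC (Fo EG W) (Fo OT W)"
proof (rule psh_arrI)
  show "is_functor (op_cat C) set_cat (Fo EG W)" "is_functor (op_cat C) set_cat (Fo OT W)"
    using eval_psh_functor[OF Go_bimodule[OF W]] hom_psh_functor[OF W] W by (simp_all add: EG_sel OT_sel)
  fix A B h x assume h: "h \<in> Hom C A B" and x: "x \<in> Fo (Fo EG W) B"
  have o: "A \<in> Obj C" "B \<in> Obj C" using HomD[OF h] by auto
  have x': "x \<in> Fo (Go W) (B, \<one>)"
    using x W o by (simp add: EG_sel eval_psh_def)
  then obtain w where w: "w \<in> Hom Q [B] W" "zeta_fun C J \<phi> \<theta> W B x = DMor w" "transport B w = x"
    by (rule transport_zeta[OF W o(2)])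
  have wh: "w \<bullet> emb h \<in> Hom Q [A] W"
    by (rule Q.Comp_Hom[OF emb_Hom[OF h] w(1)])
  have a: "app (Fa (Fo EG W) h) x = transport A (w \<bullet> emb h)"
    unfolding transport_pre[OF w(1) h] using HomD[OF h] by (simp add: EG_sel(1)[OF W] eval_psh_def act_def w(3))
  show "app (zeta_comp W A) (app (Fa (Fo EG W) h) x) = app (Fa (Fo OT W) h) (app (zeta_comp W B) x)"
    unfolding a zeta_comp_eq[OF W o(1)] zeta_comp_eq[OF W o(2)] app_mk_fun[OF x'] app_mk_fun[OF transport_in[OF wh]] zeta_transport[OF wh] w(2)
    by (simp add: OT_sel(1)[OF W] app_Fa_hom_psh[OF h w(1)])
qed (rule zeta_comp_Hom[OF W])

lemma zeta_eq: "zeta C J \<Gamma> \<phi> \<theta> = (EG, \<lambda>W \<in> words C. (Fo EG W, \<lambda>A \<in> Obj C. zeta_comp W A, Fo OT W), OT)"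
  by (simp add: zeta_def Let_def)

text \<open>The same transfer for naturality in \<open>W\<close>, now with
  \<open>transport_post\<close>: the action of \<open>w\<close> on a transport is the transport of a
  composite.\<close>

lemma zeta_natural:
  assumes w: "w \<in> Hom Q U W"
  shows "Fa OT w \<cdot>\<^bsub>PC\<^esub> (Fo EG U, \<lambda>A \<in> Obj C. zeta_comp U A, Fo OT U) =
    (Fo EG W, \<lambda>A \<in> Obj C. zeta_comp W A, Fo OT W) \<cdot>\<^bsub>PC\<^esub> Fa EG w"
proof -
  interpret PC: category PC by (rule PC_category)
  have o: "U \<in> words C" "W \<in> words C" using Q_HomD[OF w] by auto
  note F = OT_Hom[OF w, folded OT_sel(1)[OF o(1)] OT_sel(1)[OF o(2)]] EG_Hom[OF w, folded EG_sel(1)[OF o(1)] EG_sel(1)[OF o(2)]]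
  note c = PC.Comp_Hom[OF zeta_component_Hom[OF o(1)] F(1)] PC.Comp_Hom[OF F(2) zeta_component_Hom[OF o(2)]]
  show ?thesis
    using c unfolding OT_sel(2)[OF w] EG_sel(2)[OF w] psh_Comp EG_sel(1)[OF o(1)] OT_sel(1)[OF o(2)]
  proof (rule psh_arr_eqI)
    fix A x assume A: "A \<in> Obj C" and "x \<in> Fo (eval_psh (Go U)) A"
    then have x: "x \<in> Fo (Go U) (A, \<one>)"
      by (simp add: eval_psh_def)
    then obtain v where v: "v \<in> Hom Q [A] U" "zeta_fun C J \<phi> \<theta> U A x = DMor v" "transport A v = x"
      by (rule transport_zeta[OF o(1) A])
    have wv: "w \<bullet> v \<in> Hom Q [A] W"
      by (rule Q.Comp_Hom[OF v(1) w])
    have a: "app (component (Ga w) (A, \<one>)) x = transport A (w \<bullet> v)"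
      unfolding transport_post[OF v(1) w] by (simp add: ev_def v(3))
    show "app ((\<lambda>A \<in> Obj C. (\<lambda>A \<in> Obj C. mk_fun (DMor ` Hom Q [A] U) (\<lambda>z. case z of DMor x \<Rightarrow> DMor (w \<bullet> x)) (DMor ` Hom Q [A] W)) A \<cdot>\<^bsub>set_cat\<^esub>
            (\<lambda>A \<in> Obj C. mk_fun (Fo (eval_psh (Go U)) A) (zeta_fun C J \<phi> \<theta> U A) (Fo (Fo OT U) A)) A) A) x =
          app ((\<lambda>A \<in> Obj C. (\<lambda>A \<in> Obj C. mk_fun (Fo (Fo EG W) A) (zeta_fun C J \<phi> \<theta> W A) (Fo (hom_psh W) A)) A \<cdot>\<^bsub>set_cat\<^esub>
            (\<lambda>A \<in> Obj C. component (Ga w) (A, \<one>)) A) A) x"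
      using A x v(1) wv transport_in[OF wv] fst_set_arr[OF component_Hom[OF Ga_Hom[OF w] A unit_Obj]]
      by (simp add: app_Comp app_mk_fun eval_psh_def v(2) a zeta_transport[OF wv] EG_sel(1)[OF o(2)])
  qed
qed

lemma zeta_Hom: "zeta C J \<Gamma> \<phi> \<theta> \<in> Hom (functor_cat Q PC) EG OT"
proof -
  have "nat_trans Q PC EG OT (\<lambda>W \<in> words C. (Fo EG W, \<lambda>A \<in> Obj C. zeta_comp W A, Fo OT W))"
    unfolding nat_trans_def
  proof (intro conjI ballI)
    fix f assume f: "f \<in> Arr Q"
    show "Fa OT f \<cdot>\<^bsub>PC\<^esub> (\<lambda>W \<in> words C. (Fo EG W, \<lambda>A \<in> Obj C. zeta_comp W A, Fo OT W)) (Dom Q f) =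
        (\<lambda>W \<in> words C. (Fo EG W, \<lambda>A \<in> Obj C. zeta_comp W A, Fo OT W)) (Cod Q f) \<cdot>\<^bsub>PC\<^esub> Fa EG f"
      using zeta_natural[OF Q.Arr_Hom[OF f]] Q_HomD[OF Q.Arr_Hom[OF f]] by simp
  qed (simp add: zeta_component_Hom)
  then show ?thesis
    unfolding zeta_eq using EG_functor OT_functor by (simp add: functor_Hom)
qed

text \<open>Invertibility is checked componentwise at two levels, over the objects of C[J^v] and
  then over those of \<open>C\<close>, which leaves bijections of sets.\<close>

lemma zeta_is_iso: "is_iso (functor_cat Q PC) (zeta C J \<Gamma> \<phi> \<theta>)"
proof -
  interpret QP: two_categories Q PC
    by (intro two_categories.intro Q_category PC_category)
  interpret CS: two_categories "op_cat C" set_cat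
    by (rule two_categories_psh)
  show ?thesis
    unfolding zeta_eq
  proof (rule QP.functor_is_iso)
    show "(EG, \<lambda>W \<in> words C. (Fo EG W, \<lambda>A \<in> Obj C. zeta_comp W A, Fo OT W), OT) \<in> Hom (functor_cat Q PC) EG OT"
      using zeta_Hom by (simp only: zeta_eq)
    fix W assume "W \<in> Obj Q"
    then have W: "W \<in> words C" by simp
    have "is_iso PC (Fo EG W, \<lambda>A \<in> Obj C. zeta_comp W A, Fo OT W)"
      unfolding psh_cat_def
      by (rule CS.functor_is_iso[OF zeta_component_Hom[OF W, unfolded psh_cat_def]]) (simp add: op_sel zeta_comp_is_iso[OF W])
    then show "is_iso PC ((\<lambda>W \<in> words C. (Fo EG W, \<lambda>A \<in> Obj C. zeta_comp W A, Fo OT W)) W)"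
      using W by simp
  qed
qed

end

theorem theorem18:
  fixes C :: "('o, 'm) smcat" and J :: 'o
    and \<Gamma> :: "('o, 'm) Gamma_functor"
    and \<phi> :: "'o list \<Rightarrow> 'o list \<Rightarrow> ('o, 'm) mod_arr"
    and \<phi>0 :: "('o, 'm) mod_arr"
    and \<theta> :: "'o \<Rightarrow> ('o, 'm) mod_arr"
  assumes "strict_monoidal_category C"
    and "J \<in> Obj C"
    and "is_Gamma C J \<Gamma> \<phi> \<phi>0 \<theta>"
  shows "zeta C J \<Gamma> \<phi> \<theta> \<in> Hom (functor_cat (adjoin_dual C J) (psh_cat C))
           (comp_functor (adjoin_dual C J) (Ev_unit C) \<Gamma>) (Omega_tilde C J)
         \<and> is_iso (functor_cat (adjoin_dual C J) (psh_cat C)) (zeta C J \<Gamma> \<phi> \<theta>)"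
proof -
  interpret Gamma_data C J \<Gamma> \<phi> \<phi>0 \<theta>
    using assms by (intro Gamma_data.intro adjoined_dual.intro adjoined_dual_axioms.intro Gamma_data_axioms.intro)
  show ?thesis
    using zeta_Hom zeta_is_iso by blast
qed

end
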